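(* Let $\Omega_1\subset\mathbb{R}^{N_1}$ and $\Omega_2\subset\mathbb{R}^{N_2}$ be regions satisfying (B1) and (B2), let $b_2$ satisfy (B3) on $\partial\Omega_2$, and let $\Omega_p:=\Omega_1\times\Omega_2$ and $V:=H_0^1(\Omega_1)\otimes H^1(\Omega_2)$. Let $\{\lambda_{1j}\}_{j\in\mathbb{N}}$, $\{e_{1j}\}_{j\in\mathbb{N}}$ be the Dirichlet Laplacian eigenvalues and eigenfunctions on $\Omega_1$, let $\{\delta_{2k}\}_{k\in\mathbb{N}_0}$, $\{s_{2k}\}_{k\in\mathbb{N}_0}$ be the harmonic Steklov eigenvalues and eigenfunctions on $\Omega_2$ with weight $b_2$, and put $u_{jk}:=e_{1j}\otimes s_{2k}$ for $j\in\mathbb{N}$, $k\in\mathbb{N}_0$. Then each $u_{jk}$ is a Dirichlet–Steklov Laplacian (DSL) eigenfunction on $\Omega_p$ corresponding to the eigenpair $(\lambda_{1j},\delta_{2k})$.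
   Context: A region is a nonempty, connected, open subset of $\mathbb{R}^N$; $\mathbb{N}_0:=\mathbb{N}\cup\{0\}$. All function spaces are real; $\sigma$ denotes $(N-1)$-dimensional Hausdorff measure on a boundary ($\sigma_2$ the one on $\partial\Omega_2$), and in boundary integrals functions are replaced by their traces. Condition (B1) on a region $\Omega\subset\mathbb{R}^N$: $\Omega$ is bounded and its boundary $\partial\Omega:=\overline{\Omega}\setminus\Omega$ is the union of a finite number of disjoint closed Lipschitz surfaces, each having finite surface area. Condition (B2): $\Omega$ satisfies (B1); the imbedding of $H^1(\Omega)$ into $L^p(\Omega)$ is compact for $1\le p<p_s$, where $p_s=2N/(N-2)$ if $N\ge3$ and $p_s=\infty$ if $N=2$ (Rellich theorem); and the trace map $\gamma:H^1(\Omega)\to L^2(\partial\Omega,d\sigma)$ is compact ($L^2$-compact trace theorem). Condition (B3) on $b:\partial\Omega\to(0,\infty)$: $b$ is Borel measurable, $b\in L^\infty(\partial\Omega,d\sigma)$ and $b\ge b_0>0$ $\sigma$-a.e. for some constant $b_0$. Tensor products: $(e\otimes f)(x,y):=e(x)f(y)$. For real separable Hilbert spaces $H_1\subset L^2(\Omega_1)$, $H_2\subset L^2(\Omega_2)$ with orthonormal bases $\{e_j\}$, $\{f_k\}$, the Hilbert tensor product $H_1\otimes H_2$ is the completion of the space of finite linear combinations $\sum\hat g_{jk}\,e_j\otimes f_k$ under $\langle g,h\rangle_\otimes:=\sum_{j,k}\hat g_{jk}\hat h_{jk}$; its elements are the functions $g(x,y)=\sum_{j,k}\hat g_{jk}e_j(x)f_k(y)$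 with $\sum_{j,k}\hat g_{jk}^2<\infty$. In $V$, $H_0^1(\Omega_1)$ carries the inner product $\int_{\Omega_1}\nabla u\cdot\nabla v\,dx$ and $H^1(\Omega_2)$ its standard inner product (or any equivalent one). Dirichlet eigendata on $\Omega_1$: pairs $(\lambda_{1j},e_{1j})$ with $e_{1j}\in H_0^1(\Omega_1)$, $\int_{\Omega_1}\nabla e_{1j}\cdot\nabla h\,dx=\lambda_{1j}\int_{\Omega_1}e_{1j}h\,dx$ for all $h\in H_0^1(\Omega_1)$; the $\lambda_{1j}>0$ are all the eigenvalues repeated according to multiplicity, $\lambda_{1j}\to\infty$, and $\{e_{1j}\}$ is an orthonormal basis of $L^2(\Omega_1)$. Harmonic Steklov eigendata on $\Omega_2$ with weight $b_2$: pairs $(\delta_{2k},s_{2k})$ with $0\ne s_{2k}\in H^1(\Omega_2)$ and $\int_{\Omega_2}\nabla s_{2k}\cdot\nabla h\,dy=\delta_{2k}\int_{\partial\Omega_2}b_2\,s_{2k}\,h\,d\sigma_2$ for all $h\in H^1(\Omega_2)$, where $\delta_{20}=0$, $s_{20}\equiv1$, and $\{\delta_{2k}\}_{k\ge1}$ is the increasing sequence of strictly positive Steklov eigenvalues with eigenfunctions $s_{2k}$, $k\ge1$, orthonormal for $[u,v]_{b_2}:=\int_{\Omega_2}\nabla u\cdot\nabla v\,dy+\int_{\partial\Omega_2}b_2uv\,d\sigma_2$; $\{s_{2k}\}_{k\ge0}$ is a maximal orthogonal set in the $[\cdot,\cdot]_{b_2}$-orthogonal complement of $H_0^1(\Omega_2)$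 in $H^1(\Omega_2)$. DSL eigenproblem on $\Omega_p$: find $(\lambda,\delta,u)\in\mathbb{R}^2\times V$, $u\ne0$, with $$\int_{\Omega_p}\nabla u\cdot\nabla h\,dx\,dy=\lambda\int_{\Omega_p}u\,h\,dx\,dy+\delta\int_{\Omega_1}\int_{\partial\Omega_2}b_2\,u\,h\,d\sigma_2\,dx\quad\text{for all }h\in V;$$ $u$ is then called a DSL eigenfunction corresponding to the eigenpair $(\lambda,\delta)$. *)

theory Defs
  imports "HOL-Analysis.Analysis"
begin

section \<open>Square-integrable and p-integrable functions\<close>

text \<open>
  Elements of function spaces are represented by real functions on the whole ambient type; only
  their values on the domain matter, and they are identified when they agree almost everywhere
  there. Lebesgue spaces over an open set \<open>\<Omega>\<close> are taken over \<open>lebesgue_on \<Omega>\<close>.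
\<close>

definition L2 :: "'x measure \<Rightarrow> ('x \<Rightarrow> real) set" where
  "L2 M = {f \<in> borel_measurable M. integrable M (\<lambda>x. (f x)\<^sup>2)}"

definition L2_inner :: "'x measure \<Rightarrow> ('x \<Rightarrow> real) \<Rightarrow> ('x \<Rightarrow> real) \<Rightarrow> real" where
  "L2_inner M f g = (\<integral>x. f x * g x \<partial>M)"

definition L2_norm :: "'x measure \<Rightarrow> ('x \<Rightarrow> real) \<Rightarrow> real" where
  "L2_norm M f = sqrt (L2_inner M f f)"

definition Lp :: "'x measure \<Rightarrow> real \<Rightarrow> ('x \<Rightarrow> real) set" where
  "Lp M p = {f \<in> borel_measurable M. integrable M (\<lambda>x. \<bar>f x\<bar> powr p)}"

definition Lp_norm :: "'x measure \<Rightarrow> real \<Rightarrow> ('x \<Rightarrow> real) \<Rightarrow> real" where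
  "Lp_norm M p f = (\<integral>x. \<bar>f x\<bar> powr p \<partial>M) powr (1 / p)"

definition compact_map ::
    "('x \<Rightarrow> real) set \<Rightarrow> (('x \<Rightarrow> real) \<Rightarrow> real) \<Rightarrow> ('y \<Rightarrow> real) set \<Rightarrow> (('y \<Rightarrow> real) \<Rightarrow> real)
      \<Rightarrow> (('x \<Rightarrow> real) \<Rightarrow> ('y \<Rightarrow> real)) \<Rightarrow> bool" where
  "compact_map X normX Y normY T \<longleftrightarrow>
     (\<forall>u\<in>X. T u \<in> Y) \<and>
     (\<forall>u :: nat \<Rightarrow> 'x \<Rightarrow> real. (\<forall>n. u n \<in> X) \<and> bounded (range (\<lambda>n. normX (u n))) \<longrightarrow>
        (\<exists>(r :: nat \<Rightarrow> nat) v. strict_mono r \<and> v \<in> Y \<and>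
           (\<lambda>n. normY (\<lambda>y. T (u (r n)) y - v y)) \<longlonglongrightarrow> 0))"


section \<open>Sobolev spaces\<close>

primrec C_k :: "nat \<Rightarrow> ('a::euclidean_space \<Rightarrow> real) \<Rightarrow> bool" where
  "C_k 0 f \<longleftrightarrow> continuous_on UNIV f"
| "C_k (Suc k) f \<longleftrightarrow> f differentiable_on UNIV \<and>
     (\<forall>i\<in>Basis. C_k k (\<lambda>x. frechet_derivative f (at x) i))"

definition test_functions :: "'a::euclidean_space set \<Rightarrow> ('a \<Rightarrow> real) set" where
  "test_functions \<Omega> = {\<phi>. (\<forall>k. C_k k \<phi>) \<and>
     compact (closure {x. \<phi> x \<noteq> 0}) \<and> closure {x. \<phi> x \<noteq> 0} \<subseteq> \<Omega>}"

definition locally_integrable :: "'a::euclidean_space set \<Rightarrow> ('a \<Rightarrow> 'c::euclidean_space) \<Rightarrow> bool" where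
  "locally_integrable \<Omega> f \<longleftrightarrow> (\<forall>K. compact K \<and> K \<subseteq> \<Omega> \<longrightarrow> f absolutely_integrable_on K)"

definition has_weak_gradient ::
    "'a::euclidean_space set \<Rightarrow> ('a \<Rightarrow> real) \<Rightarrow> ('a \<Rightarrow> 'a) \<Rightarrow> bool" where
  "has_weak_gradient \<Omega> u G \<longleftrightarrow> locally_integrable \<Omega> u \<and> locally_integrable \<Omega> G \<and>
     (\<forall>\<phi>\<in>test_functions \<Omega>. \<forall>i\<in>Basis.
        (\<integral>x. u x * frechet_derivative \<phi> (at x) i \<partial>lebesgue_on \<Omega>) =
        - (\<integral>x. (G x \<bullet> i) * \<phi> x \<partial>lebesgue_on \<Omega>))"

text \<open>Weak gradients are unique up to null sets, so the choice below is immaterial.\<close>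

definition weak_gradient :: "'a::euclidean_space set \<Rightarrow> ('a \<Rightarrow> real) \<Rightarrow> 'a \<Rightarrow> 'a" where
  "weak_gradient \<Omega> u = (SOME G. has_weak_gradient \<Omega> u G)"

definition H1 :: "'a::euclidean_space set \<Rightarrow> ('a \<Rightarrow> real) set" where
  "H1 \<Omega> = {u \<in> L2 (lebesgue_on \<Omega>). \<exists>G. has_weak_gradient \<Omega> u G \<and>
     G \<in> borel_measurable (lebesgue_on \<Omega>) \<and> integrable (lebesgue_on \<Omega>) (\<lambda>x. (norm (G x))\<^sup>2)}"

definition dirichlet_form :: "'a::euclidean_space set \<Rightarrow> ('a \<Rightarrow> real) \<Rightarrow> ('a \<Rightarrow> real) \<Rightarrow> real" where
  "dirichlet_form \<Omega> u v = (\<integral>x. weak_gradient \<Omega> u x \<bullet> weak_gradient \<Omega> v x \<partial>lebesgue_on \<Omega>)"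

definition H1_inner :: "'a::euclidean_space set \<Rightarrow> ('a \<Rightarrow> real) \<Rightarrow> ('a \<Rightarrow> real) \<Rightarrow> real" where
  "H1_inner \<Omega> u v = L2_inner (lebesgue_on \<Omega>) u v + dirichlet_form \<Omega> u v"

definition H1_norm :: "'a::euclidean_space set \<Rightarrow> ('a \<Rightarrow> real) \<Rightarrow> real" where
  "H1_norm \<Omega> u = sqrt (H1_inner \<Omega> u u)"

definition H10 :: "'a::euclidean_space set \<Rightarrow> ('a \<Rightarrow> real) set" where
  "H10 \<Omega> = {u \<in> H1 \<Omega>. \<exists>\<phi> :: nat \<Rightarrow> 'a \<Rightarrow> real. (\<forall>n. \<phi> n \<in> test_functions \<Omega>) \<and>
     (\<lambda>n. H1_norm \<Omega> (\<lambda>x. u x - \<phi> n x)) \<longlonglongrightarrow> 0}"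


section \<open>Hausdorff measure, boundaries and traces\<close>

text \<open>
  The size of a covering set \<open>S\<close> is \<open>\<alpha>(m) (diam S / 2)^m\<close> with \<open>\<alpha>(m)\<close> the volume of the unit ball
  of dimension \<open>m\<close>, so that the measure agrees with surface area. The empty set has size 0 also for
  \<open>m = 0\<close>, and the boundedness requirement below is needed because \<open>diameter\<close> is unspecified on
  unbounded sets.
\<close>

definition hausdorff_size :: "nat \<Rightarrow> 'a::euclidean_space set \<Rightarrow> ennreal" where
  "hausdorff_size m S =
     (if S = {} then 0 else ennreal (unit_ball_vol (real m) * (diameter S / 2) ^ m))"

definition hausdorff_outer :: "nat \<Rightarrow> 'a::euclidean_space set \<Rightarrow> ennreal" where
  "hausdorff_outer m A = (SUP d\<in>{0<..}. INF C\<in>{C :: nat \<Rightarrow> 'a set.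
     A \<subseteq> (\<Union>i. C i) \<and> (\<forall>i. bounded (C i) \<and> diameter (C i) \<le> d)}. \<Sum>i. hausdorff_size m (C i))"

definition hausdorff_measure :: "nat \<Rightarrow> 'a::euclidean_space measure" where
  "hausdorff_measure m = measure_of UNIV (sets borel) (hausdorff_outer m)"

definition bdry :: "'a::euclidean_space set \<Rightarrow> 'a set" where
  "bdry \<Omega> = closure \<Omega> - \<Omega>"

definition surface_measure :: "'a::euclidean_space set \<Rightarrow> 'a measure" where
  "surface_measure \<Omega> = restrict_space (hausdorff_measure (DIM('a) - 1)) (bdry \<Omega>)"

text \<open>
  Closed (compact, without boundary) Lipschitz surface: near each of its points it is the graph, over
  the hyperplane orthogonal to some unit vector \<open>\<nu>\<close>, of a Lipschitz function.
\<close>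

definition closed_lipschitz_surface :: "'a::euclidean_space set \<Rightarrow> bool" where
  "closed_lipschitz_surface S \<longleftrightarrow> compact S \<and>
     (\<forall>x\<in>S. \<exists>U \<nu> (g :: 'a \<Rightarrow> real) L. open U \<and> x \<in> U \<and> norm \<nu> = 1 \<and>
        L-lipschitz_on {z. z \<bullet> \<nu> = 0} g \<and>
        S \<inter> U = {y \<in> U. y \<bullet> \<nu> = g (y - (y \<bullet> \<nu>) *\<^sub>R \<nu>)})"

definition region :: "'a::euclidean_space set \<Rightarrow> bool" where
  "region \<Omega> \<longleftrightarrow> \<Omega> \<noteq> {} \<and> connected \<Omega> \<and> open \<Omega>"

definition cond_B1 :: "'a::euclidean_space set \<Rightarrow> bool" where
  "cond_B1 \<Omega> \<longleftrightarrow> bounded \<Omega> \<and>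
     (\<exists>\<S>. finite \<S> \<and> disjoint \<S> \<and> bdry \<Omega> = \<Union>\<S> \<and>
        (\<forall>S\<in>\<S>. closed_lipschitz_surface S \<and>
           emeasure (hausdorff_measure (DIM('a) - 1)) S < \<infinity>))"

text \<open>
  The trace map is the bounded linear map from \<open>H1\<close> to \<open>L2\<close> of the boundary that restricts functions
  continuous up to the boundary. On a bounded Lipschitz domain it is unique up to null sets.
\<close>

definition is_trace_map ::
    "'a::euclidean_space set \<Rightarrow> (('a \<Rightarrow> real) \<Rightarrow> ('a \<Rightarrow> real)) \<Rightarrow> bool" where
  "is_trace_map \<Omega> \<gamma> \<longleftrightarrow>
     (\<forall>u\<in>H1 \<Omega>. \<gamma> u \<in> L2 (surface_measure \<Omega>)) \<and>
     (\<forall>u\<in>H1 \<Omega>. \<forall>v\<in>H1 \<Omega>. \<forall>a b.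
        AE z in surface_measure \<Omega>. \<gamma> (\<lambda>x. a * u x + b * v x) z = a * \<gamma> u z + b * \<gamma> v z) \<and>
     (\<exists>C. \<forall>u\<in>H1 \<Omega>. L2_norm (surface_measure \<Omega>) (\<gamma> u) \<le> C * H1_norm \<Omega> u) \<and>
     (\<forall>u\<in>H1 \<Omega>. continuous_on (closure \<Omega>) u \<longrightarrow> (AE z in surface_measure \<Omega>. \<gamma> u z = u z))"

definition trace_map :: "'a::euclidean_space set \<Rightarrow> ('a \<Rightarrow> real) \<Rightarrow> ('a \<Rightarrow> real)" where
  "trace_map \<Omega> = (SOME \<gamma>. is_trace_map \<Omega> \<gamma>)"

text \<open>
  The bound on \<open>p\<close> says \<open>p < p\<^sub>s\<close>, where \<open>p\<^sub>s\<close> is \<open>2N/(N-2)\<close> in dimension \<open>N \<ge> 3\<close> and infinite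
  otherwise.
\<close>

definition cond_B2 :: "'a::euclidean_space set \<Rightarrow> bool" where
  "cond_B2 \<Omega> \<longleftrightarrow> cond_B1 \<Omega> \<and>
     (\<forall>p::real. 1 \<le> p \<and> (DIM('a) \<ge> 3 \<longrightarrow> p < 2 * real DIM('a) / (real DIM('a) - 2)) \<longrightarrow>
        compact_map (H1 \<Omega>) (H1_norm \<Omega>) (Lp (lebesgue_on \<Omega>) p) (Lp_norm (lebesgue_on \<Omega>) p) (\<lambda>u. u)) \<and>
     (\<exists>\<gamma>. is_trace_map \<Omega> \<gamma>) \<and>
     compact_map (H1 \<Omega>) (H1_norm \<Omega>) (L2 (surface_measure \<Omega>)) (L2_norm (surface_measure \<Omega>))
       (trace_map \<Omega>)"

definition cond_B3 :: "'a::euclidean_space set \<Rightarrow> ('a \<Rightarrow> real) \<Rightarrow> bool" where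
  "cond_B3 \<Omega> b \<longleftrightarrow> (\<forall>z\<in>bdry \<Omega>. 0 < b z) \<and>
     b \<in> borel_measurable (restrict_space borel (bdry \<Omega>)) \<and>
     (\<exists>C. AE z in surface_measure \<Omega>. \<bar>b z\<bar> \<le> C) \<and>
     (\<exists>b0>0. AE z in surface_measure \<Omega>. b0 \<le> b z)"

definition boundary_form ::
    "'a::euclidean_space set \<Rightarrow> ('a \<Rightarrow> real) \<Rightarrow> ('a \<Rightarrow> real) \<Rightarrow> ('a \<Rightarrow> real) \<Rightarrow> real" where
  "boundary_form \<Omega> b u v =
     (\<integral>z. b z * trace_map \<Omega> u z * trace_map \<Omega> v z \<partial>surface_measure \<Omega>)"


section \<open>Orthonormal bases and Hilbert tensor products\<close>

definition orthonormal_basis ::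
    "('x \<Rightarrow> real) set \<Rightarrow> (('x \<Rightarrow> real) \<Rightarrow> ('x \<Rightarrow> real) \<Rightarrow> real) \<Rightarrow> (nat \<Rightarrow> 'x \<Rightarrow> real) \<Rightarrow> bool" where
  "orthonormal_basis H ip e \<longleftrightarrow>
     (\<forall>j. e j \<in> H) \<and>
     (\<forall>i j. ip (e i) (e j) = (if i = j then 1 else 0)) \<and>
     (\<forall>u\<in>H. (\<lambda>n. let r = (\<lambda>x. u x - (\<Sum>j<n. ip u (e j) * e j x)) in sqrt (ip r r)) \<longlonglongrightarrow> 0)"

definition tensor_fun :: "('x \<Rightarrow> real) \<Rightarrow> ('y \<Rightarrow> real) \<Rightarrow> 'x \<times> 'y \<Rightarrow> real" where
  "tensor_fun e f = (\<lambda>(x, y). e x * f y)"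

text \<open>
  The completion is realised as a space of functions on \<open>\<Omega>1 \<times> \<Omega>2\<close>: sums, in the sense of
  \<open>L2\<close>-convergence, of \<open>c\<^sub>j\<^sub>k e\<^sub>j \<otimes> f\<^sub>k\<close> with square-summable coefficients. It does not depend on the
  choice of the orthonormal bases.
\<close>

definition hilbert_tensor ::
    "'a::euclidean_space set \<Rightarrow> ('a \<Rightarrow> real) set \<Rightarrow> (('a \<Rightarrow> real) \<Rightarrow> ('a \<Rightarrow> real) \<Rightarrow> real) \<Rightarrow>
     'b::euclidean_space set \<Rightarrow> ('b \<Rightarrow> real) set \<Rightarrow> (('b \<Rightarrow> real) \<Rightarrow> ('b \<Rightarrow> real) \<Rightarrow> real) \<Rightarrow>
     ('a \<times> 'b \<Rightarrow> real) set" where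
  "hilbert_tensor \<Omega>1 X1 ip1 \<Omega>2 X2 ip2 = {g \<in> L2 (lebesgue_on (\<Omega>1 \<times> \<Omega>2)).
     \<exists>e f (c :: nat \<times> nat \<Rightarrow> real).
       orthonormal_basis X1 ip1 e \<and> orthonormal_basis X2 ip2 f \<and>
       (\<lambda>jk. (c jk)\<^sup>2) summable_on UNIV \<and>
       ((\<lambda>F. L2_norm (lebesgue_on (\<Omega>1 \<times> \<Omega>2))
          (\<lambda>z. g z - (\<Sum>(j, k)\<in>F. c (j, k) * tensor_fun (e j) (f k) z))) \<longlongrightarrow> 0)
         (finite_subsets_at_top UNIV)}"


section \<open>Dirichlet and harmonic Steklov eigendata\<close>

definition nonzero_on :: "'a::euclidean_space set \<Rightarrow> ('a \<Rightarrow> real) \<Rightarrow> bool" where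
  "nonzero_on \<Omega> u \<longleftrightarrow> \<not> (AE x in lebesgue_on \<Omega>. u x = 0)"

definition in_ae_span :: "'a::euclidean_space set \<Rightarrow> (nat \<Rightarrow> 'a \<Rightarrow> real) \<Rightarrow> nat set \<Rightarrow> ('a \<Rightarrow> real) \<Rightarrow> bool" where
  "in_ae_span \<Omega> e J u \<longleftrightarrow> (\<exists>F (c :: nat \<Rightarrow> real). finite F \<and> F \<subseteq> J \<and>
     (AE x in lebesgue_on \<Omega>. u x = (\<Sum>j\<in>F. c j * e j x)))"

definition dirichlet_eigenpair :: "'a::euclidean_space set \<Rightarrow> real \<Rightarrow> ('a \<Rightarrow> real) \<Rightarrow> bool" where
  "dirichlet_eigenpair \<Omega> lam u \<longleftrightarrow> u \<in> H10 \<Omega> \<and> nonzero_on \<Omega> u \<and>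
     (\<forall>h\<in>H10 \<Omega>. dirichlet_form \<Omega> u h = lam * L2_inner (lebesgue_on \<Omega>) u h)"

text \<open>
  The index set of the Dirichlet sequence is \<open>nat\<close>, starting at 0. The span clause expresses that all
  eigenvalues are listed according to multiplicity; likewise in the Steklov case.
\<close>

definition dirichlet_eigendata ::
    "'a::euclidean_space set \<Rightarrow> (nat \<Rightarrow> real) \<Rightarrow> (nat \<Rightarrow> 'a \<Rightarrow> real) \<Rightarrow> bool" where
  "dirichlet_eigendata \<Omega> lam e \<longleftrightarrow>
     (\<forall>j. 0 < lam j \<and> dirichlet_eigenpair \<Omega> (lam j) (e j)) \<and>
     (\<forall>\<mu> u. dirichlet_eigenpair \<Omega> \<mu> u \<longrightarrow> in_ae_span \<Omega> e {j. lam j = \<mu>} u) \<and>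
     filterlim lam at_top sequentially \<and>
     orthonormal_basis (L2 (lebesgue_on \<Omega>)) (L2_inner (lebesgue_on \<Omega>)) e"

definition steklov_eigenpair ::
    "'b::euclidean_space set \<Rightarrow> ('b \<Rightarrow> real) \<Rightarrow> real \<Rightarrow> ('b \<Rightarrow> real) \<Rightarrow> bool" where
  "steklov_eigenpair \<Omega> b del s \<longleftrightarrow> s \<in> H1 \<Omega> \<and> nonzero_on \<Omega> s \<and>
     (\<forall>h\<in>H1 \<Omega>. dirichlet_form \<Omega> s h = del * boundary_form \<Omega> b s h)"

definition steklov_inner ::
    "'b::euclidean_space set \<Rightarrow> ('b \<Rightarrow> real) \<Rightarrow> ('b \<Rightarrow> real) \<Rightarrow> ('b \<Rightarrow> real) \<Rightarrow> real" where
  "steklov_inner \<Omega> b u v = dirichlet_form \<Omega> u v + boundary_form \<Omega> b u v"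

definition H10_complement :: "'b::euclidean_space set \<Rightarrow> ('b \<Rightarrow> real) \<Rightarrow> ('b \<Rightarrow> real) set" where
  "H10_complement \<Omega> b = {w \<in> H1 \<Omega>. \<forall>v\<in>H10 \<Omega>. steklov_inner \<Omega> b w v = 0}"

definition steklov_eigendata ::
    "'b::euclidean_space set \<Rightarrow> ('b \<Rightarrow> real) \<Rightarrow> (nat \<Rightarrow> real) \<Rightarrow> (nat \<Rightarrow> 'b \<Rightarrow> real) \<Rightarrow> bool" where
  "steklov_eigendata \<Omega> b del s \<longleftrightarrow>
     (\<forall>k. steklov_eigenpair \<Omega> b (del k) (s k)) \<and>
     del 0 = 0 \<and> (\<forall>y\<in>\<Omega>. s 0 y = 1) \<and>
     (\<forall>k\<ge>1. 0 < del k) \<and> (\<forall>k l. 1 \<le> k \<and> k \<le> l \<longrightarrow> del k \<le> del l) \<and>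
     (\<forall>\<mu> u. 0 < \<mu> \<and> steklov_eigenpair \<Omega> b \<mu> u \<longrightarrow> in_ae_span \<Omega> s {k. 1 \<le> k \<and> del k = \<mu>} u) \<and>
     (\<forall>k\<ge>1. \<forall>l\<ge>1. steklov_inner \<Omega> b (s k) (s l) = (if k = l then 1 else 0)) \<and>
     (\<forall>k. s k \<in> H10_complement \<Omega> b) \<and>
     (\<forall>k l. k \<noteq> l \<longrightarrow> steklov_inner \<Omega> b (s k) (s l) = 0) \<and>
     (\<forall>w\<in>H10_complement \<Omega> b. (\<forall>k. steklov_inner \<Omega> b w (s k) = 0) \<longrightarrow> \<not> nonzero_on \<Omega> w)"


section \<open>The Dirichlet--Steklov Laplacian eigenproblem\<close>

definition dsl_space :: "'a::euclidean_space set \<Rightarrow> 'b::euclidean_space set \<Rightarrow> ('a \<times> 'b \<Rightarrow> real) set" where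
  "dsl_space \<Omega>1 \<Omega>2 = hilbert_tensor \<Omega>1 (H10 \<Omega>1) (dirichlet_form \<Omega>1) \<Omega>2 (H1 \<Omega>2) (H1_inner \<Omega>2)"

text \<open>
  For \<open>u\<close> in \<open>dsl_space \<Omega>1 \<Omega>2\<close> almost every slice \<open>u(x, -)\<close> lies in \<open>H1 \<Omega>2\<close>; the boundary integral
  over \<open>\<Omega>1 \<times> \<partial>\<Omega>2\<close> uses the traces of these slices.
\<close>

definition dsl_boundary_form ::
    "'a::euclidean_space set \<Rightarrow> 'b::euclidean_space set \<Rightarrow> ('b \<Rightarrow> real) \<Rightarrow>
     ('a \<times> 'b \<Rightarrow> real) \<Rightarrow> ('a \<times> 'b \<Rightarrow> real) \<Rightarrow> real" where
  "dsl_boundary_form \<Omega>1 \<Omega>2 b u h =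
     (\<integral>x. boundary_form \<Omega>2 b (\<lambda>y. u (x, y)) (\<lambda>y. h (x, y)) \<partial>lebesgue_on \<Omega>1)"

definition dsl_eigenfunction ::
    "'a::euclidean_space set \<Rightarrow> 'b::euclidean_space set \<Rightarrow> ('b \<Rightarrow> real) \<Rightarrow> real \<times> real \<Rightarrow>
     ('a \<times> 'b \<Rightarrow> real) \<Rightarrow> bool" where
  "dsl_eigenfunction \<Omega>1 \<Omega>2 b = (\<lambda>(lam, del) u.
     u \<in> dsl_space \<Omega>1 \<Omega>2 \<and> nonzero_on (\<Omega>1 \<times> \<Omega>2) u \<and>
     (\<forall>h\<in>dsl_space \<Omega>1 \<Omega>2. dirichlet_form (\<Omega>1 \<times> \<Omega>2) u h =
        lam * L2_inner (lebesgue_on (\<Omega>1 \<times> \<Omega>2)) u h + del * dsl_boundary_form \<Omega>1 \<Omega>2 b u h))"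

end

theory Submission
  imports Defs
begin

text \<open>
  The identity to be shown is formally a separation of variables: for \<open>u = e \<otimes> s\<close> the gradient is
  \<open>(s \<nabla>e, e \<nabla>s)\<close>, and the Dirichlet equation for \<open>e\<close> turns the first component into \<open>\<lambda> \<langle>u, h\<rangle>\<close> while the
  Steklov equation for \<open>s\<close>, applied to the slices \<open>h (x, -)\<close>, turns the second one into \<open>\<delta>\<close> times the
  boundary form. The work lies in giving a meaning to this for every \<open>h\<close> in \<open>H10 \<Omega>1 \<otimes> H1 \<Omega>2\<close>, which
  is only known as an \<open>L2\<close> limit of sums \<open>\<Sum> c\<^sub>j\<^sub>k e\<^sub>j \<otimes> f\<^sub>k\<close> with square-summable coefficients.

  An energy estimate (\<open>tensor_gradient_energy_le\<close>) bounds the \<open>L2\<close> norm of the gradient of such a sum by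
  the coefficients; it uses the two orthonormality relations and the Poincare inequality, which is
  itself read off from the Dirichlet eigendata (\<open>poincare_inequality\<close>). By completeness of \<open>L2\<close>
  (\<open>Riesz_Fischer\<close>) the gradients of the partial sums converge, and since weak gradients are closed under
  \<open>L2\<close> limits, \<open>h\<close> has a weak gradient \<open>G\<close> (\<open>dsl_space_approximation\<close>). Fubini's theorem shows that along a
  subsequence almost every slice converges too, so that \<open>h (x, -)\<close> lies in \<open>H1 \<Omega>2\<close> with gradient the
  second component of \<open>G (x, -)\<close> (\<open>AE_L2_converges_slice\<close>). Then the first component is treated by
  passing to the limit in the partial sums and the second one slice by slice (\<open>dsl_weak_form\<close>). Of the
  trace map only homogeneity enters, because the Steklov equation already expresses \<open>\<delta>\<close> times the
  boundary form by the Dirichlet form.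

  That \<open>u\<close> itself belongs to the tensor product space requires orthonormal bases of \<open>H10 \<Omega>1\<close> and \<open>H1 \<Omega>2\<close>;
  the bases constructed here begin with multiples of \<open>e\<close> and of \<open>s\<close>, so that \<open>u\<close> is a one-term expansion.
  They come from the Gram-Schmidt process along a dense sequence, hence from separability of \<open>L2\<close>
  (\<open>L2_separable\<close>). Weak gradients are unique by the fundamental lemma of the calculus of variations,
  for which smooth bump functions approximating indicators of boxes are constructed.
\<close>


section \<open>Orthonormal bases of separable semi-inner product spaces of functions\<close>

text \<open>Gaussian elimination: more vectors than coordinates are linearly dependent.\<close>

lemma nontrivial_solution_of_underdetermined_system:
  fixes M :: "nat \<Rightarrow> nat \<Rightarrow> real"
  shows "\<exists>a. (\<exists>i\<le>n. a i \<noteq> 0) \<and> (\<forall>j<n. (\<Sum>i\<le>n. a i * M i j) = 0)"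
proof (induction n arbitrary: M)
  case 0
  show ?case by (rule exI[of _ "\<lambda>_. 1"]) auto
next
  case (Suc n)
  show ?case
  proof (cases "M (Suc n) n = 0 \<and> (\<forall>i\<le>n. M i n = 0)")
    case True
    obtain a i where a: "i \<le> n" "a i \<noteq> 0" "\<forall>j<n. (\<Sum>i\<le>n. a i * M i j) = 0"
      using Suc.IH[of M] by auto
    show ?thesis
      using a True by (intro exI[of _ "a(Suc n := 0)"]) (auto simp: less_Suc_eq intro!: exI[of _ i])
  next
    case False
    then obtain p where p: "p \<le> Suc n" "M p n \<noteq> 0" using le_Suc_eq by blast
    \<comment> \<open>The pivot row is moved to the last position and used to clear column \<open>n\<close>.\<close>
    define s where "s i = (if i = p then Suc n else if i = Suc n then p else i)" for i
    have s_bij: "bij_betw s {..Suc n} {..Suc n}"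
      by (rule bij_betwI[where g = s]) (use p in \<open>auto simp: s_def\<close>)
    have s_inv: "s (s i) = i" for i by (auto simp: s_def)
    define M' where "M' i j = M (s i) j - M (s i) n / M p n * M p j" for i j
    obtain a i where a: "i \<le> n" "a i \<noteq> 0" "\<forall>j<n. (\<Sum>i\<le>n. a i * M' i j) = 0"
      using Suc.IH[of M'] by auto
    define b where "b = a(Suc n := - (\<Sum>i\<le>n. a i * M (s i) n) / M p n)"
    have sum_b: "(\<Sum>i\<le>Suc n. b i * M (s i) j) = (\<Sum>i\<le>n. a i * M' i j)" for j
    proof -
      have "(\<Sum>i\<le>Suc n. b i * M (s i) j)
          = (\<Sum>i\<le>n. a i * M (s i) j) - (\<Sum>i\<le>n. a i * M (s i) n) / M p n * M p j"
        using p by (auto simp: b_def s_def)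
      also have "\<dots> = (\<Sum>i\<le>n. a i * M' i j)"
        by (simp add: M'_def right_diff_distrib sum_subtractf sum_distrib_right sum_divide_distrib mult.assoc)
      finally show ?thesis .
    qed
    have reindex: "(\<Sum>i\<le>Suc n. b (s i) * M i j) = (\<Sum>i\<le>Suc n. b i * M (s i) j)" for j
      using sum.reindex_bij_betw[OF s_bij, of "\<lambda>i. b (s i) * M i j"] by (simp add: s_inv)
    have "(\<Sum>i\<le>Suc n. b (s i) * M i j) = 0" if "j < Suc n" for j
    proof (cases "j = n")
      case True
      have "M' i n = 0" for i using p by (simp add: M'_def)
      then show ?thesis using True unfolding reindex sum_b by simp
    next
      case False
      then show ?thesis using that a unfolding reindex sum_b by simp
    qed
    moreover have "s i \<le> Suc n" "b (s (s i)) \<noteq> 0"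
      using a p by (auto simp: s_inv b_def) (auto simp: s_def)
    ultimately show ?thesis by (intro exI[of _ "\<lambda>i. b (s i)"]) blast
  qed
qed

text \<open>The discriminant argument behind the Cauchy-Schwarz inequality.\<close>

lemma square_le_of_nonneg_quadratic:
  fixes p q r :: real
  assumes "\<And>a b. 0 \<le> a\<^sup>2 * p + 2 * a * b * q + b\<^sup>2 * r"
  shows "q\<^sup>2 \<le> p * r"
proof (cases "r = 0")
  case True
  have "q = 0"
  proof (rule ccontr)
    assume "q \<noteq> 0"
    then show False using assms[of 1 "- (p + 1) / (2 * q)"] True by (simp add: field_simps)
  qed
  then show ?thesis using True by simp
next
  case False
  then have pos: "r > 0" using assms[of 0 1] by simp
  have "0 \<le> r * (p * r - q\<^sup>2)"
    using assms[of r "- q"] by (simp add: power2_eq_square algebra_simps)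
  then show ?thesis using pos by (simp add: zero_le_mult_iff)
qed

locale semi_inner_space =
  fixes X :: "('x \<Rightarrow> real) set" and ip :: "('x \<Rightarrow> real) \<Rightarrow> ('x \<Rightarrow> real) \<Rightarrow> real"
  assumes nonempty: "X \<noteq> {}"
    and lin: "\<And>u v a b. u \<in> X \<Longrightarrow> v \<in> X \<Longrightarrow> (\<lambda>x. a * u x + b * v x) \<in> X"
    and ip_lin: "\<And>u v w a b. u \<in> X \<Longrightarrow> v \<in> X \<Longrightarrow> w \<in> X \<Longrightarrow>
          ip (\<lambda>x. a * u x + b * v x) w = a * ip u w + b * ip v w"
    and ip_sym: "\<And>u v. u \<in> X \<Longrightarrow> v \<in> X \<Longrightarrow> ip u v = ip v u"
    and ip_nonneg: "\<And>u. u \<in> X \<Longrightarrow> 0 \<le> ip u u"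
begin

lemma zero_mem: "(\<lambda>x. 0) \<in> X"
  using nonempty lin[where a = 0 and b = 0] by fastforce

lemma scale_mem: "u \<in> X \<Longrightarrow> (\<lambda>x. a * u x) \<in> X"
  using lin[of u u a 0] by simp

lemma diff_mem: "u \<in> X \<Longrightarrow> v \<in> X \<Longrightarrow> (\<lambda>x. u x - v x) \<in> X"
  using lin[of u v 1 "-1"] by simp

lemma sum_mem: "(\<And>j. j \<in> F \<Longrightarrow> e j \<in> X) \<Longrightarrow> (\<lambda>x. \<Sum>j\<in>F. c j * e j x) \<in> X"
proof (induction F rule: infinite_finite_induct)
  case (insert j F)
  then show ?case using lin[of "e j" "\<lambda>x. \<Sum>j\<in>F. c j * e j x" "c j" 1] by simp
qed (auto simp: zero_mem)

lemma ip_scale: "u \<in> X \<Longrightarrow> w \<in> X \<Longrightarrow> ip (\<lambda>x. a * u x) w = a * ip u w"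
  using ip_lin[of u u w a 0] by simp

lemma ip_diff: "u \<in> X \<Longrightarrow> v \<in> X \<Longrightarrow> w \<in> X \<Longrightarrow> ip (\<lambda>x. u x - v x) w = ip u w - ip v w"
  using ip_lin[of u v w 1 "-1"] by simp

lemma ip_zero: "w \<in> X \<Longrightarrow> ip (\<lambda>x. 0) w = 0"
  using ip_lin[of w w w 0 0] by simp

lemma ip_sum: "(\<And>j. j \<in> F \<Longrightarrow> e j \<in> X) \<Longrightarrow> w \<in> X \<Longrightarrow>
    ip (\<lambda>x. \<Sum>j\<in>F. c j * e j x) w = (\<Sum>j\<in>F. c j * ip (e j) w)"
proof (induction F rule: infinite_finite_induct)
  case (insert j F)
  then show ?case
    using ip_lin[of "e j" "\<lambda>x. \<Sum>j\<in>F. c j * e j x" w "c j" 1] sum_mem[of F e c] by simp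
qed (auto simp: ip_zero)

lemma ip_sum_right: "(\<And>j. j \<in> F \<Longrightarrow> e j \<in> X) \<Longrightarrow> w \<in> X \<Longrightarrow>
    ip w (\<lambda>x. \<Sum>j\<in>F. c j * e j x) = (\<Sum>j\<in>F. c j * ip w (e j))"
  by (subst ip_sym) (auto simp: sum_mem ip_sum ip_sym intro!: sum.cong)

lemma ip_sum_sum: "(\<And>j. j \<in> F \<Longrightarrow> e j \<in> X) \<Longrightarrow>
    ip (\<lambda>x. \<Sum>j\<in>F. c j * e j x) (\<lambda>x. \<Sum>j\<in>F. c j * e j x)
      = (\<Sum>i\<in>F. \<Sum>j\<in>F. c i * c j * ip (e i) (e j))"
  by (auto simp: ip_sum ip_sum_right sum_mem sum_distrib_left mult.assoc intro!: sum.cong)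

lemma ip_lin2: "u \<in> X \<Longrightarrow> v \<in> X \<Longrightarrow>
    ip (\<lambda>x. a * u x + b * v x) (\<lambda>x. a * u x + b * v x) = a\<^sup>2 * ip u u + 2 * a * b * ip u v + b\<^sup>2 * ip v v"
  by (simp add: ip_lin lin ip_sym[of _ "\<lambda>x. a * u x + b * v x"] ip_sym[of v u]
      power2_eq_square algebra_simps)

lemma ip_scale2: "u \<in> X \<Longrightarrow> ip (\<lambda>x. a * u x) (\<lambda>x. a * u x) = a\<^sup>2 * ip u u"
  using ip_lin2[of u u a 0] by simp

lemma ip_diff2: "u \<in> X \<Longrightarrow> v \<in> X \<Longrightarrow>
    ip (\<lambda>x. u x - v x) (\<lambda>x. u x - v x) = ip u u - 2 * ip u v + ip v v"
  using ip_lin2[of u v 1 "-1"] by simp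

text \<open>Used in place of the triangle inequality, because squared norms are easier to handle.\<close>

lemma ip_add_le: "u \<in> X \<Longrightarrow> v \<in> X \<Longrightarrow>
    ip (\<lambda>x. u x + v x) (\<lambda>x. u x + v x) \<le> 2 * ip u u + 2 * ip v v"
  using ip_lin2[of u v 1 1] ip_lin2[of u v 1 "-1"] lin[of u v 1 "-1"] ip_nonneg[of "\<lambda>x. u x - v x"]
  by simp

definition orthonormal_upto :: "nat \<Rightarrow> (nat \<Rightarrow> 'x \<Rightarrow> real) \<Rightarrow> bool" where
  "orthonormal_upto n e \<longleftrightarrow> (\<forall>i<n. e i \<in> X) \<and> (\<forall>i<n. \<forall>j<n. ip (e i) (e j) = (if i = j then 1 else 0))"

definition residual :: "nat \<Rightarrow> (nat \<Rightarrow> 'x \<Rightarrow> real) \<Rightarrow> ('x \<Rightarrow> real) \<Rightarrow> 'x \<Rightarrow> real" where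
  "residual n e u = (\<lambda>x. u x - (\<Sum>j<n. ip u (e j) * e j x))"

lemma residual_mem: "orthonormal_upto n e \<Longrightarrow> u \<in> X \<Longrightarrow> residual n e u \<in> X"
  unfolding residual_def orthonormal_upto_def by (intro diff_mem sum_mem) auto

lemma ip_orthonormal_sum:
  assumes "orthonormal_upto n e"
  shows "ip (\<lambda>x. \<Sum>j<n. c j * e j x) (\<lambda>x. \<Sum>j<n. c j * e j x) = (\<Sum>j<n. (c j)\<^sup>2)"
proof -
  have e: "e i \<in> X" "j < n \<Longrightarrow> ip (e i) (e j) = (if i = j then 1 else 0)" if "i < n" for i j
    using assms that by (auto simp: orthonormal_upto_def)
  have "ip (\<lambda>x. \<Sum>j<n. c j * e j x) (\<lambda>x. \<Sum>j<n. c j * e j x)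
      = (\<Sum>i<n. \<Sum>j<n. c i * c j * ip (e i) (e j))"
    using e by (subst ip_sum_sum) auto
  also have "\<dots> = (\<Sum>i<n. \<Sum>j<n. if i = j then (c i)\<^sup>2 else 0)"
    using e by (intro sum.cong refl) (auto simp: power2_eq_square)
  finally show ?thesis by simp
qed

lemma residual_orthogonal:
  assumes "orthonormal_upto n e" "u \<in> X" "i < n"
  shows "ip (residual n e u) (e i) = 0"
proof -
  have e: "e j \<in> X" if "j < n" for j using assms that by (auto simp: orthonormal_upto_def)
  have "ip (residual n e u) (e i) = ip u (e i) - (\<Sum>j<n. ip u (e j) * ip (e j) (e i))"
    using assms e sum_mem[of "{..<n}" e "\<lambda>j. ip u (e j)"] ip_sum[of "{..<n}" e "e i" "\<lambda>j. ip u (e j)"]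
    unfolding residual_def by (subst ip_diff) auto
  also have "(\<Sum>j<n. ip u (e j) * ip (e j) (e i)) = (\<Sum>j<n. if j = i then ip u (e i) else 0)"
    by (rule sum.cong) (use assms in \<open>auto simp: orthonormal_upto_def\<close>)
  finally show ?thesis using assms by simp
qed

lemma ip_residual:
  assumes "orthonormal_upto n e" "u \<in> X"
  shows "ip (residual n e u) (residual n e u) = ip u u - (\<Sum>j<n. (ip u (e j))\<^sup>2)"
proof -
  have e: "e j \<in> X" if "j < n" for j using assms that by (auto simp: orthonormal_upto_def)
  have "ip u (\<lambda>x. \<Sum>j<n. ip u (e j) * e j x) = (\<Sum>j<n. (ip u (e j))\<^sup>2)"
    using assms e by (subst ip_sum_right) (auto simp: power2_eq_square)
  then show ?thesis
    using assms sum_mem[of "{..<n}" e "\<lambda>j. ip u (e j)"] e unfolding residual_def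
    by (subst ip_diff2) (auto simp: ip_orthonormal_sum)
qed

lemma bessel: "orthonormal_upto n e \<Longrightarrow> u \<in> X \<Longrightarrow> (\<Sum>j<n. (ip u (e j))\<^sup>2) \<le> ip u u"
  using ip_residual[of n e u] ip_nonneg[OF residual_mem, of n e u] by simp

lemma ip_residual_le: "orthonormal_upto n e \<Longrightarrow> u \<in> X \<Longrightarrow> ip (residual n e u) (residual n e u) \<le> ip u u"
  by (simp add: ip_residual sum_nonneg)

lemma residual_diff:
  assumes "orthonormal_upto n e" "u \<in> X" "v \<in> X"
  shows "residual n e (\<lambda>x. u x - v x) = (\<lambda>x. residual n e u x - residual n e v x)"
proof -
  have "ip (\<lambda>x. u x - v x) (e j) = ip u (e j) - ip v (e j)" if "j < n" for j
    using that assms by (auto simp: orthonormal_upto_def ip_diff)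
  then show ?thesis
    by (auto simp: residual_def left_diff_distrib sum_subtractf)
qed

text \<open>
  Taking residuals is linear and does not increase the norm, so a vector that is close to the span of
  the orthonormal vectors has a small residual.
\<close>

lemma residual_le_dist:
  assumes "orthonormal_upto n e" "u \<in> X" "v \<in> X" "ip (residual n e v) (residual n e v) = 0"
  shows "ip (residual n e u) (residual n e u) \<le> 2 * ip (\<lambda>x. u x - v x) (\<lambda>x. u x - v x)"
proof -
  let ?r = "residual n e (\<lambda>x. u x - v x)"
  have "residual n e u = (\<lambda>x. ?r x + residual n e v x)"
    by (simp add: residual_diff assms)
  then have "ip (residual n e u) (residual n e u) \<le> 2 * ip ?r ?r + 2 * ip (residual n e v) (residual n e v)"
    using ip_add_le[of ?r "residual n e v"] by (simp add: residual_mem assms diff_mem)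
  also have "\<dots> \<le> 2 * ip (\<lambda>x. u x - v x) (\<lambda>x. u x - v x)"
    using ip_residual_le[OF assms(1) diff_mem[OF assms(2,3)]] assms(4) by simp
  finally show ?thesis .
qed

text \<open>
  With an infinite linearly independent sequence (modulo null vectors), finitely many orthonormal
  vectors cannot span: a nontrivial combination of \<open>n + 1\<close> of the independent vectors is orthogonal
  to \<open>n\<close> given vectors.
\<close>

lemma exists_positive_residual:
  fixes w :: "nat \<Rightarrow> 'x \<Rightarrow> real"
  assumes w: "\<And>i. w i \<in> X"
    and indep: "\<And>n a. (\<exists>i\<le>n. a i \<noteq> 0) \<Longrightarrow>
      0 < ip (\<lambda>x. \<Sum>i\<le>n. a i * w i x) (\<lambda>x. \<Sum>i\<le>n. a i * w i x)"
    and e: "orthonormal_upto n e"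
  shows "\<exists>x\<in>X. 0 < ip (residual n e x) (residual n e x)"
proof -
  obtain a where a: "\<exists>i\<le>n. a i \<noteq> 0" "\<And>j. j < n \<Longrightarrow> (\<Sum>i\<le>n. a i * ip (w i) (e j)) = 0"
    using nontrivial_solution_of_underdetermined_system[of n "\<lambda>i j. ip (w i) (e j)"] by auto
  let ?x = "\<lambda>x. \<Sum>i\<le>n. a i * w i x"
  have x: "?x \<in> X" using w by (intro sum_mem)
  have "ip ?x (e j) = 0" if "j < n" for j
    using a that w e by (subst ip_sum) (auto simp: orthonormal_upto_def)
  then have "ip (residual n e ?x) (residual n e ?x) = ip ?x ?x"
    using ip_residual[OF e x] by simp
  then show ?thesis using indep[OF a(1)] x by force
qed

lemma extend_orthonormal:
  assumes e: "orthonormal_upto n e" and x: "x \<in> X" "0 < ip (residual n e x) (residual n e x)"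
  defines "r \<equiv> residual n e x"
  shows "orthonormal_upto (Suc n) (e(n := (\<lambda>t. (1 / sqrt (ip r r)) * r t)))"
proof -
  have r: "r \<in> X" "\<And>i. i < n \<Longrightarrow> ip r (e i) = 0" "ip r r > 0"
    using residual_mem[OF e x(1)] residual_orthogonal[OF e x(1)] x by (auto simp: r_def)
  define w where "w = (\<lambda>t. (1 / sqrt (ip r r)) * r t)"
  have w: "w \<in> X" using r by (simp only: w_def scale_mem)
  have "ip w w = 1" using r unfolding w_def by (subst ip_scale2) (auto simp: power_divide)
  moreover have we: "ip w (e i) = 0" if "i < n" for i
    using r e that unfolding w_def by (subst ip_scale) (auto simp: orthonormal_upto_def)
  moreover have "ip (e i) w = 0" if "i < n" for i
    using we[OF that] ip_sym[OF _ w, of "e i"] e that by (auto simp: orthonormal_upto_def)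
  ultimately show ?thesis
    using e w unfolding orthonormal_upto_def w_def[symmetric] by (auto simp: less_Suc_eq)
qed

lemma residual_fun_upd: "residual n (e(n := w)) u = residual n e u"
  by (auto simp: residual_def)

lemma ip_residual_Suc:
  assumes "orthonormal_upto (Suc n) e" "u \<in> X"
  shows "ip (residual (Suc n) e u) (residual (Suc n) e u)
     = ip (residual n e u) (residual n e u) - (ip u (e n))\<^sup>2"
proof -
  have "orthonormal_upto n e" using assms by (auto simp: orthonormal_upto_def)
  then show ?thesis using assms by (simp add: ip_residual)
qed

text \<open>
  The inductive step of the Gram-Schmidt process. If \<open>d\<close> is not yet in the span modulo null vectors,
  its normalized residual is added; otherwise any new direction does, since residuals only shrink.
\<close>

lemma orthonormal_extension_absorbing:
  assumes e: "orthonormal_upto n e" and d: "d \<in> X"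
    and infdim: "\<exists>x\<in>X. 0 < ip (residual n e x) (residual n e x)"
  obtains w where "orthonormal_upto (Suc n) (e(n := w))"
    "ip (residual (Suc n) (e(n := w)) d) (residual (Suc n) (e(n := w)) d) = 0"
proof (cases "0 < ip (residual n e d) (residual n e d)")
  case True
  let ?r = "residual n e d"
  define w where "w = (\<lambda>t. (1 / sqrt (ip ?r ?r)) * ?r t)"
  have o: "orthonormal_upto (Suc n) (e(n := w))"
    using extend_orthonormal[OF e d True] by (simp add: w_def)
  have rX: "?r \<in> X" by (rule residual_mem[OF e d])
  have "ip d ?r = ip ?r ?r"
  proof -
    have eX: "e j \<in> X" if "j < n" for j using e that by (auto simp: orthonormal_upto_def)
    have "ip ?r ?r = ip d ?r - ip (\<lambda>x. \<Sum>j<n. ip d (e j) * e j x) ?r"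
      using ip_diff[OF d sum_mem rX, of "{..<n}" e "\<lambda>j. ip d (e j)"] eX by (simp add: residual_def)
    also have "ip (\<lambda>x. \<Sum>j<n. ip d (e j) * e j x) ?r = 0"
      using eX rX residual_orthogonal[OF e d] ip_sym[OF rX] by (subst ip_sum) auto
    finally show ?thesis by simp
  qed
  then have "ip d w = ip ?r ?r / sqrt (ip ?r ?r)"
    using ip_scale[OF rX d, of "1 / sqrt (ip ?r ?r)"] ip_sym[OF d rX] ip_sym[OF d, of w]
      scale_mem[OF rX, of "1 / sqrt (ip ?r ?r)"]
    by (simp add: w_def)
  then have "(ip d w)\<^sup>2 = ip ?r ?r" using True by (simp add: real_div_sqrt)
  then have "ip (residual (Suc n) (e(n := w)) d) (residual (Suc n) (e(n := w)) d) = 0"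
    using ip_residual_Suc[OF o d] by (simp add: residual_fun_upd)
  then show ?thesis using that o by blast
next
  case False
  then have z: "ip (residual n e d) (residual n e d) = 0"
    using ip_nonneg[OF residual_mem[OF e d]] by simp
  obtain x where "x \<in> X" "0 < ip (residual n e x) (residual n e x)" using infdim by auto
  then obtain w where o: "orthonormal_upto (Suc n) (e(n := w))"
    using extend_orthonormal[OF e] by blast
  then have "ip (residual (Suc n) (e(n := w)) d) (residual (Suc n) (e(n := w)) d) = 0"
    using ip_residual_Suc[OF o d] z ip_nonneg[OF residual_mem[OF o d]]
    by (simp add: residual_fun_upd)
  then show ?thesis using that o by blast
qed

text \<open>
  Gram-Schmidt along a dense sequence \<open>d\<close>, started at \<open>v\<close>: step \<open>n\<close> brings \<open>d n\<close> into the span.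
  When \<open>d n\<close> already lies there, an arbitrary new direction is added instead, so that the result
  is indexed by all of \<open>nat\<close>.
\<close>

lemma exists_orthonormal_basis_from:
  fixes d :: "nat \<Rightarrow> 'x \<Rightarrow> real"
  assumes v: "v \<in> X" "ip v v = 1"
    and d: "\<And>n. d n \<in> X"
    and dense: "\<And>u \<epsilon>. u \<in> X \<Longrightarrow> 0 < \<epsilon> \<Longrightarrow> \<exists>n. ip (\<lambda>x. u x - d n x) (\<lambda>x. u x - d n x) < \<epsilon>"
    and infdim: "\<And>n e. orthonormal_upto n e \<Longrightarrow> \<exists>x\<in>X. 0 < ip (residual n e x) (residual n e x)"
  shows "\<exists>e. orthonormal_basis X ip e \<and> e 0 = v"
proof -
  define Q where "Q n e \<longleftrightarrow> orthonormal_upto (Suc n) e \<and> e 0 = v \<and>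
    (\<forall>i<n. ip (residual (Suc n) e (d i)) (residual (Suc n) e (d i)) = 0)" for n e
  have Q0: "Q 0 (\<lambda>_. v)" using v by (auto simp: Q_def orthonormal_upto_def)
  have Q_step: "\<exists>e'. Q (Suc n) e' \<and> (\<forall>i\<le>n. e' i = e i)" if "Q n e" for n e
  proof -
    have e: "orthonormal_upto (Suc n) e" using that by (simp add: Q_def)
    obtain w where w: "orthonormal_upto (Suc (Suc n)) (e(Suc n := w))"
      "ip (residual (Suc (Suc n)) (e(Suc n := w)) (d n)) (residual (Suc (Suc n)) (e(Suc n := w)) (d n)) = 0"
      by (rule orthonormal_extension_absorbing[OF e d[of n] infdim[OF e]])
    have "ip (residual (Suc (Suc n)) (e(Suc n := w)) (d i)) (residual (Suc (Suc n)) (e(Suc n := w)) (d i)) = 0"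
      if i: "i < Suc n" for i
    proof (cases "i = n")
      case False
      then have "ip (residual (Suc n) e (d i)) (residual (Suc n) e (d i)) = 0"
        using i \<open>Q n e\<close> by (auto simp: Q_def)
      then show ?thesis
        using ip_residual_Suc[OF w(1) d[of i]] ip_nonneg[OF residual_mem[OF w(1) d[of i]]]
        by (simp add: residual_fun_upd)
    qed (use w in auto)
    then show ?thesis using w(1) that by (intro exI[of _ "e(Suc n := w)"]) (auto simp: Q_def)
  qed
  obtain E where E: "\<And>n. Q n (E n)" "\<And>n. \<forall>i\<le>n. E (Suc n) i = E n i"
  proof -
    have "\<exists>E. \<forall>n. Q n (E n) \<and> (\<forall>i\<le>n. E (Suc n) i = E n i)"
      by (rule dependent_nat_choice) (use Q0 Q_step in blast)+
    then show ?thesis using that by blast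
  qed
  define e where "e i = E i i" for i
  have e_eq: "i \<le> n \<Longrightarrow> e i = E n i" for i n
    by (induction n rule: nat_induct) (use E(2) in \<open>auto simp: e_def le_Suc_eq\<close>)
  have o: "orthonormal_upto n e" for n
    using E(1)[of n] e_eq[of _ n] unfolding Q_def orthonormal_upto_def by auto
  have res0: "ip (residual n e (d i)) (residual n e (d i)) = 0" if i: "Suc i < n" for i n
  proof -
    obtain m where m: "n = Suc m" using i by (cases n) auto
    have "residual n e (d i) = residual n (E m) (d i)"
      using e_eq[of _ m] by (auto simp: residual_def m)
    then show ?thesis using E(1)[of m] i m by (auto simp: Q_def)
  qed
  have "(\<lambda>n. let r = (\<lambda>x. u x - (\<Sum>j<n. ip u (e j) * e j x)) in sqrt (ip r r)) \<longlonglongrightarrow> 0" if u: "u \<in> X" for u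
  proof -
    have "(\<lambda>n. ip (residual n e u) (residual n e u)) \<longlonglongrightarrow> 0"
    proof (rule LIMSEQ_I)
      fix \<epsilon> :: real assume "0 < \<epsilon>"
      then obtain i where i: "ip (\<lambda>x. u x - d i x) (\<lambda>x. u x - d i x) < \<epsilon> / 2"
        using dense[OF u, of "\<epsilon> / 2"] by auto
      have "norm (ip (residual n e u) (residual n e u) - 0) < \<epsilon>" if "n \<ge> Suc (Suc i)" for n
        using residual_le_dist[OF o u d[of i] res0[of i n]] i that ip_nonneg[OF residual_mem[OF o u], of n]
        by simp
      then show "\<exists>no. \<forall>n\<ge>no. norm (ip (residual n e u) (residual n e u) - 0) < \<epsilon>" by blast
    qed
    then have "(\<lambda>n. sqrt (ip (residual n e u) (residual n e u))) \<longlonglongrightarrow> sqrt 0"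
      by (rule tendsto_real_sqrt)
    then show ?thesis by (simp add: residual_def Let_def)
  qed
  moreover have "e j \<in> X" "ip (e i) (e j) = (if i = j then 1 else 0)" for i j
    using o[of "Suc (max i j)"] unfolding orthonormal_upto_def by auto
  ultimately have "orthonormal_basis X ip e" by (auto simp: orthonormal_basis_def)
  moreover have "e 0 = v" using E(1)[of 0] by (simp add: e_def Q_def)
  ultimately show ?thesis by blast
qed

end

section \<open>Lebesgue integration on products\<close>

lemma borel_measurable_lebesgue_on_AE:
  fixes f :: "'a::euclidean_space \<Rightarrow> 'c::euclidean_space"
  assumes S: "S \<in> sets lebesgue" and f: "f \<in> borel_measurable (lebesgue_on S)"
    and ae: "AE x in lebesgue_on S. f x = g x"
  shows "g \<in> borel_measurable (lebesgue_on S)"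
proof -
  have "AE x in lebesgue. (if x \<in> S then f x else 0) = (if x \<in> S then g x else 0)"
    using ae S by (auto simp: AE_restrict_space_iff)
  moreover have "(\<lambda>x. if x \<in> S then f x else 0) \<in> borel_measurable lebesgue"
    using f by (simp only: borel_measurable_if[OF S])
  ultimately have "(\<lambda>x. if x \<in> S then g x else 0) \<in> borel_measurable lebesgue"
    by (rule borel_measurable_AE[rotated])
  then show ?thesis by (simp only: borel_measurable_if[OF S])
qed

lemma integrable_lebesgue_on_AE:
  fixes f :: "'a::euclidean_space \<Rightarrow> 'c::euclidean_space"
  assumes "S \<in> sets lebesgue" "integrable (lebesgue_on S) f" "AE x in lebesgue_on S. f x = g x"
  shows "integrable (lebesgue_on S) g"
  by (rule integrable_cong_AE_imp[OF assms(2) borel_measurable_lebesgue_on_AE[OF assms(1) _ assms(3)] assms(3)])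
    (use assms in auto)

lemma integral_lebesgue_on_AE:
  fixes f :: "'a::euclidean_space \<Rightarrow> 'c::euclidean_space"
  assumes "S \<in> sets lebesgue" "f \<in> borel_measurable (lebesgue_on S)" "AE x in lebesgue_on S. f x = g x"
  shows "integral\<^sup>L (lebesgue_on S) f = integral\<^sup>L (lebesgue_on S) g"
  using assms borel_measurable_lebesgue_on_AE[OF assms] by (intro integral_cong_AE)

text \<open>
  Lebesgue measure on a product is only the completion of the product measure, so Fubini's theorem is
  transferred from a Borel function \<open>g\<close> that agrees almost everywhere with the given one. Stating the
  transfer for a curried \<open>g\<close> makes it serve both orders of integration.
\<close>

lemma iterated_integral_lebesgue_on_transfer:
  fixes f g :: "'a::euclidean_space \<Rightarrow> 'b::euclidean_space \<Rightarrow> real"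
  assumes A: "A \<in> sets lebesgue" and B: "B \<in> sets lebesgue"
    and ae: "AE x in lborel. AE y in lborel. indicator A x * indicator B y * f x y = g x y"
    and meas: "\<And>x. g x \<in> borel_measurable borel"
    and slices: "AE x in lborel. integrable lborel (g x)"
    and outer: "integrable lborel (\<lambda>x. \<integral>y. g x y \<partial>lborel)"
  shows "AE x in lebesgue_on A. integrable (lebesgue_on B) (f x)"
    and "integrable (lebesgue_on A) (\<lambda>x. \<integral>y. f x y \<partial>lebesgue_on B)"
    and "(\<integral>x. \<integral>y. f x y \<partial>lebesgue_on B \<partial>lebesgue_on A) = (\<integral>x. \<integral>y. g x y \<partial>lborel \<partial>lborel)"
proof -
  define F where "F x y = indicator A x * indicator B y * f x y" for x y
  have slice: "integrable (lebesgue_on B) (f x) \<and> (\<integral>y. f x y \<partial>lebesgue_on B) = (\<integral>y. g x y \<partial>lborel)"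
    if "x \<in> A" "AE y in lborel. F x y = g x y" "integrable lborel (g x)" for x
  proof -
    have ae: "AE y in lebesgue. g x y = F x y"
      using AE_completion[OF that(2)] by eventually_elim simp
    have gl: "integrable lebesgue (g x)" using meas that(3) by (simp add: integrable_completion)
    have Fm: "F x \<in> borel_measurable lebesgue"
      using borel_measurable_AE[OF borel_measurable_integrable[OF gl] ae] .
    have "integrable lebesgue (F x)" by (rule integrable_cong_AE_imp[OF gl Fm ae])
    moreover have "(\<integral>y. g x y \<partial>lebesgue) = (\<integral>y. F x y \<partial>lebesgue)"
      using gl Fm ae by (intro integral_cong_AE) auto
    ultimately show ?thesis
      using that(1) B meas
      by (simp add: F_def[abs_def] integrable_restrict_space integral_restrict_space integral_completion)
  qed
  have zero: "(\<integral>y. g x y \<partial>lborel) = 0" if "x \<notin> A" "AE y in lborel. F x y = g x y" for x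
    using that meas by (subst integral_cong_AE[where g = "\<lambda>_. 0"]) (auto simp: F_def)
  have S: "AE x in lebesgue_on A. integrable (lebesgue_on B) (f x) \<and>
      (\<integral>y. f x y \<partial>lebesgue_on B) = (\<integral>y. g x y \<partial>lborel)"
    using AE_completion[OF ae] AE_completion[OF slices] slice A by (auto simp: AE_restrict_space_iff F_def)
  then show "AE x in lebesgue_on A. integrable (lebesgue_on B) (f x)" by auto
  have outer': "integrable lebesgue (\<lambda>x. \<integral>y. g x y \<partial>lborel)"
    using outer by (simp add: integrable_completion borel_measurable_integrable)
  have int: "integrable (lebesgue_on A) (\<lambda>x. \<integral>y. g x y \<partial>lborel)"
    using outer' A integrable_mult_indicator[OF A outer'] by (simp add: integrable_restrict_space)
  have ae': "AE x in lebesgue_on A. (\<integral>y. g x y \<partial>lborel) = (\<integral>y. f x y \<partial>lebesgue_on B)"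
    using S by eventually_elim simp
  show "integrable (lebesgue_on A) (\<lambda>x. \<integral>y. f x y \<partial>lebesgue_on B)"
    by (rule integrable_lebesgue_on_AE[OF A int ae'])
  have ae0: "AE x in lebesgue. (\<integral>y. g x y \<partial>lborel) = indicator A x * (\<integral>y. g x y \<partial>lborel)"
    using AE_completion[OF ae] by eventually_elim (auto simp: zero F_def indicator_def)
  have "(\<integral>x. \<integral>y. g x y \<partial>lborel \<partial>lborel) = (\<integral>x. \<integral>y. g x y \<partial>lborel \<partial>lebesgue)"
    using outer by (simp add: integral_completion borel_measurable_integrable)
  also have "\<dots> = (\<integral>x. indicator A x * (\<integral>y. g x y \<partial>lborel) \<partial>lebesgue)"
    using ae0 outer' borel_measurable_AE[OF borel_measurable_integrable[OF outer'] ae0]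
    by (intro integral_cong_AE) auto
  also have "\<dots> = (\<integral>x. \<integral>y. g x y \<partial>lborel \<partial>lebesgue_on A)"
    using A by (simp add: integral_restrict_space)
  finally show "(\<integral>x. \<integral>y. f x y \<partial>lebesgue_on B \<partial>lebesgue_on A) = (\<integral>x. \<integral>y. g x y \<partial>lborel \<partial>lborel)"
    using integral_lebesgue_on_AE[OF A borel_measurable_integrable[OF int] ae'] by simp
qed

lemma
  fixes f :: "'a::euclidean_space \<times> 'b::euclidean_space \<Rightarrow> real"
  assumes A: "A \<in> sets lebesgue" and B: "B \<in> sets lebesgue" and AB: "A \<times> B \<in> sets lebesgue"
    and f: "integrable (lebesgue_on (A \<times> B)) f"
  shows AE_integrable_lebesgue_on_fst: "AE x in lebesgue_on A. integrable (lebesgue_on B) (\<lambda>y. f (x, y))"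
    and integrable_lebesgue_on_fst: "integrable (lebesgue_on A) (\<lambda>x. \<integral>y. f (x, y) \<partial>lebesgue_on B)"
    and integral_lebesgue_on_fst: "(\<integral>x. \<integral>y. f (x, y) \<partial>lebesgue_on B \<partial>lebesgue_on A) = integral\<^sup>L (lebesgue_on (A \<times> B)) f"
    and integral_lebesgue_on_snd: "(\<integral>y. \<integral>x. f (x, y) \<partial>lebesgue_on A \<partial>lebesgue_on B) = integral\<^sup>L (lebesgue_on (A \<times> B)) f"
proof -
  define F where "F = (\<lambda>z. indicator (A \<times> B) z * f z)"
  have F: "integrable lebesgue F"
    using f AB by (simp add: integrable_restrict_space F_def)
  obtain g where g: "g \<in> borel_measurable lborel" "AE z in lborel. F z = g z"
    using completion_ex_borel_measurable_real[OF borel_measurable_integrable[OF F]] by blast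
  have "integrable lebesgue g"
    by (rule integrable_cong_AE_imp[OF F measurable_completion[OF g(1)] AE_completion[OF g(2)]])
  then have "integrable lborel g" using g by (simp add: integrable_completion)
  then have gi: "integrable (lborel \<Otimes>\<^sub>M lborel) (case_prod (\<lambda>x y. g (x, y)))"
    by (simp add: lborel_prod)
  have If: "integral\<^sup>L (lebesgue_on (A \<times> B)) f = integral\<^sup>L (lborel \<Otimes>\<^sub>M lborel) (case_prod (\<lambda>x y. g (x, y)))"
  proof -
    have "integral\<^sup>L (lebesgue_on (A \<times> B)) f = integral\<^sup>L lebesgue F"
      using AB by (simp add: integral_restrict_space F_def)
    also have "\<dots> = integral\<^sup>L lebesgue g"
      using F g by (intro integral_cong_AE) (auto intro: AE_completion measurable_completion)
    finally show ?thesis using g by (simp add: integral_completion lborel_prod)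
  qed
  have "AE z in lborel \<Otimes>\<^sub>M lborel. F z = g z"
    using g(2) unfolding lborel_prod .
  then have ae1: "AE x in lborel. AE y in lborel. F (x, y) = g (x, y)"
    by (rule lborel_pair.AE_pair)
  have "AE z in lborel \<Otimes>\<^sub>M lborel. F (snd z, fst z) = g (snd z, fst z)"
  proof -
    obtain N where N: "{z. F z \<noteq> g z} \<subseteq> N" "N \<in> null_sets (lborel \<Otimes>\<^sub>M lborel)"
      using g(2) unfolding lborel_prod eventually_ae_filter by auto
    define N' where "N' = (\<lambda>(x, y). (y, x)) -` N \<inter> space (lborel \<Otimes>\<^sub>M lborel :: ('b \<times> 'a) measure)"
    have "emeasure (lborel \<Otimes>\<^sub>M lborel) N' = emeasure (lborel \<Otimes>\<^sub>M lborel) N"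
      unfolding N'_def
      by (subst lborel_pair.distr_pair_swap, subst emeasure_distr) (use N in auto)
    moreover have "N' \<in> sets (lborel \<Otimes>\<^sub>M lborel)"
      unfolding N'_def by (rule measurable_sets[OF measurable_pair_swap']) (use N in auto)
    ultimately have "N' \<in> null_sets (lborel \<Otimes>\<^sub>M lborel)" using N by (simp add: null_sets_def)
    moreover have "{z. F (snd z, fst z) \<noteq> g (snd z, fst z)} \<subseteq> N'"
      using N by (auto simp: N'_def space_pair_measure)
    ultimately show ?thesis by (intro AE_I'[of N']) auto
  qed
  then have "AE y in lborel. AE x in lborel. F (snd (y, x), fst (y, x)) = g (snd (y, x), fst (y, x))"
    by (rule lborel_pair.AE_pair)
  then have ae2: "AE y in lborel. AE x in lborel. F (x, y) = g (x, y)" by simp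
  have gx: "(\<lambda>y. g (x, y)) \<in> borel_measurable lborel" "(\<lambda>x. g (x, y)) \<in> borel_measurable lborel" for x y
    using g(1) by auto
  have ae1': "AE x in lborel. AE y in lborel. indicator A x * indicator B y * f (x, y) = g (x, y)"
    and ae2': "AE y in lborel. AE x in lborel. indicator B y * indicator A x * f (x, y) = g (x, y)"
    using ae1 ae2 by (simp_all add: F_def indicator_times ac_simps)
  note fst = iterated_integral_lebesgue_on_transfer[OF A B ae1' gx(1)[simplified]
      lborel_pair.AE_integrable_fst[OF gi] lborel_pair.integrable_fst[OF gi]]
  note snd = iterated_integral_lebesgue_on_transfer[OF B A ae2' gx(2)[simplified]
      lborel_pair.AE_integrable_snd[OF gi] lborel_pair.integrable_snd[OF gi]]
  show "AE x in lebesgue_on A. integrable (lebesgue_on B) (\<lambda>y. f (x, y))"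
    "integrable (lebesgue_on A) (\<lambda>x. \<integral>y. f (x, y) \<partial>lebesgue_on B)"
    by (rule fst(1), rule fst(2))
  show "(\<integral>x. \<integral>y. f (x, y) \<partial>lebesgue_on B \<partial>lebesgue_on A) = integral\<^sup>L (lebesgue_on (A \<times> B)) f"
    using fst(3) lborel_pair.integral_fst[OF gi] If by simp
  show "(\<integral>y. \<integral>x. f (x, y) \<partial>lebesgue_on A \<partial>lebesgue_on B) = integral\<^sup>L (lebesgue_on (A \<times> B)) f"
    using snd(3) lborel_pair.integral_snd[OF gi] If by simp
qed

lemma null_sets_lebesgue_Times:
  fixes N :: "'a::euclidean_space set"
  assumes "N \<in> null_sets lebesgue"
  shows "N \<times> (UNIV :: 'b::euclidean_space set) \<in> null_sets lebesgue"
    and "(UNIV :: 'b::euclidean_space set) \<times> N \<in> null_sets lebesgue"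
proof -
  obtain N' where N': "N \<subseteq> N'" "N' \<in> null_sets lborel"
    using assms by (auto simp: null_sets_completion_iff2)
  have "N' \<times> UNIV \<in> null_sets (lborel :: ('a \<times> 'b) measure)"
    "UNIV \<times> N' \<in> null_sets (lborel :: ('b \<times> 'a) measure)"
    using N'(2) unfolding lborel_prod[symmetric]
    by (auto intro: lborel.times_in_null_sets1 lborel.times_in_null_sets2)
  then show "N \<times> (UNIV :: 'b set) \<in> null_sets lebesgue" "(UNIV :: 'b set) \<times> N \<in> null_sets lebesgue"
    using N'(1) null_sets_completion_subset[OF _ null_sets_completionI]
    by (metis Sigma_mono order_refl)+
qed

text \<open>
  The projections are measurable for the completed \<open>\<sigma>\<close>-algebras because a cylinder over a null set is
  null; this makes functions of one variable measurable on the product.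
\<close>

lemma measurable_fst_lebesgue: "fst \<in> measurable (lebesgue :: ('a::euclidean_space \<times> 'b::euclidean_space) measure) lebesgue"
  and measurable_snd_lebesgue: "snd \<in> measurable (lebesgue :: ('a \<times> 'b) measure) lebesgue"
proof -
  have 1: "fst -` S \<in> sets (lebesgue :: ('a \<times> 'b) measure)" if "S \<in> sets lebesgue" for S :: "'a set"
  proof -
    obtain T N N' where S: "S = T \<union> N" "N \<subseteq> N'" "N' \<in> null_sets lborel" "T \<in> sets lborel"
      using sets_completionE[OF \<open>S \<in> sets lebesgue\<close>] by metis
    have "N \<in> null_sets lebesgue" using S null_sets_completion_iff2 by blast
    then have "N \<times> (UNIV :: 'b set) \<in> sets lebesgue" using null_sets_lebesgue_Times by blast
    moreover have "T \<times> (UNIV :: 'b set) \<in> sets lebesgue"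
    proof -
      have "T \<times> (UNIV :: 'b set) \<in> sets (borel \<Otimes>\<^sub>M borel)" using S by (intro pair_measureI) auto
      then show ?thesis unfolding borel_prod by (intro sets_completionI_sets) simp
    qed
    moreover have "fst -` S = T \<times> (UNIV :: 'b set) \<union> N \<times> (UNIV :: 'b set)" using S by auto
    ultimately show ?thesis by auto
  qed
  have 2: "snd -` S \<in> sets (lebesgue :: ('a \<times> 'b) measure)" if "S \<in> sets lebesgue" for S :: "'b set"
  proof -
    obtain T N N' where S: "S = T \<union> N" "N \<subseteq> N'" "N' \<in> null_sets lborel" "T \<in> sets lborel"
      using sets_completionE[OF \<open>S \<in> sets lebesgue\<close>] by metis
    have "N \<in> null_sets lebesgue" using S null_sets_completion_iff2 by blast
    then have "(UNIV :: 'a set) \<times> N \<in> sets lebesgue" using null_sets_lebesgue_Times by blast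
    moreover have "(UNIV :: 'a set) \<times> T \<in> sets lebesgue"
    proof -
      have "(UNIV :: 'a set) \<times> T \<in> sets (borel \<Otimes>\<^sub>M borel)" using S by (intro pair_measureI) auto
      then show ?thesis unfolding borel_prod by (intro sets_completionI_sets) simp
    qed
    moreover have "snd -` S = (UNIV :: 'a set) \<times> T \<union> (UNIV :: 'a set) \<times> N" using S by auto
    ultimately show ?thesis by auto
  qed
  show "fst \<in> measurable (lebesgue :: ('a \<times> 'b) measure) lebesgue"
    by (rule measurableI) (use 1 in auto)
  show "snd \<in> measurable (lebesgue :: ('a \<times> 'b) measure) lebesgue"
    by (rule measurableI) (use 2 in auto)
qed

lemma sets_lebesgue_Times:
  "A \<in> sets lebesgue \<Longrightarrow> B \<in> sets lebesgue \<Longrightarrow> A \<times> B \<in> sets lebesgue"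
proof -
  assume "A \<in> sets lebesgue" "B \<in> sets lebesgue"
  then have "fst -` A \<inter> space lebesgue \<in> sets lebesgue" "snd -` B \<inter> space lebesgue \<in> sets lebesgue"
    by (simp_all add: measurable_sets[OF measurable_fst_lebesgue] measurable_sets[OF measurable_snd_lebesgue]
        del: space_completion space_lborel)
  then have "(fst -` A \<inter> snd -` B) \<in> sets lebesgue" by auto
  moreover have "fst -` A \<inter> snd -` B = A \<times> B" by auto
  ultimately show ?thesis by simp
qed

lemma measurable_fst_lebesgue_on: "fst \<in> measurable (lebesgue_on (A \<times> B)) (lebesgue_on A)"
  and measurable_snd_lebesgue_on: "snd \<in> measurable (lebesgue_on (A \<times> B)) (lebesgue_on B)"
  by (intro measurable_restrict_space2 measurable_restrict_space1 measurable_fst_lebesgue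
      measurable_snd_lebesgue; auto)+

lemma AE_lebesgue_on_Times:
  assumes A: "A \<in> sets lebesgue" and B: "B \<in> sets lebesgue"
    and P: "AE x in lebesgue_on A. P x" and Q: "AE y in lebesgue_on B. Q y"
  shows "AE z in lebesgue_on (A \<times> B). P (fst z) \<and> Q (snd z)"
proof -
  have "AE x in lebesgue. x \<in> A \<longrightarrow> P x" using P A by (simp add: AE_restrict_space_iff)
  then obtain N where N: "N \<in> null_sets lebesgue" "\<And>x. x \<in> A \<Longrightarrow> x \<notin> N \<Longrightarrow> P x"
    unfolding eventually_ae_filter by auto
  have "AE y in lebesgue. y \<in> B \<longrightarrow> Q y" using Q B by (simp add: AE_restrict_space_iff)
  then obtain N' where N': "N' \<in> null_sets lebesgue" "\<And>y. y \<in> B \<Longrightarrow> y \<notin> N' \<Longrightarrow> Q y"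
    unfolding eventually_ae_filter by auto
  have "N \<times> UNIV \<union> UNIV \<times> N' \<in> null_sets lebesgue"
    using null_sets_lebesgue_Times N N' by blast
  then have "AE z in lebesgue. z \<in> A \<times> B \<longrightarrow> P (fst z) \<and> Q (snd z)"
    by (rule AE_I') (use N(2) N'(2) in fastforce)
  then show ?thesis using sets_lebesgue_Times[OF A B]
    by (subst AE_restrict_space_iff) simp_all
qed

text \<open>
  As for Fubini's theorem, the factors are replaced by Borel functions that agree with them almost
  everywhere.
\<close>

lemma integrable_lebesgue_on_tensor:
  fixes f :: "'a::euclidean_space \<Rightarrow> real" and g :: "'b::euclidean_space \<Rightarrow> real"
  assumes A: "A \<in> sets lebesgue" and B: "B \<in> sets lebesgue"
    and f: "integrable (lebesgue_on A) f" and g: "integrable (lebesgue_on B) g"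
  shows "integrable (lebesgue_on (A \<times> B)) (\<lambda>(x, y). f x * g y)"
    and "(\<integral>(x, y). f x * g y \<partial>lebesgue_on (A \<times> B)) = integral\<^sup>L (lebesgue_on A) f * integral\<^sup>L (lebesgue_on B) g"
proof -
  note AB = sets_lebesgue_Times[OF A B]
  define F where "F = (\<lambda>x. indicator A x * f x)"
  define G where "G = (\<lambda>y. indicator B y * g y)"
  have F: "integrable lebesgue F" and G: "integrable lebesgue G"
    using f g A B by (simp_all add: integrable_restrict_space F_def G_def)
  obtain F' where F': "F' \<in> borel_measurable lborel" "AE x in lborel. F x = F' x"
    using completion_ex_borel_measurable_real[OF borel_measurable_integrable[OF F]] by blast
  obtain G' where G': "G' \<in> borel_measurable lborel" "AE x in lborel. G x = G' x"
    using completion_ex_borel_measurable_real[OF borel_measurable_integrable[OF G]] by blast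
  have F'i: "integrable lborel F'"
    using integrable_cong_AE_imp[OF F measurable_completion[OF F'(1)] AE_completion[OF F'(2)]] F'(1)
    by (simp add: integrable_completion)
  have G'i: "integrable lborel G'"
    using integrable_cong_AE_imp[OF G measurable_completion[OF G'(1)] AE_completion[OF G'(2)]] G'(1)
    by (simp add: integrable_completion)
  have m: "(\<lambda>(x, y). F' x * G' y) \<in> borel_measurable (lborel \<Otimes>\<^sub>M lborel)"
    using F'(1) G'(1) by measurable
  have "integrable (lborel \<Otimes>\<^sub>M lborel) (\<lambda>(x, y). F' x * G' y)"
    by (rule lborel_pair.Fubini_integrable[OF m]) (use F'i G'i in \<open>auto simp: abs_mult\<close>)
  then have i: "integrable lebesgue (\<lambda>(x, y). F' x * G' y)"
    using m by (simp add: lborel_prod integrable_completion)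
  have "AE z in lebesgue_on (UNIV \<times> UNIV). F (fst z) = F' (fst z) \<and> G (snd z) = G' (snd z)"
    using AE_completion[OF F'(2)] AE_completion[OF G'(2)]
    by (intro AE_lebesgue_on_Times) (simp_all only: lebesgue_on_UNIV_eq, simp_all)
  then have ae: "AE z in lebesgue. (\<lambda>(x, y). F' x * G' y) z = (\<lambda>(x, y). F x * G y) z"
    unfolding UNIV_Times_UNIV lebesgue_on_UNIV_eq by eventually_elim (auto simp: case_prod_beta)
  have "integrable lebesgue (\<lambda>(x, y). F x * G y)"
    by (rule integrable_cong_AE_imp[OF i borel_measurable_AE[OF borel_measurable_integrable[OF i] ae] ae])
  then show int: "integrable (lebesgue_on (A \<times> B)) (\<lambda>(x, y). f x * g y)"
    using AB by (simp add: integrable_restrict_space F_def G_def indicator_times case_prod_beta' ac_simps)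
  show "(\<integral>(x, y). f x * g y \<partial>lebesgue_on (A \<times> B)) = integral\<^sup>L (lebesgue_on A) f * integral\<^sup>L (lebesgue_on B) g"
    using integral_lebesgue_on_fst[OF A B AB int] by simp
qed

section \<open>Square-integrable functions\<close>

definition square_integrable :: "'x measure \<Rightarrow> ('x \<Rightarrow> 'c::euclidean_space) \<Rightarrow> bool" where
  "square_integrable M f \<longleftrightarrow> f \<in> borel_measurable M \<and> integrable M (\<lambda>x. (norm (f x))\<^sup>2)"

lemma L2_iff_square_integrable: "f \<in> L2 M \<longleftrightarrow> square_integrable M f"
  by (simp add: L2_def square_integrable_def)

lemma L2_inner_self: "L2_inner M f f = (\<integral>x. (norm (f x))\<^sup>2 \<partial>M)"
  by (simp add: L2_inner_def power2_eq_square)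

lemma square_integrableD:
  assumes "square_integrable M f"
  shows "f \<in> borel_measurable M" "integrable M (\<lambda>x. (norm (f x))\<^sup>2)"
  using assms by (auto simp: square_integrable_def)

lemma norm_add_square_le: "(norm (x + y))\<^sup>2 \<le> 2 * (norm x)\<^sup>2 + 2 * (norm (y :: 'a::real_inner))\<^sup>2"
proof -
  have "0 \<le> (norm (x - y))\<^sup>2" by simp
  then show ?thesis by (simp add: power2_norm_eq_inner inner_add inner_diff inner_commute)
qed

lemma square_integrable_inner:
  assumes "square_integrable M f" "square_integrable M g"
  shows "integrable M (\<lambda>x. f x \<bullet> g x)"
proof (rule Bochner_Integration.integrable_bound)
  show "integrable M (\<lambda>x. (norm (f x))\<^sup>2 + (norm (g x))\<^sup>2)"
    using assms by (auto simp: square_integrable_def)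
  show "(\<lambda>x. f x \<bullet> g x) \<in> borel_measurable M"
    using assms by (auto simp: square_integrable_def)
  have "\<bar>f x \<bullet> g x\<bar> \<le> (norm (f x))\<^sup>2 + (norm (g x))\<^sup>2" for x
  proof -
    have "\<bar>f x \<bullet> g x\<bar> \<le> norm (f x) * norm (g x)" by (rule Cauchy_Schwarz_ineq2)
    also have "\<dots> \<le> (norm (f x))\<^sup>2 + (norm (g x))\<^sup>2"
      using sum_squares_bound[of "norm (f x)" "norm (g x)"]
        mult_nonneg_nonneg[OF norm_ge_zero[of "f x"] norm_ge_zero[of "g x"]] by linarith
    finally show ?thesis .
  qed
  then show "AE x in M. norm (f x \<bullet> g x) \<le> norm ((norm (f x))\<^sup>2 + (norm (g x))\<^sup>2)" by simp
qed

lemma square_integrable_mult: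
  fixes f g :: "'x \<Rightarrow> real"
  shows "square_integrable M f \<Longrightarrow> square_integrable M g \<Longrightarrow> integrable M (\<lambda>x. f x * g x)"
  using square_integrable_inner[of M f g] by simp

lemma square_integrable_scaleR: "square_integrable M f \<Longrightarrow> square_integrable M (\<lambda>x. a *\<^sub>R f x)"
  by (auto simp: square_integrable_def power_mult_distrib)

lemma square_integrable_add:
  assumes "square_integrable M f" "square_integrable M g"
  shows "square_integrable M (\<lambda>x. f x + g x)"
  unfolding square_integrable_def
proof (intro conjI)
  show m: "(\<lambda>x. f x + g x) \<in> borel_measurable M" using assms by (auto simp: square_integrable_def)
  show "integrable M (\<lambda>x. (norm (f x + g x))\<^sup>2)"
  proof (rule Bochner_Integration.integrable_bound)
    show "integrable M (\<lambda>x. 2 * (norm (f x))\<^sup>2 + 2 * (norm (g x))\<^sup>2)"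
      using assms by (auto simp: square_integrable_def)
  qed (use m in \<open>auto simp: norm_add_square_le\<close>)
qed

lemma square_integrable_diff:
  "square_integrable M f \<Longrightarrow> square_integrable M g \<Longrightarrow> square_integrable M (\<lambda>x. f x - g x)"
  using square_integrable_add[of M f "\<lambda>x. (-1) *\<^sub>R g x"] square_integrable_scaleR[of M g "-1"] by simp

lemma square_integrable_zero [simp]: "square_integrable M (\<lambda>x. 0)"
  by (simp add: square_integrable_def)

lemma square_integrable_sum:
  "(\<And>j. j \<in> F \<Longrightarrow> square_integrable M (f j)) \<Longrightarrow> square_integrable M (\<lambda>x. \<Sum>j\<in>F. f j x)"
  by (induction F rule: infinite_finite_induct) (auto intro: square_integrable_add)

lemma square_integrable_bounded:
  assumes "finite_measure M" "f \<in> borel_measurable M" "\<And>x. norm (f x) \<le> B"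
  shows "square_integrable M f"
proof -
  interpret finite_measure M by fact
  have "integrable M (\<lambda>x. (norm (f x))\<^sup>2)"
  proof (rule integrable_const_bound[where B = "B\<^sup>2"])
    show "AE x in M. norm ((norm (f x))\<^sup>2) \<le> B\<^sup>2" using assms(3) by (simp add: power_mono)
  qed (use assms in auto)
  then show ?thesis using assms by (simp add: square_integrable_def)
qed

lemma square_integrable_imp_integrable:
  assumes "finite_measure M" "square_integrable M f"
  shows "integrable M f"
proof -
  interpret finite_measure M by fact
  have le: "norm (f x) \<le> norm (1 + (norm (f x))\<^sup>2)" for x
    using sum_squares_bound[of 1 "norm (f x)"] norm_ge_zero[of "f x"] by (simp del: norm_ge_zero)
  show ?thesis
  proof (rule Bochner_Integration.integrable_bound)
    show "integrable M (\<lambda>x. 1 + (norm (f x))\<^sup>2)" using assms by (simp add: square_integrable_def)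
  qed (use assms le in \<open>simp_all add: square_integrable_def\<close>)
qed

lemma integral_norm_add_square_le:
  assumes "square_integrable M f" "square_integrable M g"
  shows "(\<integral>x. (norm (f x + g x))\<^sup>2 \<partial>M) \<le> 2 * (\<integral>x. (norm (f x))\<^sup>2 \<partial>M) + 2 * (\<integral>x. (norm (g x))\<^sup>2 \<partial>M)"
proof -
  have "(\<integral>x. (norm (f x + g x))\<^sup>2 \<partial>M) \<le> (\<integral>x. 2 * (norm (f x))\<^sup>2 + 2 * (norm (g x))\<^sup>2 \<partial>M)"
    using assms square_integrable_add[OF assms] by (intro integral_mono) (auto simp: square_integrable_def norm_add_square_le)
  then show ?thesis using assms by (simp add: square_integrable_def)
qed

lemma integral_dist_square_le:
  assumes "square_integrable M f" "square_integrable M g" "square_integrable M h"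
  shows "(\<integral>x. (norm (f x - h x))\<^sup>2 \<partial>M)
    \<le> 2 * (\<integral>x. (norm (f x - g x))\<^sup>2 \<partial>M) + 2 * (\<integral>x. (norm (g x - h x))\<^sup>2 \<partial>M)"
  using integral_norm_add_square_le[OF square_integrable_diff[OF assms(1,2)] square_integrable_diff[OF assms(2,3)]]
  by simp

lemma integral_inner_cauchy_schwarz:
  assumes f: "square_integrable M f" and g: "square_integrable M g"
  shows "(\<integral>x. f x \<bullet> g x \<partial>M)\<^sup>2 \<le> (\<integral>x. (norm (f x))\<^sup>2 \<partial>M) * (\<integral>x. (norm (g x))\<^sup>2 \<partial>M)"
proof (rule square_le_of_nonneg_quadratic)
  fix a b :: real
  have "0 \<le> (\<integral>x. (norm (a *\<^sub>R f x + b *\<^sub>R g x))\<^sup>2 \<partial>M)"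
    by (intro Bochner_Integration.integral_nonneg) auto
  also have "\<dots> = (\<integral>x. a\<^sup>2 * (norm (f x))\<^sup>2 + 2 * a * b * (f x \<bullet> g x) + b\<^sup>2 * (norm (g x))\<^sup>2 \<partial>M)"
    by (intro Bochner_Integration.integral_cong refl)
      (simp only: power2_norm_eq_inner inner_add_left inner_add_right inner_scaleR_left inner_scaleR_right
        inner_commute[of "g _" "f _"], simp add: power2_eq_square algebra_simps)
  also have "\<dots> = a\<^sup>2 * (\<integral>x. (norm (f x))\<^sup>2 \<partial>M) + 2 * a * b * (\<integral>x. f x \<bullet> g x \<partial>M) + b\<^sup>2 * (\<integral>x. (norm (g x))\<^sup>2 \<partial>M)"
    using square_integrableD[OF f] square_integrableD[OF g] square_integrable_inner[OF f g] by simp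
  finally show "0 \<le> \<dots>" .
qed

definition L2_converges :: "'x measure \<Rightarrow> (nat \<Rightarrow> 'x \<Rightarrow> 'c::euclidean_space) \<Rightarrow> ('x \<Rightarrow> 'c) \<Rightarrow> bool" where
  "L2_converges M f g \<longleftrightarrow> (\<forall>n. square_integrable M (f n)) \<and> square_integrable M g \<and>
     (\<lambda>n. \<integral>x. (norm (f n x - g x))\<^sup>2 \<partial>M) \<longlonglongrightarrow> 0"

lemma L2_converges_inner:
  assumes fg: "L2_converges M f g" and h: "square_integrable M h"
  shows "(\<lambda>n. \<integral>x. f n x \<bullet> h x \<partial>M) \<longlonglongrightarrow> (\<integral>x. g x \<bullet> h x \<partial>M)"
proof -
  have si: "square_integrable M (f n)" "square_integrable M g" for n using fg by (auto simp: L2_converges_def)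
  have bound: "((\<integral>x. f n x \<bullet> h x \<partial>M) - (\<integral>x. g x \<bullet> h x \<partial>M))\<^sup>2
      \<le> (\<integral>x. (norm (f n x - g x))\<^sup>2 \<partial>M) * (\<integral>x. (norm (h x))\<^sup>2 \<partial>M)" for n
  proof -
    have "(\<integral>x. f n x \<bullet> h x \<partial>M) - (\<integral>x. g x \<bullet> h x \<partial>M) = (\<integral>x. (f n x - g x) \<bullet> h x \<partial>M)"
      using square_integrable_inner[OF si(1) h] square_integrable_inner[OF si(2) h]
      by (simp add: inner_diff_left)
    then show ?thesis using integral_inner_cauchy_schwarz[OF square_integrable_diff[OF si] h] by simp
  qed
  have "(\<lambda>n. (\<integral>x. (norm (f n x - g x))\<^sup>2 \<partial>M) * (\<integral>x. (norm (h x))\<^sup>2 \<partial>M)) \<longlonglongrightarrow> 0 * (\<integral>x. (norm (h x))\<^sup>2 \<partial>M)"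
    using fg by (intro tendsto_mult tendsto_const) (auto simp: L2_converges_def)
  then have "(\<lambda>n. (\<integral>x. (norm (f n x - g x))\<^sup>2 \<partial>M) * (\<integral>x. (norm (h x))\<^sup>2 \<partial>M)) \<longlonglongrightarrow> 0" by simp
  then have "(\<lambda>n. ((\<integral>x. f n x \<bullet> h x \<partial>M) - (\<integral>x. g x \<bullet> h x \<partial>M))\<^sup>2) \<longlonglongrightarrow> 0"
    by (rule tendsto_sandwich[OF _ _ tendsto_const, rotated 2]) (use bound in auto)
  then have "(\<lambda>n. sqrt (((\<integral>x. f n x \<bullet> h x \<partial>M) - (\<integral>x. g x \<bullet> h x \<partial>M))\<^sup>2)) \<longlonglongrightarrow> sqrt 0"
    by (rule tendsto_real_sqrt)
  then show ?thesis by (simp add: tendsto_rabs_zero_iff LIM_zero_iff)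
qed

lemma L2_converges_linear_image:
  assumes "L2_converges M f g" "bounded_linear T"
  shows "L2_converges M (\<lambda>n x. T (f n x)) (\<lambda>x. T (g x))"
proof -
  interpret T: bounded_linear T by fact
  obtain K where K: "K > 0" "\<And>x. norm (T x) \<le> norm x * K" using T.pos_bounded by blast
  have Tsq: "(norm (T x))\<^sup>2 \<le> K\<^sup>2 * (norm x)\<^sup>2" for x
    using power_mono[OF K(2)[of x], of 2] by (simp add: power_mult_distrib mult.commute)
  have si: "square_integrable M (\<lambda>x. T (h x))" if h: "square_integrable M h" for h
  proof -
    have "(\<lambda>x. T (h x)) \<in> borel_measurable M"
      using square_integrableD(1)[OF h] borel_measurable_continuous_onI[OF linear_continuous_on[OF assms(2)]]
      by (rule measurable_compose)
    moreover have "integrable M (\<lambda>x. (norm (T (h x)))\<^sup>2)"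
    proof (rule Bochner_Integration.integrable_bound)
      show "integrable M (\<lambda>x. K\<^sup>2 * (norm (h x))\<^sup>2)" using square_integrableD(2)[OF h] by simp
      show "(\<lambda>x. (norm (T (h x)))\<^sup>2) \<in> borel_measurable M" using calculation by measurable
    qed (use Tsq in simp)
    ultimately show ?thesis by (simp add: square_integrable_def)
  qed
  have fg: "square_integrable M (f n)" "square_integrable M g" for n using assms by (auto simp: L2_converges_def)
  have bound: "(\<integral>x. (norm (T (f n x) - T (g x)))\<^sup>2 \<partial>M) \<le> K\<^sup>2 * (\<integral>x. (norm (f n x - g x))\<^sup>2 \<partial>M)" for n
  proof -
    have d: "square_integrable M (\<lambda>x. f n x - g x)" using fg by (rule square_integrable_diff)
    have "(\<integral>x. (norm (T (f n x - g x)))\<^sup>2 \<partial>M) \<le> (\<integral>x. K\<^sup>2 * (norm (f n x - g x))\<^sup>2 \<partial>M)"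
      using square_integrableD[OF d] square_integrableD[OF si[OF d]] Tsq by (intro integral_mono) auto
    then show ?thesis by (simp add: T.diff)
  qed
  have "(\<lambda>n. K\<^sup>2 * (\<integral>x. (norm (f n x - g x))\<^sup>2 \<partial>M)) \<longlonglongrightarrow> K\<^sup>2 * 0"
    using assms by (intro tendsto_mult tendsto_const) (auto simp: L2_converges_def)
  then have "(\<lambda>n. K\<^sup>2 * (\<integral>x. (norm (f n x - g x))\<^sup>2 \<partial>M)) \<longlonglongrightarrow> 0" by simp
  then have "(\<lambda>n. \<integral>x. (norm (T (f n x) - T (g x)))\<^sup>2 \<partial>M) \<longlonglongrightarrow> 0"
    by (rule tendsto_sandwich[OF _ _ tendsto_const, rotated 2]) (use bound in auto)
  then show ?thesis using si fg by (auto simp: L2_converges_def)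
qed

lemma square_integrable_linear_image:
  assumes "square_integrable M f" "bounded_linear T"
  shows "square_integrable M (\<lambda>x. T (f x))"
proof -
  have "L2_converges M (\<lambda>n. f) f" using assms(1) by (simp add: L2_converges_def)
  from L2_converges_linear_image[OF this assms(2)] show ?thesis by (simp add: L2_converges_def)
qed

lemma semi_inner_space_L2: "semi_inner_space (L2 M) (L2_inner M)"
proof
  show "L2 M \<noteq> {}" using square_integrable_zero L2_iff_square_integrable by blast
  fix u v w :: "'a \<Rightarrow> real" and a b :: real
  assume u: "u \<in> L2 M" and v: "v \<in> L2 M"
  show "(\<lambda>x. a * u x + b * v x) \<in> L2 M"
    using u v square_integrable_add[OF square_integrable_scaleR[of M u a] square_integrable_scaleR[of M v b]]
    by (simp add: L2_iff_square_integrable)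
  assume w: "w \<in> L2 M"
  show "L2_inner M (\<lambda>x. a * u x + b * v x) w = a * L2_inner M u w + b * L2_inner M v w"
    using u v w square_integrable_mult[of M u w] square_integrable_mult[of M v w]
    by (simp add: L2_iff_square_integrable L2_inner_def distrib_right mult.assoc)
qed (auto simp: L2_inner_def mult.commute intro!: Bochner_Integration.integral_nonneg)

text \<open>
  Along a subsequence whose increments \<open>d\<^sub>k\<close> have squared norm at most \<open>8\<^sup>-\<^sup>k\<close>, the series
  \<open>\<Sum> 2\<^sup>k \<bar>d\<^sub>k\<bar>\<^sup>2\<close> has a finite integral, so that almost everywhere \<open>\<bar>d\<^sub>k\<bar>\<close> is dominated by a geometric
  series and the subsequence converges pointwise. Fatou's lemma turns the pointwise limit into an
  \<open>L2\<close> limit.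
\<close>

theorem Riesz_Fischer:
  fixes f :: "nat \<Rightarrow> 'x \<Rightarrow> 'c::euclidean_space"
  assumes si: "\<And>n. square_integrable M (f n)"
    and cauchy: "\<And>\<epsilon>. 0 < \<epsilon> \<Longrightarrow> \<exists>N. \<forall>m\<ge>N. \<forall>n\<ge>N. (\<integral>x. (norm (f m x - f n x))\<^sup>2 \<partial>M) < \<epsilon>"
  shows "\<exists>g. L2_converges M f g"
proof -
  have [measurable]: "f n \<in> borel_measurable M" for n using si square_integrableD by blast
  have sid: "square_integrable M (\<lambda>x. f m x - f n x)" for m n using si by (intro square_integrable_diff)
  have nn: "(\<integral>\<^sup>+x. ennreal ((norm (f m x - f n x))\<^sup>2) \<partial>M) = ennreal (\<integral>x. (norm (f m x - f n x))\<^sup>2 \<partial>M)" for m n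
    using square_integrableD(2)[OF sid] by (intro nn_integral_eq_integral) auto
  have "\<exists>r. \<forall>k. (\<forall>m\<ge>r k. \<forall>n\<ge>r k. (\<integral>x. (norm (f m x - f n x))\<^sup>2 \<partial>M) < (1/8)^k) \<and> r k < r (Suc k)"
  proof (rule dependent_nat_choice)
    show "\<exists>N. \<forall>m\<ge>N. \<forall>n\<ge>N. (\<integral>x. (norm (f m x - f n x))\<^sup>2 \<partial>M) < (1/8)^0" using cauchy[of 1] by simp
    fix N k
    obtain N' where "\<forall>m\<ge>N'. \<forall>n\<ge>N'. (\<integral>x. (norm (f m x - f n x))\<^sup>2 \<partial>M) < (1/8)^Suc k"
      using cauchy[of "(1/8)^Suc k"] by auto
    then show "\<exists>y. (\<forall>m\<ge>y. \<forall>n\<ge>y. (\<integral>x. (norm (f m x - f n x))\<^sup>2 \<partial>M) < (1/8)^Suc k) \<and> N < y"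
      by (intro exI[of _ "max N' (Suc N)"]) auto
  qed
  then obtain r where r: "\<And>k m n. m \<ge> r k \<Longrightarrow> n \<ge> r k \<Longrightarrow> (\<integral>x. (norm (f m x - f n x))\<^sup>2 \<partial>M) < (1/8)^k"
    and r_step: "\<And>k. r k < r (Suc k)" by blast
  have r_mono: "strict_mono r" using r_step by (simp add: strict_mono_Suc_iff)
  define d where "d k x = f (r (Suc k)) x - f (r k) x" for k x
  define h where "h x = (\<Sum>k. ennreal (2^k * (norm (d k x))\<^sup>2))" for x
  have [measurable]: "d k \<in> borel_measurable M" for k unfolding d_def by measurable
  have "(\<integral>\<^sup>+x. h x \<partial>M) = (\<Sum>k. \<integral>\<^sup>+x. ennreal (2^k * (norm (d k x))\<^sup>2) \<partial>M)"
    unfolding h_def by (rule nn_integral_suminf) measurable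
  also have "\<dots> \<le> (\<Sum>k. ennreal ((1/4)^k))"
  proof (rule suminf_le)
    fix k
    have "(\<integral>\<^sup>+x. ennreal (2^k * (norm (d k x))\<^sup>2) \<partial>M) = ennreal (2^k) * (\<integral>\<^sup>+x. ennreal ((norm (d k x))\<^sup>2) \<partial>M)"
      by (subst nn_integral_cmult[symmetric]) (auto simp: ennreal_mult)
    also have "\<dots> \<le> ennreal (2^k) * ennreal ((1/8)^k)"
      unfolding d_def nn using r[of k "r (Suc k)" "r k"] r_step[of k] by (intro mult_left_mono ennreal_leI) auto
    also have "\<dots> = ennreal ((1/4)^k)"
      by (simp add: ennreal_mult[symmetric] power_mult_distrib[symmetric])
    finally show "(\<integral>\<^sup>+x. ennreal (2^k * (norm (d k x))\<^sup>2) \<partial>M) \<le> ennreal ((1/4)^k)" .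
  qed auto
  also have "\<dots> < \<infinity>"
  proof -
    have "summable (\<lambda>k. (1/4::real)^k)" by (rule summable_geometric) simp
    then have "(\<Sum>k. ennreal ((1/4)^k)) = ennreal (\<Sum>k. (1/4)^k)" by (intro suminf_ennreal2) simp_all
    then show ?thesis by simp
  qed
  finally have "(\<integral>\<^sup>+x. h x \<partial>M) \<noteq> \<infinity>" by simp
  moreover have "h \<in> borel_measurable M" unfolding h_def by measurable
  ultimately have h_fin: "AE x in M. h x \<noteq> \<infinity>" by (intro nn_integral_PInf_AE) auto
  have conv: "convergent (\<lambda>k. f (r k) x)" if "h x \<noteq> \<infinity>" for x
  proof -
    define C where "C = enn2real (h x)"
    have C: "2^k * (norm (d k x))\<^sup>2 \<le> C" for k
    proof -
      have "(\<Sum>j\<in>{k}. ennreal (2^j * (norm (d j x))\<^sup>2)) \<le> h x"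
        unfolding h_def by (rule sum_le_suminf) auto
      then have "ennreal (2^k * (norm (d k x))\<^sup>2) \<le> h x" by (simp only: sum.insert_remove finite.emptyI) simp
      also have "h x = ennreal C"
        unfolding C_def using that by (metis ennreal_enn2real infinity_ennreal_def less_top)
      finally show ?thesis by (subst (asm) ennreal_le_iff) (auto simp: C_def)
    qed
    have bound: "norm (d k x) \<le> sqrt C * (sqrt (1/2))^k" for k
    proof -
      have "(norm (d k x))\<^sup>2 \<le> C * (1/2)^k" using C[of k] by (simp add: field_simps)
      then have "sqrt ((norm (d k x))\<^sup>2) \<le> sqrt (C * (1/2)^k)" by (rule real_sqrt_le_mono)
      then show ?thesis by (simp add: real_sqrt_mult real_sqrt_power)
    qed
    have "summable (\<lambda>k. sqrt C * (sqrt (1/2))^k)"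
      by (intro summable_mult summable_geometric) simp
    then have "summable (\<lambda>k. d k x)" by (rule summable_comparison_test'[OF _ bound])
    then have "convergent (\<lambda>n. \<Sum>k<n. d k x)" by (simp add: summable_iff_convergent)
    moreover have "(\<Sum>k<n. d k x) = f (r n) x - f (r 0) x" for n
      unfolding d_def using sum_lessThan_telescope[of "\<lambda>k. f (r k) x" n] by simp
    ultimately have "convergent (\<lambda>n. f (r n) x - f (r 0) x)" by simp
    then have "convergent (\<lambda>n. f (r n) x - f (r 0) x + f (r 0) x)"
      by (intro convergent_add convergent_const)
    then show ?thesis by simp
  qed
  define g where "g x = lim (\<lambda>k. f (r k) x)" for x
  have [measurable]: "g \<in> borel_measurable M" unfolding g_def by measurable
  have lim: "AE x in M. (\<lambda>k. f (r k) x) \<longlonglongrightarrow> g x"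
    using h_fin by eventually_elim (simp add: g_def conv convergent_LIMSEQ_iff[symmetric])
  have fatou: "(\<integral>\<^sup>+x. ennreal ((norm (f n x - g x))\<^sup>2) \<partial>M) \<le> ennreal ((1/8)^k)" if "n \<ge> r k" for n k
  proof -
    have "(\<integral>\<^sup>+x. ennreal ((norm (f n x - g x))\<^sup>2) \<partial>M)
        = (\<integral>\<^sup>+x. liminf (\<lambda>m. ennreal ((norm (f n x - f (r m) x))\<^sup>2)) \<partial>M)"
    proof (rule nn_integral_cong_AE)
      show "AE x in M. ennreal ((norm (f n x - g x))\<^sup>2) = liminf (\<lambda>m. ennreal ((norm (f n x - f (r m) x))\<^sup>2))"
        using lim
      proof eventually_elim
        case (elim x)
        then have "(\<lambda>m. ennreal ((norm (f n x - f (r m) x))\<^sup>2)) \<longlonglongrightarrow> ennreal ((norm (f n x - g x))\<^sup>2)"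
          by (intro tendsto_ennrealI tendsto_intros)
        then show ?case by (simp only: lim_imp_Liminf[OF trivial_limit_sequentially])
      qed
    qed
    also have "\<dots> \<le> liminf (\<lambda>m. \<integral>\<^sup>+x. ennreal ((norm (f n x - f (r m) x))\<^sup>2) \<partial>M)"
      by (rule nn_integral_liminf) measurable
    also have "\<dots> \<le> ennreal ((1/8)^k)"
    proof (rule Liminf_le)
      show "\<forall>\<^sub>F m in sequentially. (\<integral>\<^sup>+x. ennreal ((norm (f n x - f (r m) x))\<^sup>2) \<partial>M) \<le> ennreal ((1/8)^k)"
        using eventually_ge_at_top[of k]
      proof eventually_elim
        case (elim m)
        then have "r m \<ge> r k" using r_mono by (simp add: strict_mono_less_eq)
        then show ?case unfolding nn using r[OF that, of "r m"] by (intro ennreal_leI) simp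
      qed
    qed simp
    finally show ?thesis .
  qed
  have sin: "square_integrable M (\<lambda>x. f n x - g x)" if "n \<ge> r k" for n k
    unfolding square_integrable_def
    using fatou[OF that] by (auto simp: integrable_iff_bounded intro: le_less_trans)
  have "square_integrable M (\<lambda>x. f (r 0) x - (f (r 0) x - g x))"
    by (rule square_integrable_diff[OF si sin[of 0 "r 0"]]) simp
  then have g: "square_integrable M g" by simp
  have le: "(\<integral>x. (norm (f n x - g x))\<^sup>2 \<partial>M) \<le> (1/8)^k" if "n \<ge> r k" for n k
  proof -
    have "ennreal (\<integral>x. (norm (f n x - g x))\<^sup>2 \<partial>M) \<le> ennreal ((1/8)^k)"
      using fatou[OF that] square_integrableD(2)[OF sin[OF that]] by (subst nn_integral_eq_integral[symmetric]) auto
    then show ?thesis by simp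
  qed
  have "(\<lambda>n. \<integral>x. (norm (f n x - g x))\<^sup>2 \<partial>M) \<longlonglongrightarrow> 0"
  proof (rule LIMSEQ_I)
    fix \<epsilon> :: real assume "0 < \<epsilon>"
    then obtain k where k: "(1/8::real)^k < \<epsilon>" using real_arch_pow_inv[of \<epsilon> "1/8"] by auto
    have "norm ((\<integral>x. (norm (f n x - g x))\<^sup>2 \<partial>M) - 0) < \<epsilon>" if "n \<ge> r k" for n
      using le[OF that] k by simp
    then show "\<exists>N. \<forall>n\<ge>N. norm ((\<integral>x. (norm (f n x - g x))\<^sup>2 \<partial>M) - 0) < \<epsilon>" by blast
  qed
  then show ?thesis using si g by (auto simp: L2_converges_def)
qed

section \<open>Separability of spaces of square-integrable functions\<close>

definition step_fun :: "(rat \<times> 'a set) list \<Rightarrow> 'a \<Rightarrow> real" where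
  "step_fun xs x = (\<Sum>(r, U)\<leftarrow>xs. of_rat r * indicator U x)"

lemma step_fun_append: "step_fun (xs @ ys) x = step_fun xs x + step_fun ys x"
  by (simp add: step_fun_def)

text \<open>
  Rational combinations of indicators of finite unions of basic open sets are dense: indicators of
  measurable sets are approximated by outer regularity, general functions by simple functions with
  dominated convergence.
\<close>

lemma L2_separable:
  fixes S :: "'a::euclidean_space set"
  assumes S: "S \<in> lmeasurable"
  shows "\<exists>q :: nat \<Rightarrow> 'a \<Rightarrow> real. \<forall>f. square_integrable (lebesgue_on S) f \<longrightarrow>
    (\<forall>\<epsilon>>0. \<exists>n. square_integrable (lebesgue_on S) (q n) \<and> (\<integral>x. (norm (f x - q n x))\<^sup>2 \<partial>lebesgue_on S) < \<epsilon>)"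
proof -
  let ?M = "lebesgue_on S"
  have S': "S \<in> sets lebesgue" using S by (simp add: fmeasurableD)
  interpret finite_measure ?M using S by (rule finite_measure_lebesgue_on)
  obtain \<B> :: "'a set set" where \<B>: "countable \<B>" "topological_basis \<B>"
    using ex_countable_basis by blast
  define \<U> where "\<U> = Union ` {F. finite F \<and> F \<subseteq> \<B>}"
  have \<U>_countable: "countable \<U>"
    unfolding \<U>_def using countable_Collect_finite_subset[OF \<B>(1)] by (intro countable_image)
  have \<U>_open: "open U" if "U \<in> \<U>" for U
    using that topological_basis_open[OF \<B>(2)] by (auto simp: \<U>_def)
  have M_open: "U \<inter> S \<in> sets ?M" if "open U" for U
    using that S' by (auto simp: sets_restrict_space_iff intro!: sets.Int)
  define D where "D = lists ((UNIV :: rat set) \<times> \<U>)"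
  have step_meas: "step_fun xs \<in> borel_measurable ?M" if "xs \<in> D" for xs
    using that unfolding D_def
  proof (induction xs)
    case (Cons p xs)
    obtain r U where p: "p = (r, U)" by force
    have "(indicator U :: 'a \<Rightarrow> real) \<in> borel_measurable ?M"
      using Cons(1) \<U>_open p by (intro measurable_restrict_space1 borel_measurable_indicator) auto
    then show ?case using Cons p by (simp add: step_fun_def[abs_def])
  qed (simp add: step_fun_def[abs_def])
  have step_bounded: "\<exists>B. \<forall>x. norm (step_fun xs x) \<le> B" for xs :: "(rat \<times> 'a set) list"
  proof (induction xs)
    case (Cons p xs)
    obtain r U where p: "p = (r, U)" by force
    obtain B where "\<forall>x. norm (step_fun xs x) \<le> B" using Cons by blast
    then have "norm (step_fun (p # xs) x) \<le> \<bar>of_rat r\<bar> + B" for x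
    proof -
      have "\<bar>step_fun (p # xs) x\<bar> \<le> \<bar>of_rat r * indicator U x\<bar> + \<bar>step_fun xs x\<bar>"
        unfolding step_fun_def p by (simp add: abs_triangle_ineq)
      also have "\<bar>of_rat r * indicator U x :: real\<bar> \<le> \<bar>of_rat r\<bar>" by (simp add: indicator_def)
      finally show ?thesis using \<open>\<forall>x. norm (step_fun xs x) \<le> B\<close>[rule_format, of x] by simp
    qed
    then show ?case by blast
  qed (auto simp: step_fun_def)
  have step_si: "square_integrable ?M (step_fun xs)" if "xs \<in> D" for xs
    using square_integrable_bounded[OF finite_measure_axioms step_meas[OF that]] step_bounded[of xs] by blast
  define approx where "approx f \<longleftrightarrow> square_integrable ?M f \<and>
    (\<forall>\<epsilon>>0. \<exists>xs\<in>D. (\<integral>x. (norm (f x - step_fun xs x))\<^sup>2 \<partial>?M) < \<epsilon>)" for f :: "'a \<Rightarrow> real"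
  have approx_add: "approx (\<lambda>x. f x + g x)" if f: "approx f" and g: "approx g" for f g
    unfolding approx_def
  proof (intro conjI allI impI)
    show "square_integrable ?M (\<lambda>x. f x + g x)" using f g by (auto simp: approx_def intro: square_integrable_add)
    fix \<epsilon> :: real assume "0 < \<epsilon>"
    then have "0 < \<epsilon> / 4" by simp
    then obtain xs ys where xs: "xs \<in> D" "(\<integral>x. (norm (f x - step_fun xs x))\<^sup>2 \<partial>?M) < \<epsilon> / 4"
      and ys: "ys \<in> D" "(\<integral>x. (norm (g x - step_fun ys x))\<^sup>2 \<partial>?M) < \<epsilon> / 4"
      using f g unfolding approx_def by blast
    have "(\<integral>x. (norm ((f x - step_fun xs x) + (g x - step_fun ys x)))\<^sup>2 \<partial>?M)
      \<le> 2 * (\<integral>x. (norm (f x - step_fun xs x))\<^sup>2 \<partial>?M) + 2 * (\<integral>x. (norm (g x - step_fun ys x))\<^sup>2 \<partial>?M)"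
      using f g xs ys by (intro integral_norm_add_square_le square_integrable_diff step_si) (auto simp: approx_def)
    also have "\<dots> < \<epsilon>" using xs ys by linarith
    also have "(\<lambda>x. (norm ((f x - step_fun xs x) + (g x - step_fun ys x)))\<^sup>2)
        = (\<lambda>x. (norm (f x + g x - step_fun (xs @ ys) x))\<^sup>2)"
      by (simp add: step_fun_append algebra_simps)
    finally show "\<exists>zs\<in>D. (\<integral>x. (norm (f x + g x - step_fun zs x))\<^sup>2 \<partial>?M) < \<epsilon>"
      using xs ys by (intro bexI[of _ "xs @ ys"]) (auto simp: D_def)
  qed
  have approx_zero: "approx (\<lambda>x. 0)"
    unfolding approx_def by (auto simp: D_def step_fun_def intro!: bexI[of _ "[]"])
  have approx_limit: "approx f" if f: "L2_converges ?M g f" "\<And>n. approx (g n)" for f g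
    unfolding approx_def
  proof (intro conjI allI impI)
    show sf: "square_integrable ?M f" using f by (simp add: L2_converges_def)
    fix \<epsilon> :: real assume "0 < \<epsilon>"
    moreover have "(\<lambda>n. \<integral>x. (norm (g n x - f x))\<^sup>2 \<partial>?M) \<longlonglongrightarrow> 0" using f by (simp add: L2_converges_def)
    ultimately obtain n where n: "(\<integral>x. (norm (g n x - f x))\<^sup>2 \<partial>?M) < \<epsilon> / 4"
      using order_tendstoD(2)[of _ 0 sequentially "\<epsilon> / 4"] by (force simp: eventually_sequentially)
    obtain xs where xs: "xs \<in> D" "(\<integral>x. (norm (g n x - step_fun xs x))\<^sup>2 \<partial>?M) < \<epsilon> / 4"
      using f(2)[of n] \<open>0 < \<epsilon>\<close> unfolding approx_def by (meson divide_pos_pos zero_less_numeral)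
    have "(\<integral>x. (norm (f x - step_fun xs x))\<^sup>2 \<partial>?M)
      \<le> 2 * (\<integral>x. (norm (f x - g n x))\<^sup>2 \<partial>?M) + 2 * (\<integral>x. (norm (g n x - step_fun xs x))\<^sup>2 \<partial>?M)"
      using f xs sf by (intro integral_dist_square_le step_si) (auto simp: approx_def)
    moreover have "(\<integral>x. (norm (f x - g n x))\<^sup>2 \<partial>?M) < \<epsilon> / 4"
      using n by (simp only: norm_minus_commute)
    ultimately have "(\<integral>x. (norm (f x - step_fun xs x))\<^sup>2 \<partial>?M) < \<epsilon>" using xs by linarith
    then show "\<exists>xs\<in>D. (\<integral>x. (norm (f x - step_fun xs x))\<^sup>2 \<partial>?M) < \<epsilon>" using xs by blast
  qed
  have indicator_si: "square_integrable ?M (\<lambda>x. c * indicator A x)" if "A \<in> sets ?M" for A and c :: real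
    using that by (intro square_integrable_bounded[OF finite_measure_axioms, of _ "\<bar>c\<bar>"])
      (auto simp: indicator_def)
  have approx_indicator: "approx (\<lambda>x. c * indicator A x)" if A: "A \<in> sets ?M" for A c
    unfolding approx_def
  proof (intro conjI allI impI)
    show "square_integrable ?M (\<lambda>x. c * indicator A x)" using A by (rule indicator_si)
    fix \<epsilon> :: real assume \<epsilon>: "0 < \<epsilon>"
    have AS: "A \<subseteq> S" "A \<in> sets lebesgue" using A S' by (auto simp: sets_restrict_space_iff)
    \<comment> \<open>The rational \<open>r\<close> replaces the coefficient and a finite union \<open>W n\<close> of basic open sets replaces \<open>A\<close>;
      the tolerances let each replacement contribute at most \<open>\<epsilon> / 2\<close> to the squared distance.\<close>
    define m where "m = measure ?M S + 1"
    have m: "m > 0" unfolding m_def by (simp add: add_nonneg_pos)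
    obtain r :: rat where r: "\<bar>c - of_rat r\<bar> < sqrt (\<epsilon> / (8 * m))"
      using of_rat_dense[of c "c + sqrt (\<epsilon> / (8 * m))"] \<epsilon> m by (force simp: abs_if)
    define \<rho> where "\<rho> = (of_rat r :: real)"
    have r2: "(c - \<rho>)\<^sup>2 * m < \<epsilon> / 4"
    proof -
      have "(c - \<rho>)\<^sup>2 = \<bar>c - \<rho>\<bar>\<^sup>2" by simp
      also have "\<dots> < (sqrt (\<epsilon> / (8 * m)))\<^sup>2"
        using r unfolding \<rho>_def by (intro power_strict_mono) auto
      also have "\<dots> = \<epsilon> / (8 * m)" using \<epsilon> m by simp
      finally have "(c - \<rho>)\<^sup>2 * m < \<epsilon> / (8 * m) * m" using m by (intro mult_strict_right_mono)
      then show ?thesis using \<epsilon> m by simp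
    qed
    define \<delta> where "\<delta> = \<epsilon> / (8 * (\<rho>\<^sup>2 + 1))"
    have \<delta>: "\<delta> > 0" unfolding \<delta>_def using \<epsilon> by (simp add: add_nonneg_pos)
    obtain T where T: "open T" "A \<subseteq> T" "T - A \<in> lmeasurable" "emeasure lebesgue (T - A) < ennreal \<delta>"
      using sets_lebesgue_outer_open[OF AS(2) \<delta>] by blast
    obtain \<B>' where \<B>': "\<B>' \<subseteq> \<B>" "T = \<Union>\<B>'"
      using \<B>(2) T(1) unfolding topological_basis_def by blast
    have "countable \<B>'" using \<B> \<B>' countable_subset by blast
    define b where "b = (\<lambda>n. if \<B>' = {} then {} else from_nat_into \<B>' n)"
    define W where "W n = (\<Union>i<n. b i)" for n
    have b: "T = (\<Union>i. b i)"
      using \<B>'(2) range_from_nat_into[OF _ \<open>countable \<B>'\<close>] by (auto simp: b_def)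
    have W_in: "W n \<in> \<U>" for n
    proof (cases "\<B>' = {}")
      case True
      then show ?thesis by (auto simp: W_def b_def \<U>_def intro!: image_eqI[of _ _ "{}"])
    next
      case False
      then show ?thesis using \<B>'(1) from_nat_into[OF False]
        by (auto simp: W_def b_def \<U>_def intro!: image_eqI[of _ _ "from_nat_into \<B>' ` {..<n}"])
    qed
    have "(\<lambda>n. measure ?M (W n \<inter> S)) \<longlonglongrightarrow> measure ?M (\<Union>n. W n \<inter> S)"
      using M_open \<U>_open W_in by (intro finite_Lim_measure_incseq) (force simp: incseq_def W_def)+
    moreover have "(\<Union>n. W n \<inter> S) = T \<inter> S" unfolding b W_def by auto
    ultimately have "(\<lambda>n. measure ?M (W n \<inter> S)) \<longlonglongrightarrow> measure ?M (T \<inter> S)" by simp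
    then have "\<forall>\<^sub>F n in sequentially. measure ?M (T \<inter> S) - \<delta> < measure ?M (W n \<inter> S)"
      using \<delta> by (intro order_tendstoD(1)) auto
    then obtain n where "measure ?M (T \<inter> S) - \<delta> < measure ?M (W n \<inter> S)"
      unfolding eventually_sequentially by blast
    then have n: "measure ?M (T \<inter> S) - measure ?M (W n \<inter> S) < \<delta>" by simp
    have TA: "measure ?M (T \<inter> S - A) < \<delta>"
    proof -
      have "emeasure ?M (T \<inter> S - A) = emeasure lebesgue (T \<inter> S - A)"
        using A M_open[OF T(1)] S' by (intro emeasure_restrict_space) (auto simp: sets_restrict_space_iff)
      also have "\<dots> \<le> emeasure lebesgue (T - A)" using T by (intro emeasure_mono) auto
      also have "\<dots> < ennreal \<delta>" by (rule T)
      finally show ?thesis using \<delta> by (simp add: emeasure_eq_measure ennreal_less_iff)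
    qed
    have WT: "W n \<subseteq> T" unfolding b W_def by auto
    have TW: "measure ?M (T \<inter> S - W n \<inter> S) < \<delta>"
    proof -
      have "W n \<inter> S \<subseteq> T \<inter> S" using WT by auto
      then show ?thesis
        using n finite_measure_Diff[OF M_open[OF T(1)] M_open[OF \<U>_open[OF W_in[of n]]]] by simp
    qed
    let ?W = "W n"
    have W: "?W \<inter> S \<in> sets ?M" "T \<inter> S \<in> sets ?M" using M_open T \<U>_open[OF W_in] by auto
    have sub: "(\<integral>x. (norm (indicator A x - indicator ?W x :: real))\<^sup>2 \<partial>?M) \<le> 2 * \<delta>"
    proof -
      have "(\<integral>x. (norm (indicator A x - indicator ?W x :: real))\<^sup>2 \<partial>?M)
          = (\<integral>x. (norm (indicator A x - indicator (?W \<inter> S) x :: real))\<^sup>2 \<partial>?M)"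
        by (intro Bochner_Integration.integral_cong) (auto simp: indicator_def)
      also have "\<dots> \<le> (\<integral>x. indicator (T \<inter> S - A) x + indicator (T \<inter> S - ?W \<inter> S) x \<partial>?M)"
      proof (rule integral_mono)
        show "integrable ?M (\<lambda>x. (norm (indicator A x - indicator (?W \<inter> S) x :: real))\<^sup>2)"
          using square_integrable_diff[OF indicator_si[OF A, of 1] indicator_si[OF W(1), of 1]]
          by (simp add: square_integrable_def)
        show "integrable ?M (\<lambda>x. indicator (T \<inter> S - A) x + indicator (T \<inter> S - ?W \<inter> S) x :: real)"
          using A W by (intro Bochner_Integration.integrable_add integrable_real_indicator) (auto simp: emeasure_eq_measure)
        fix x
        show "(norm (indicator A x - indicator (?W \<inter> S) x :: real))\<^sup>2
            \<le> indicator (T \<inter> S - A) x + indicator (T \<inter> S - ?W \<inter> S) x"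
          using T AS WT by (auto simp: indicator_def)
      qed
      also have "\<dots> = measure ?M (T \<inter> S - A) + measure ?M (T \<inter> S - ?W \<inter> S)"
      proof -
        have "(T \<inter> S - A) \<inter> S = T \<inter> S - A" "(T \<inter> S - ?W \<inter> S) \<inter> S = T \<inter> S - ?W \<inter> S" by auto
        then show ?thesis
          using A W by (subst Bochner_Integration.integral_add)
            (auto simp: emeasure_eq_measure intro!: integrable_real_indicator)
      qed
      finally show ?thesis using TA TW by linarith
    qed
    have Wsi: "square_integrable ?M (\<lambda>x. d * indicator ?W x)" for d :: real
    proof -
      have "square_integrable ?M (\<lambda>x. d * indicator (?W \<inter> S) x)" using W by (intro indicator_si)
      moreover have "(\<lambda>x. d * indicator (?W \<inter> S) x) \<in> borel_measurable ?M \<longleftrightarrow>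
          (\<lambda>x. d * indicator ?W x) \<in> borel_measurable ?M"
        by (intro measurable_cong) (auto simp: indicator_def)
      moreover have "integrable ?M (\<lambda>x. (norm (d * indicator (?W \<inter> S) x))\<^sup>2) \<longleftrightarrow>
          integrable ?M (\<lambda>x. (norm (d * indicator ?W x))\<^sup>2)"
        by (intro Bochner_Integration.integrable_cong) (auto simp: indicator_def)
      ultimately show ?thesis by (simp only: square_integrable_def)
    qed
    have "(\<integral>x. (norm (c * indicator A x - \<rho> * indicator ?W x))\<^sup>2 \<partial>?M)
      \<le> 2 * (\<integral>x. (norm (c * indicator A x - \<rho> * indicator A x))\<^sup>2 \<partial>?M)
        + 2 * (\<integral>x. (norm (\<rho> * indicator A x - \<rho> * indicator ?W x))\<^sup>2 \<partial>?M)"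
      by (rule integral_dist_square_le[OF indicator_si[OF A] indicator_si[OF A] Wsi])
    also have "(\<integral>x. (norm (c * indicator A x - \<rho> * indicator A x))\<^sup>2 \<partial>?M) = (c - \<rho>)\<^sup>2 * measure ?M A"
    proof -
      have "(\<lambda>x. (norm (c * indicator A x - \<rho> * indicator A x))\<^sup>2) = (\<lambda>x. (c - \<rho>)\<^sup>2 * indicator A x)"
        by (auto simp: indicator_def)
      moreover have "A \<inter> S = A" using AS by auto
      ultimately show ?thesis using A by simp
    qed
    also have "(\<integral>x. (norm (\<rho> * indicator A x - \<rho> * indicator ?W x))\<^sup>2 \<partial>?M)
        = \<rho>\<^sup>2 * (\<integral>x. (norm (indicator A x - indicator ?W x :: real))\<^sup>2 \<partial>?M)"
      by (simp add: right_diff_distrib[symmetric] power_mult_distrib)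
    also have "2 * ((c - \<rho>)\<^sup>2 * measure ?M A) + 2 * (\<rho>\<^sup>2 * (\<integral>x. (norm (indicator A x - indicator ?W x :: real))\<^sup>2 \<partial>?M))
        \<le> 2 * ((c - \<rho>)\<^sup>2 * m) + 2 * (\<rho>\<^sup>2 * (2 * \<delta>))"
    proof -
      have "measure ?M A \<le> m"
        using finite_measure_mono[OF AS(1), of] S' unfolding m_def by simp
      then show ?thesis using sub by (intro add_mono mult_left_mono) auto
    qed
    also have "2 * (\<rho>\<^sup>2 * (2 * \<delta>)) \<le> \<epsilon> / 2"
    proof -
      have "\<rho>\<^sup>2 + 1 > 0" by (simp add: add_nonneg_pos)
      then have "\<rho>\<^sup>2 / (\<rho>\<^sup>2 + 1) \<le> 1" by (simp add: divide_le_eq)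
      then have "\<epsilon> / 2 * (\<rho>\<^sup>2 / (\<rho>\<^sup>2 + 1)) \<le> \<epsilon> / 2" using \<epsilon> by (intro mult_left_le) auto
      moreover have "2 * (\<rho>\<^sup>2 * (2 * \<delta>)) = \<epsilon> / 2 * (\<rho>\<^sup>2 / (\<rho>\<^sup>2 + 1))"
        unfolding \<delta>_def using \<open>\<rho>\<^sup>2 + 1 > 0\<close> by (simp add: divide_simps)
      ultimately show ?thesis by linarith
    qed
    finally have "(\<integral>x. (norm (c * indicator A x - step_fun [(r, ?W)] x))\<^sup>2 \<partial>?M) < \<epsilon>"
      using r2 by (simp add: step_fun_def \<rho>_def)
    then show "\<exists>xs\<in>D. (\<integral>x. (norm (c * indicator A x - step_fun xs x))\<^sup>2 \<partial>?M) < \<epsilon>"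
      using W_in[of n] by (intro bexI[of _ "[(r, ?W)]"]) (auto simp: D_def)
  qed
  have approx_sum: "approx (\<lambda>x. \<Sum>y\<in>Y. y * indicator (B y) x)" if "\<And>y. y \<in> Y \<Longrightarrow> B y \<in> sets ?M" for Y B
    using that
  proof (induction Y rule: infinite_finite_induct)
    case (insert y Y)
    then have "approx (\<lambda>x. y * indicator (B y) x + (\<Sum>y\<in>Y. y * indicator (B y) x))"
      by (intro approx_add approx_indicator) blast+
    then show ?case by (simp only: sum.insert[OF insert(1,2)])
  qed (simp_all add: approx_zero)
  have approx_simple: "approx f" if f: "simple_function ?M f" for f :: "'a \<Rightarrow> real"
  proof -
    let ?g = "\<lambda>x. \<Sum>y\<in>f ` space ?M. y * indicator (f -` {y} \<inter> space ?M) x"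
    have eq: "f x = ?g x" if "x \<in> space ?M" for x
    proof -
      have "?g x = (\<Sum>y\<in>f ` space ?M. if y = f x then f x else 0)"
        using that by (intro sum.cong) (auto simp: indicator_def)
      then show ?thesis using f that by (simp add: simple_function_def)
    qed
    have g: "approx ?g" using f by (intro approx_sum) (auto simp: simple_function_def)
    have "f \<in> borel_measurable ?M \<longleftrightarrow> ?g \<in> borel_measurable ?M" by (intro measurable_cong eq)
    moreover have "integrable ?M (\<lambda>x. (norm (f x))\<^sup>2) \<longleftrightarrow> integrable ?M (\<lambda>x. (norm (?g x))\<^sup>2)"
      by (intro Bochner_Integration.integrable_cong refl) (simp only: eq)
    moreover have "(\<integral>x. (norm (f x - s x))\<^sup>2 \<partial>?M) = (\<integral>x. (norm (?g x - s x))\<^sup>2 \<partial>?M)" for s :: "'a \<Rightarrow> real"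
      by (intro Bochner_Integration.integral_cong refl) (simp only: eq)
    ultimately show ?thesis using g unfolding approx_def square_integrable_def by simp
  qed
  have approx_all: "approx f" if f: "square_integrable ?M f" for f
  proof -
    obtain F where F: "\<And>i. simple_function ?M (F i)" "\<And>x. x \<in> space ?M \<Longrightarrow> (\<lambda>i. F i x) \<longlonglongrightarrow> f x"
      "\<And>i x. x \<in> space ?M \<Longrightarrow> dist (F i x) 0 \<le> 2 * dist (f x) 0"
      using borel_measurable_implies_sequence_metric[OF square_integrableD(1)[OF f], of 0] by blast
    have bd: "(norm (F i x - f x))\<^sup>2 \<le> 10 * (norm (f x))\<^sup>2" if "x \<in> space ?M" for i x
    proof -
      have "(norm (F i x - f x))\<^sup>2 \<le> 2 * (norm (F i x))\<^sup>2 + 2 * (norm (f x))\<^sup>2"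
        using norm_add_square_le[of "F i x" "- f x"] by simp
      moreover have "(norm (F i x))\<^sup>2 \<le> (2 * norm (f x))\<^sup>2" using F(3)[OF that, of i] by (intro power_mono) auto
      ultimately show ?thesis by (simp add: power_mult_distrib)
    qed
    have F_meas: "F i \<in> borel_measurable ?M" for i using F(1) by (rule borel_measurable_simple_function)
    have "(\<lambda>i. \<integral>x. (norm (F i x - f x))\<^sup>2 \<partial>?M) \<longlonglongrightarrow> (\<integral>x. 0 \<partial>?M)"
    proof (rule integral_dominated_convergence[where w = "\<lambda>x. 10 * (norm (f x))\<^sup>2"])
      show "AE x in ?M. (\<lambda>i. (norm (F i x - f x))\<^sup>2) \<longlonglongrightarrow> 0"
      proof (rule AE_I2)
        fix x assume "x \<in> space ?M"
        then have "(\<lambda>i. (norm (F i x - f x))\<^sup>2) \<longlonglongrightarrow> (norm (f x - f x))\<^sup>2"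
          by (intro tendsto_intros F(2))
        then show "(\<lambda>i. (norm (F i x - f x))\<^sup>2) \<longlonglongrightarrow> 0" by simp
      qed
    qed (use F_meas square_integrableD[OF f] bd in auto)
    then have "L2_converges ?M F f"
      using approx_simple[OF F(1)] f by (simp add: L2_converges_def approx_def)
    then show ?thesis using approx_simple[OF F(1)] by (rule approx_limit)
  qed
  have "countable D" unfolding D_def using \<U>_countable by (intro countable_lists countable_SIGMA) auto
  moreover have "D \<noteq> {}" by (auto simp: D_def)
  ultimately have "range (from_nat_into D) = D" by (intro range_from_nat_into)
  then obtain q where q: "D = range (q :: nat \<Rightarrow> _)" by metis
  show ?thesis
  proof (intro exI[of _ "\<lambda>n. step_fun (q n)"] allI impI)
    fix f :: "'a \<Rightarrow> real" and \<epsilon> :: real assume "square_integrable ?M f" "0 < \<epsilon>"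
    then obtain xs where "xs \<in> D" "(\<integral>x. (norm (f x - step_fun xs x))\<^sup>2 \<partial>?M) < \<epsilon>"
      using approx_all[of f] unfolding approx_def by blast
    then show "\<exists>n. square_integrable ?M (step_fun (q n)) \<and> (\<integral>x. (norm (f x - step_fun (q n) x))\<^sup>2 \<partial>?M) < \<epsilon>"
    proof -
      obtain n where "xs = q n" using \<open>xs \<in> D\<close> q by auto
      then show ?thesis
        using step_si[OF \<open>xs \<in> D\<close>] \<open>(\<integral>x. (norm (f x - step_fun xs x))\<^sup>2 \<partial>?M) < \<epsilon>\<close> by blast
    qed
  qed
qed

text \<open>
  Subsets of a separable space are separable: pick one member of \<open>X\<close> near each tuple of approximants
  of the components of \<open>T u\<close>.
\<close>

lemma exists_dense_sequence:
  fixes S :: "'a::euclidean_space set" and T :: "'v \<Rightarrow> 'a \<Rightarrow> 'c::euclidean_space"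
  assumes S: "S \<in> lmeasurable" and X: "X \<noteq> {}"
    and T: "\<And>u. u \<in> X \<Longrightarrow> square_integrable (lebesgue_on S) (T u)"
  shows "\<exists>d :: nat \<Rightarrow> 'v. (\<forall>n. d n \<in> X) \<and>
    (\<forall>u\<in>X. \<forall>\<epsilon>>0. \<exists>n. (\<integral>x. (norm (T u x - T (d n) x))\<^sup>2 \<partial>lebesgue_on S) < \<epsilon>)"
proof -
  let ?M = "lebesgue_on S"
  obtain q :: "nat \<Rightarrow> 'a \<Rightarrow> real" where q: "\<And>f \<epsilon>. square_integrable ?M f \<Longrightarrow> 0 < \<epsilon> \<Longrightarrow>
      \<exists>n. square_integrable ?M (q n) \<and> (\<integral>x. (norm (f x - q n x))\<^sup>2 \<partial>?M) < \<epsilon>"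
    using L2_separable[OF S] by blast
  have comp: "square_integrable ?M (\<lambda>x. T u x \<bullet> i)" if "u \<in> X" "i \<in> Basis" for u i
    by (rule square_integrable_linear_image[OF T[OF that(1)] bounded_linear_inner_left])
  define near where "near k n u \<longleftrightarrow> (\<forall>i\<in>Basis. square_integrable ?M (q (k i)) \<and>
    (\<integral>x. (norm (T u x \<bullet> i - q (k i) x))\<^sup>2 \<partial>?M) < 1 / Suc n)" for k :: "'c \<Rightarrow> nat" and n u
  define pick where "pick k n = (if \<exists>u\<in>X. near k n u then SOME u. u \<in> X \<and> near k n u else SOME u. u \<in> X)" for k n
  have pick: "pick k n \<in> X" "\<And>u. u \<in> X \<Longrightarrow> near k n u \<Longrightarrow> near k n (pick k n)" for k n
  proof -
    show "pick k n \<in> X"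
      using X by (auto simp: pick_def intro: someI2 someI_ex[of "\<lambda>u. u \<in> X"])
    show "near k n (pick k n)" if "u \<in> X" "near k n u" for u
      using that by (auto simp: pick_def intro: someI2)
  qed
  define I where "I = (PiE (Basis :: 'c set) (\<lambda>_. UNIV :: nat set)) \<times> (UNIV :: nat set)"
  have "countable I" unfolding I_def by (intro countable_SIGMA countable_PiE) auto
  moreover have "I \<noteq> {}" by (auto simp: I_def PiE_eq_empty_iff)
  ultimately have "range (from_nat_into I) = I" by (intro range_from_nat_into)
  then obtain s where s: "I = range (s :: nat \<Rightarrow> _)" by metis
  show ?thesis
  proof (intro exI[of _ "\<lambda>m. pick (fst (s m)) (snd (s m))"] conjI allI ballI impI)
    show "pick (fst (s m)) (snd (s m)) \<in> X" for m by (rule pick)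
    fix u and \<epsilon> :: real assume u: "u \<in> X" and \<epsilon>: "0 < \<epsilon>"
    obtain n where n: "4 * real DIM('c) / \<epsilon> < Suc n" using reals_Archimedean2[of "4 * real DIM('c) / \<epsilon>"]
      by (meson less_trans of_nat_less_iff lessI)
    have "\<forall>i. \<exists>k. i \<in> Basis \<longrightarrow> square_integrable ?M (q k) \<and> (\<integral>x. (norm (T u x \<bullet> i - q k x))\<^sup>2 \<partial>?M) < 1 / Suc n"
      using q[OF comp[OF u], of _ "1 / Suc n"] by auto
    then have "\<exists>k. \<forall>i. i \<in> Basis \<longrightarrow> square_integrable ?M (q (k i)) \<and>
        (\<integral>x. (norm (T u x \<bullet> i - q (k i) x))\<^sup>2 \<partial>?M) < 1 / Suc n" by (rule choice)
    then obtain k where k: "\<And>i. i \<in> Basis \<Longrightarrow> square_integrable ?M (q (k i)) \<and>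
        (\<integral>x. (norm (T u x \<bullet> i - q (k i) x))\<^sup>2 \<partial>?M) < 1 / Suc n" by blast
    define k' where "k' = restrict k Basis"
    have near_u: "near k' n u" using k by (simp add: near_def k'_def)
    have "(k', n) \<in> I" by (auto simp: I_def k'_def)
    then have "(k', n) \<in> range s" by (simp only: s)
    then obtain m where m: "s m = (k', n)" by auto
    let ?d = "pick k' n"
    have near_d: "near k' n ?d" using pick(2)[OF u near_u] .
    have Tsi: "square_integrable ?M (T u)" "square_integrable ?M (T ?d)" using T u pick(1) by auto
    have "(\<integral>x. (norm (T u x - T ?d x))\<^sup>2 \<partial>?M) = (\<integral>x. (\<Sum>i\<in>Basis. (norm (T u x \<bullet> i - T ?d x \<bullet> i))\<^sup>2) \<partial>?M)"
    proof (intro Bochner_Integration.integral_cong refl)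
      fix x
      have "(norm (T u x - T ?d x))\<^sup>2 = (\<Sum>i\<in>Basis. ((T u x - T ?d x) \<bullet> i)\<^sup>2)"
        unfolding power2_norm_eq_inner by (subst euclidean_inner) (simp add: power2_eq_square)
      then show "(norm (T u x - T ?d x))\<^sup>2 = (\<Sum>i\<in>Basis. (norm (T u x \<bullet> i - T ?d x \<bullet> i))\<^sup>2)"
        by (simp add: inner_diff_left)
    qed
    also have "\<dots> = (\<Sum>i\<in>Basis. \<integral>x. (norm (T u x \<bullet> i - T ?d x \<bullet> i))\<^sup>2 \<partial>?M)"
      using square_integrable_diff[OF comp[OF u] comp[OF pick(1)]]
      by (intro Bochner_Integration.integral_sum) (auto simp: square_integrable_def)
    also have "\<dots> \<le> (\<Sum>i\<in>(Basis :: 'c set). 4 / Suc n)"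
    proof (rule sum_mono)
      fix i :: 'c assume i: "i \<in> Basis"
      have "(\<integral>x. (norm (T u x \<bullet> i - T ?d x \<bullet> i))\<^sup>2 \<partial>?M)
        \<le> 2 * (\<integral>x. (norm (T u x \<bullet> i - q (k' i) x))\<^sup>2 \<partial>?M) + 2 * (\<integral>x. (norm (q (k' i) x - T ?d x \<bullet> i))\<^sup>2 \<partial>?M)"
        using near_u i by (intro integral_dist_square_le comp u pick(1)) (auto simp: near_def)
      also have "\<dots> = 2 * (\<integral>x. (norm (T u x \<bullet> i - q (k' i) x))\<^sup>2 \<partial>?M) + 2 * (\<integral>x. (norm (T ?d x \<bullet> i - q (k' i) x))\<^sup>2 \<partial>?M)"
        by (simp only: norm_minus_commute)
      also have "\<dots> \<le> 4 / Suc n"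
      proof -
        have "(\<integral>x. (norm (T u x \<bullet> i - q (k' i) x))\<^sup>2 \<partial>?M) < 1 / Suc n"
          "(\<integral>x. (norm (T ?d x \<bullet> i - q (k' i) x))\<^sup>2 \<partial>?M) < 1 / Suc n"
          using near_u near_d i unfolding near_def by blast+
        then have "2 * (\<integral>x. (norm (T u x \<bullet> i - q (k' i) x))\<^sup>2 \<partial>?M)
            + 2 * (\<integral>x. (norm (T ?d x \<bullet> i - q (k' i) x))\<^sup>2 \<partial>?M) \<le> 4 * (1 / Suc n)" by linarith
        then show ?thesis by simp
      qed
      finally show "(\<integral>x. (norm (T u x \<bullet> i - T ?d x \<bullet> i))\<^sup>2 \<partial>?M) \<le> 4 / Suc n" .
    qed
    also have "\<dots> = 4 * real DIM('c) / Suc n" by simp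
    also have "\<dots> < \<epsilon>"
    proof -
      have "4 * real DIM('c) < real (Suc n) * \<epsilon>" using n by (simp only: pos_divide_less_eq[OF \<epsilon>])
      then show ?thesis by (simp only: pos_divide_less_eq[OF of_nat_0_less_iff[THEN iffD2, OF zero_less_Suc]] mult.commute)
    qed
    finally show "\<exists>m. (\<integral>x. (norm (T u x - T (pick (fst (s m)) (snd (s m))) x))\<^sup>2 \<partial>?M) < \<epsilon>"
      using m by (intro exI[of _ m]) simp
  qed
qed

section \<open>Smooth bump functions\<close>

lemma frechet_derivative_eqI: "(f has_derivative f') (at x) \<Longrightarrow> frechet_derivative f (at x) = f'"
  using frechet_derivative_at by metis

lemma C_k_Suc_imp: "C_k (Suc k) f \<Longrightarrow> C_k k f"
proof (induction k arbitrary: f)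
  case 0
  then show ?case by (simp add: differentiable_imp_continuous_on)
qed auto

lemma C_k_differentiable: "C_k (Suc k) f \<Longrightarrow> f differentiable (at x)"
  by (simp add: differentiable_on_def)

lemma C_k_const: "C_k k (\<lambda>x. c)"
  by (induction k arbitrary: c) auto

lemma C_k_add: "C_k k f \<Longrightarrow> C_k k g \<Longrightarrow> C_k k (\<lambda>x. f x + g x)"
proof (induction k arbitrary: f g)
  case 0
  then show ?case by (auto intro: continuous_on_add)
next
  case (Suc k)
  have "frechet_derivative (\<lambda>x. f x + g x) (at x) = (\<lambda>i. frechet_derivative f (at x) i + frechet_derivative g (at x) i)" for x
    by (intro frechet_derivative_eqI has_derivative_add)
      (use C_k_differentiable[OF Suc.prems(1)] C_k_differentiable[OF Suc.prems(2)] frechet_derivative_works in blast)+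
  then show ?case using Suc by (auto intro!: differentiable_on_add)
qed

lemma C_k_mult: "C_k k f \<Longrightarrow> C_k k g \<Longrightarrow> C_k k (\<lambda>x. f x * g x)"
proof (induction k arbitrary: f g)
  case 0
  then show ?case by (auto intro: continuous_on_mult)
next
  case (Suc k)
  have "frechet_derivative (\<lambda>x. f x * g x) (at x)
      = (\<lambda>i. f x * frechet_derivative g (at x) i + frechet_derivative f (at x) i * g x)" for x
    by (intro frechet_derivative_eqI has_derivative_mult)
      (use C_k_differentiable[OF Suc.prems(1)] C_k_differentiable[OF Suc.prems(2)] frechet_derivative_works in blast)+
  moreover have "C_k k f" "C_k k g" using Suc.prems C_k_Suc_imp by blast+
  ultimately show ?case using Suc by (auto intro!: differentiable_on_mult C_k_add)
qed

lemma C_k_prod: "(\<And>i. i \<in> I \<Longrightarrow> C_k k (f i)) \<Longrightarrow> C_k k (\<lambda>x. \<Prod>i\<in>I. f i x)"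
  by (induction I rule: infinite_finite_induct) (auto intro: C_k_const C_k_mult)

text \<open>
  The functions \<open>t \<mapsto> exp (-1/t) / t\<^sup>m\<close>, extended by zero, are closed under differentiation up to
  linear combinations; hence all of them are smooth.
\<close>

definition flat :: "nat \<Rightarrow> real \<Rightarrow> real" where
  "flat m t = (if 0 < t then exp (- (1 / t)) / t ^ m else 0)"

lemma flat_tendsto_0: "(flat m \<longlongrightarrow> 0) (at 0)"
proof -
  have "((\<lambda>t. (inverse t) ^ m / exp (inverse t)) \<longlongrightarrow> 0) (at_right (0::real))"
    using filterlim_compose[OF tendsto_power_div_exp_0[of m] filterlim_inverse_at_top_right] .
  moreover have "\<forall>\<^sub>F t in at_right (0::real). (inverse t) ^ m / exp (inverse t) = flat m t"
    by (auto simp: eventually_at_filter flat_def exp_minus divide_simps)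
  ultimately have r: "(flat m \<longlongrightarrow> 0) (at_right 0)" by (rule Lim_transform_eventually)
  have "\<forall>\<^sub>F t in at_left (0::real). 0 = flat m t" by (auto simp: eventually_at_filter flat_def)
  then have l: "(flat m \<longlongrightarrow> 0) (at_left 0)" by (rule Lim_transform_eventually[OF tendsto_const])
  show ?thesis using l r by (simp add: filterlim_split_at)
qed

lemma flat_has_derivative: "(flat m has_real_derivative flat (m + 2) t - real m * flat (m + 1) t) (at t)"
proof (cases t "0 :: real" rule: linorder_cases)
  case less
  have "((\<lambda>t. 0) has_real_derivative 0) (at t)" by simp
  then have "(flat m has_real_derivative 0) (at t)"
    by (rule DERIV_cong_ev[THEN iffD1, rotated 3])
      (use less in \<open>auto simp: flat_def intro!: eventually_mono[OF eventually_nhds_in_open[of "{..<0}"]]\<close>)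
  then show ?thesis using less by (simp add: flat_def)
next
  case greater
  have "((\<lambda>t. exp (- (1 / t)) / t ^ m) has_real_derivative
      flat (m + 2) t - real m * flat (m + 1) t) (at t)"
    using greater
    by (auto intro!: derivative_eq_intros simp: flat_def)
       (cases m; simp add: field_simps power2_eq_square)
  then show ?thesis
    by (rule DERIV_cong_ev[THEN iffD1, rotated 3])
      (use greater in \<open>auto simp: flat_def intro!: eventually_mono[OF eventually_nhds_in_open[of "{0<..}"]]\<close>)
next
  case equal
  have "((\<lambda>h. (flat m (0 + h) - flat m 0) / h) \<longlongrightarrow> 0) (at 0)"
  proof (rule Lim_transform_eventually[OF flat_tendsto_0[of "Suc m"]])
    show "\<forall>\<^sub>F h in at 0. flat (Suc m) h = (flat m (0 + h) - flat m 0) / h"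
      by (auto simp: eventually_at_filter flat_def)
  qed
  then show ?thesis using equal by (simp add: DERIV_def flat_def)
qed

lemma C_k_flat: "C_k k (\<lambda>x :: 'a::euclidean_space. flat m (x \<bullet> v + c))"
proof (induction k arbitrary: m)
  case 0
  have "isCont (flat m) t" for t using flat_has_derivative DERIV_isCont by blast
  then have "continuous_on UNIV (flat m)" by (simp add: continuous_at_imp_continuous_on)
  moreover have "continuous_on UNIV (\<lambda>x :: 'a. x \<bullet> v + c)" by (intro continuous_intros)
  ultimately have "continuous_on UNIV (\<lambda>x :: 'a. flat m (x \<bullet> v + c))" by (rule continuous_on_compose2) simp
  then show ?case by simp
next
  case (Suc k)
  have d: "((\<lambda>x :: 'a. flat m (x \<bullet> v + c)) has_derivative
      (\<lambda>i. (flat (m + 2) (x \<bullet> v + c) - real m * flat (m + 1) (x \<bullet> v + c)) * (i \<bullet> v))) (at x)" for x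
  proof -
    have "((\<lambda>x :: 'a. x \<bullet> v + c) has_derivative (\<lambda>i. i \<bullet> v)) (at x)"
      by (auto intro!: derivative_eq_intros)
    then show ?thesis
      using has_derivative_compose[OF _ flat_has_derivative[unfolded has_field_derivative_def]] by blast
  qed
  have "C_k k (\<lambda>x :: 'a. (flat (m + 2) (x \<bullet> v + c) + (- real m) * flat (m + 1) (x \<bullet> v + c)) * (i \<bullet> v))" for i
    by (intro C_k_mult C_k_add C_k_const Suc)
  then show ?case
    using d by (auto simp: frechet_derivative_eqI[OF d] differentiable_on_def differentiable_def)
qed

text \<open>
  For \<open>n > 0\<close> the product is positive exactly on the open box, and it tends to 1 there as \<open>n\<close> grows, since
  \<open>flat 0 (n t) = exp (-1/(n t))\<close> for \<open>t > 0\<close>.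
\<close>

definition bump :: "'a::euclidean_space \<Rightarrow> 'a \<Rightarrow> nat \<Rightarrow> 'a \<Rightarrow> real" where
  "bump a b n x = (\<Prod>i\<in>Basis. flat 0 (x \<bullet> (real n *\<^sub>R i) + (- real n * (a \<bullet> i)))
     * flat 0 (x \<bullet> (- real n *\<^sub>R i) + real n * (b \<bullet> i)))"

lemma C_k_bump: "C_k k (bump a b n)"
  unfolding bump_def[abs_def] by (intro C_k_prod C_k_mult C_k_flat)

lemma flat_0_bounds: "0 \<le> flat 0 t" "flat 0 t \<le> 1"
  by (auto simp: flat_def)

lemma bump_bounds: "0 \<le> bump a b n x" "bump a b n x \<le> 1"
  unfolding bump_def using flat_0_bounds
  by (auto intro!: prod_nonneg prod_le_1 mult_le_one)

lemma bump_outside: "x \<notin> box a b \<Longrightarrow> bump a b n x = 0"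
proof -
  assume "x \<notin> box a b"
  then obtain i where i: "i \<in> Basis" "x \<bullet> i \<le> a \<bullet> i \<or> b \<bullet> i \<le> x \<bullet> i" by (auto simp: box_def not_less)
  then have "real n * (x \<bullet> i) \<le> real n * (a \<bullet> i) \<or> real n * (b \<bullet> i) \<le> real n * (x \<bullet> i)"
    by (auto intro: mult_left_mono)
  then have "flat 0 (x \<bullet> (real n *\<^sub>R i) + (- real n * (a \<bullet> i))) * flat 0 (x \<bullet> (- real n *\<^sub>R i) + real n * (b \<bullet> i)) = 0"
    by (auto simp: flat_def)
  then show ?thesis unfolding bump_def using i(1) by (intro prod_zero) auto
qed

lemma bump_tendsto_indicator: "(\<lambda>n. bump a b n x) \<longlonglongrightarrow> indicator (box a b) x"
proof (cases "x \<in> box a b")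
  case True
  have flat1: "(\<lambda>n. flat 0 (real n * t)) \<longlonglongrightarrow> 1" if "t > 0" for t
  proof -
    have "filterlim (\<lambda>n. real n * t) at_top sequentially"
      using that by (intro filterlim_at_top_mult_tendsto_pos[OF tendsto_const])
        (auto simp: filterlim_real_sequentially)
    then have "(\<lambda>n. inverse (real n * t)) \<longlonglongrightarrow> 0" by (rule tendsto_inverse_0_at_top)
    then have "(\<lambda>n. exp (- inverse (real n * t))) \<longlonglongrightarrow> exp (- 0)" by (intro tendsto_intros)
    moreover have "\<forall>\<^sub>F n in sequentially. exp (- inverse (real n * t)) = flat 0 (real n * t)"
      using that by (auto simp: flat_def inverse_eq_divide intro!: eventually_mono[OF eventually_gt_at_top[of 0]])
    ultimately show ?thesis using Lim_transform_eventually by fastforce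
  qed
  have "(\<lambda>n. \<Prod>i\<in>(Basis :: 'a set). flat 0 (real n * (x \<bullet> i - a \<bullet> i)) * flat 0 (real n * (b \<bullet> i - x \<bullet> i)))
      \<longlonglongrightarrow> (\<Prod>i\<in>(Basis :: 'a set). 1 * 1)"
    by (intro tendsto_prod tendsto_mult flat1) (use True in \<open>auto simp: box_def\<close>)
  moreover have "(\<lambda>n. \<Prod>i\<in>(Basis :: 'a set). flat 0 (real n * (x \<bullet> i - a \<bullet> i)) * flat 0 (real n * (b \<bullet> i - x \<bullet> i)))
      = (\<lambda>n. bump a b n x)"
    by (simp add: bump_def algebra_simps)
  ultimately show ?thesis using True by simp
qed (simp add: bump_outside)

lemma bump_test_function:
  assumes "cbox a b \<subseteq> \<Omega>"
  shows "bump a b n \<in> test_functions \<Omega>"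
proof -
  have "{x. bump a b n x \<noteq> 0} \<subseteq> cbox a b"
    using bump_outside[of _ a b n] box_subset_cbox[of a b] by auto
  then have sub: "closure {x. bump a b n x \<noteq> 0} \<subseteq> cbox a b" by (intro closure_minimal closed_cbox)
  then have "compact (closure {x. bump a b n x \<noteq> 0})"
    unfolding compact_eq_bounded_closed by (intro conjI bounded_subset[OF bounded_cbox] closed_closure)
  then show ?thesis
    using sub assms C_k_bump unfolding test_functions_def by auto
qed

lemma test_functionD:
  assumes "\<phi> \<in> test_functions \<Omega>"
  shows "continuous_on UNIV \<phi>" "\<phi> differentiable (at x)"
    "i \<in> Basis \<Longrightarrow> continuous_on UNIV (\<lambda>x. frechet_derivative \<phi> (at x) i)"
    "compact (closure {x. \<phi> x \<noteq> 0})" "closure {x. \<phi> x \<noteq> 0} \<subseteq> \<Omega>"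
    "x \<notin> closure {x. \<phi> x \<noteq> 0} \<Longrightarrow> \<phi> x = 0"
    "x \<notin> closure {x. \<phi> x \<noteq> 0} \<Longrightarrow> frechet_derivative \<phi> (at x) = (\<lambda>i. 0)"
proof -
  have C: "C_k 0 \<phi>" "C_k (Suc 0) \<phi>" and K: "compact (closure {x. \<phi> x \<noteq> 0})" "closure {x. \<phi> x \<noteq> 0} \<subseteq> \<Omega>"
    using assms by (auto simp: test_functions_def simp del: C_k.simps)
  show "continuous_on UNIV \<phi>" using C(1) by simp
  show "\<phi> differentiable (at x)" using C(2) by (rule C_k_differentiable)
  show "i \<in> Basis \<Longrightarrow> continuous_on UNIV (\<lambda>x. frechet_derivative \<phi> (at x) i)" using C(2) by simp
  show "compact (closure {x. \<phi> x \<noteq> 0})" "closure {x. \<phi> x \<noteq> 0} \<subseteq> \<Omega>" by fact+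
  show "\<phi> x = 0" if "x \<notin> closure {x. \<phi> x \<noteq> 0}" using that closure_subset[of "{x. \<phi> x \<noteq> 0}"] by auto
  assume x: "x \<notin> closure {x. \<phi> x \<noteq> 0}"
  have "(\<phi> has_derivative (\<lambda>i. 0)) (at x)"
  proof (rule has_derivative_transform_within_open[of "\<lambda>_. 0" _ x UNIV "- closure {x. \<phi> x \<noteq> 0}"])
    show "0 = \<phi> y" if "y \<in> - closure {x. \<phi> x \<noteq> 0}" for y using that closure_subset[of "{x. \<phi> x \<noteq> 0}"] by auto
  qed (use x in auto)
  then show "frechet_derivative \<phi> (at x) = (\<lambda>i. 0)" by (rule frechet_derivative_eqI)
qed

lemma bounded_if_compact_support:
  fixes \<psi> :: "'a::euclidean_space \<Rightarrow> real"
  assumes "continuous_on UNIV \<psi>" "compact K" "\<And>x. x \<notin> K \<Longrightarrow> \<psi> x = 0"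
  obtains B where "\<And>x. norm (\<psi> x) \<le> B"
proof -
  have "compact (\<psi> ` K)" using assms continuous_on_subset compact_continuous_image by blast
  then have "bounded (\<psi> ` K)" by (rule compact_imp_bounded)
  then obtain B where "\<And>x. x \<in> K \<Longrightarrow> norm (\<psi> x) \<le> B" by (auto simp: bounded_iff)
  then have "norm (\<psi> x) \<le> max B 0" for x using assms(3)[of x] by (cases "x \<in> K") (auto intro: max.coboundedI1)
  then show ?thesis using that by blast
qed

lemma test_function_bounded:
  assumes "\<phi> \<in> test_functions \<Omega>"
  obtains B where "\<And>x. norm (\<phi> x) \<le> B"
  using bounded_if_compact_support[OF test_functionD(1,4,6)[OF assms]] that by blast

lemma test_function_derivative_bounded:
  assumes "\<phi> \<in> test_functions \<Omega>" "i \<in> Basis"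
  obtains B where "\<And>x. norm (frechet_derivative \<phi> (at x) i) \<le> B"
  using bounded_if_compact_support[OF test_functionD(3)[OF assms] test_functionD(4)[OF assms(1)]]
    test_functionD(7)[OF assms(1)] that by (auto dest!: fun_cong)

lemma borel_measurable_lebesgue_on_continuous:
  fixes \<psi> :: "'a::euclidean_space \<Rightarrow> real"
  shows "continuous_on UNIV \<psi> \<Longrightarrow> \<psi> \<in> borel_measurable (lebesgue_on \<Omega>)"
  by (intro measurable_restrict_space1 measurable_completion) (simp add: borel_measurable_continuous_onI)

text \<open>A compactly supported continuous factor makes a locally integrable function integrable.\<close>

lemma integrable_locally_integrable_mult:
  fixes f \<psi> :: "'a::euclidean_space \<Rightarrow> real"
  assumes \<Omega>: "open \<Omega>" and f: "locally_integrable \<Omega> f"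
    and \<psi>: "continuous_on UNIV \<psi>" "compact K" "K \<subseteq> \<Omega>" "\<And>x. x \<notin> K \<Longrightarrow> \<psi> x = 0"
  shows "integrable (lebesgue_on \<Omega>) (\<lambda>x. f x * \<psi> x)"
    and "integral\<^sup>L (lebesgue_on \<Omega>) (\<lambda>x. f x * \<psi> x) = integral\<^sup>L lebesgue (\<lambda>x. indicator K x * f x * \<psi> x)"
proof -
  have fK: "integrable lebesgue (\<lambda>x. indicator K x * f x)"
    using f \<psi> by (auto simp: locally_integrable_def set_integrable_def)
  obtain B where B: "\<And>x. norm (\<psi> x) \<le> B" using bounded_if_compact_support[OF \<psi>(1,2,4)] by blast
  have i: "integrable lebesgue (\<lambda>x. (indicator K x * f x) * \<psi> x)"
  proof (rule Bochner_Integration.integrable_bound)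
    show "integrable lebesgue (\<lambda>x. B * (indicator K x * f x))" using fK by simp
    show "(\<lambda>x. indicator K x * f x * \<psi> x) \<in> borel_measurable lebesgue"
      using borel_measurable_integrable[OF fK] borel_measurable_lebesgue_on_continuous[OF \<psi>(1), of UNIV]
      by (simp add: lebesgue_on_UNIV_eq)
    have "0 \<le> B" using B[of undefined] norm_ge_zero order_trans by blast
    then show "AE x in lebesgue. norm (indicator K x * f x * \<psi> x) \<le> norm (B * (indicator K x * f x))"
      using B by (auto simp: abs_mult mult.commute intro!: mult_right_mono)
  qed
  have eq: "indicator \<Omega> x *\<^sub>R (f x * \<psi> x) = indicator K x * f x * \<psi> x" for x
    using \<psi>(3) \<psi>(4)[of x] by (auto simp: indicator_def)
  have \<Omega>': "\<Omega> \<in> sets lebesgue" using \<Omega> by auto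
  show "integrable (lebesgue_on \<Omega>) (\<lambda>x. f x * \<psi> x)"
    "integral\<^sup>L (lebesgue_on \<Omega>) (\<lambda>x. f x * \<psi> x) = integral\<^sup>L lebesgue (\<lambda>x. indicator K x * f x * \<psi> x)"
    using \<Omega>' i by (simp_all add: integrable_restrict_space integral_restrict_space eq del: real_scaleR_def)
qed

text \<open>
  Boxes form an intersection-stable generator of the Borel sets, so by Dynkin's argument the integral
  over every Borel set vanishes, in particular over the sets where \<open>F\<close> is positive or negative.
\<close>

lemma AE_zero_if_integral_boxes_zero:
  fixes F :: "'a::euclidean_space \<Rightarrow> real"
  assumes F: "integrable lborel F" "integral\<^sup>L lborel F = 0"
    and box: "\<And>a b. (\<integral>x. indicator (box a b) x * F x \<partial>lborel) = 0"
  shows "AE x in lborel. F x = 0"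
proof -
  have ind: "integrable lborel (\<lambda>x. indicator A x * F x)" if "A \<in> sets borel" for A
    using integrable_mult_indicator[of A lborel F] that F by simp
  have Int_stable_boxes: "Int_stable (range (\<lambda>(a :: 'a, b). box a b))"
  proof -
    have "box a b \<inter> box c d \<in> range (\<lambda>(a :: 'a, b). box a b)" for a b c d :: 'a
      unfolding box_Int_box by (rule range_eqI[of _ _ "(_, _)"]) simp
    then show ?thesis by (auto simp: Int_stable_def)
  qed
  have boxes_Pow: "range (\<lambda>(a :: 'a, b). box a b) \<subseteq> Pow UNIV" by simp
  have int0: "(\<integral>x. indicator A x * F x \<partial>lborel) = 0" if "A \<in> sigma_sets UNIV (range (\<lambda>(a :: 'a, b). box a b))" for A
    using Int_stable_boxes boxes_Pow that
  proof (induction rule: sigma_sets_induct_disjoint)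
    case (basic A)
    then show ?case using box by auto
  next
    case empty
    then show ?case by simp
  next
    case (compl A)
    have A: "A \<in> sets borel" using compl.hyps by (simp add: borel_eq_box)
    have "(\<lambda>x. indicator (UNIV - A) x * F x) = (\<lambda>x. F x - indicator A x * F x)"
      by (auto simp: indicator_def)
    then show ?case using compl ind[OF A] F by simp
  next
    case (union A)
    have A: "A i \<in> sets lborel" for i using union by (auto simp: borel_eq_box)
    have "set_integrable lborel (\<Union>i. A i) F"
      using ind[of "\<Union>i. A i"] A by (simp add: set_integrable_def)
    then have "set_lebesgue_integral lborel (\<Union>i. A i) F = (\<Sum>i. set_lebesgue_integral lborel (A i) F)"
      using union A by (intro lebesgue_integral_countable_add) (auto simp: disjoint_family_on_def)
    then show ?case using union by (simp add: set_lebesgue_integral_def)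
  qed
  have borel0: "(\<integral>x. indicator A x * F x \<partial>lborel) = 0" if "A \<in> sets borel" for A
    using int0[of A] that by (simp add: borel_eq_box)
  have [measurable]: "F \<in> borel_measurable borel" using F by auto
  have P: "{x. 0 < F x} \<in> sets borel" "{x. F x < 0} \<in> sets borel" by measurable
  have "AE x in lborel. indicator {x. 0 < F x} x * F x = 0"
    using borel0[OF P(1)] ind[OF P(1)]
    by (subst (asm) integral_nonneg_eq_0_iff_AE) (auto simp: indicator_def)
  moreover have "AE x in lborel. - (indicator {x. F x < 0} x * F x) = 0"
    using borel0[OF P(2)] ind[OF P(2)]
      integral_nonneg_eq_0_iff_AE[of lborel "\<lambda>x. - (indicator {x. F x < 0} x * F x)"]
    by (auto simp: indicator_def)
  ultimately show ?thesis by eventually_elim (auto simp: indicator_def split: if_splits)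
qed

text \<open>
  Testing with bump functions and letting them increase to the indicator of a box shows that the
  integral over every box with closure in \<open>\<Omega>\<close> is zero; countably many such boxes cover \<open>\<Omega>\<close> up to a null set.
\<close>

lemma fundamental_lemma_calculus_of_variations:
  fixes f :: "'a::euclidean_space \<Rightarrow> real"
  assumes \<Omega>: "open \<Omega>" and f: "locally_integrable \<Omega> f"
    and test: "\<And>\<phi>. \<phi> \<in> test_functions \<Omega> \<Longrightarrow> (\<integral>x. f x * \<phi> x \<partial>lebesgue_on \<Omega>) = 0"
  shows "AE x in lebesgue_on \<Omega>. f x = 0"
proof -
  have box0: "(\<integral>x. indicator (box a b) x * f x \<partial>lebesgue) = 0" if ab: "cbox a b \<subseteq> \<Omega>" for a b
  proof -
    have fK: "integrable lebesgue (\<lambda>x. indicator (cbox a b) x * f x)"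
      using f ab by (auto simp: locally_integrable_def set_integrable_def)
    have bump_meas: "bump a b n \<in> borel_measurable lebesgue" for n
      using borel_measurable_lebesgue_on_continuous[OF test_functionD(1)[OF bump_test_function[OF ab]], of _ UNIV]
      by (simp add: lebesgue_on_UNIV_eq)
    have "(\<lambda>n. \<integral>x. indicator (cbox a b) x * f x * bump a b n x \<partial>lebesgue)
        \<longlonglongrightarrow> (\<integral>x. indicator (cbox a b) x * f x * indicator (box a b) x \<partial>lebesgue)"
    proof (rule integral_dominated_convergence[where w = "\<lambda>x. norm (indicator (cbox a b) x * f x)"])
      show "AE x in lebesgue. (\<lambda>n. indicator (cbox a b) x * f x * bump a b n x)
          \<longlonglongrightarrow> indicator (cbox a b) x * f x * indicator (box a b) x"
        by (intro AE_I2 tendsto_mult tendsto_const bump_tendsto_indicator)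
      show "AE x in lebesgue. norm (indicator (cbox a b) x * f x * bump a b n x)
          \<le> norm (indicator (cbox a b) x * f x)" for n
        using bump_bounds[of a b n] by (intro AE_I2) (auto simp: abs_mult intro!: mult_left_le)
      have "indicator (box a b) \<in> borel_measurable (lebesgue :: 'a measure)"
        by (intro borel_measurable_indicator) auto
      then show "(\<lambda>x. indicator (cbox a b) x * f x * indicator (box a b) x) \<in> borel_measurable lebesgue"
        using borel_measurable_integrable[OF fK] by (rule borel_measurable_times[rotated])
      show "(\<lambda>x. indicator (cbox a b) x * f x * bump a b n x) \<in> borel_measurable lebesgue" for n
        by (rule borel_measurable_times[OF borel_measurable_integrable[OF fK] bump_meas])
      show "integrable lebesgue (\<lambda>x. norm (indicator (cbox a b) x * f x))" by (rule integrable_norm[OF fK])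
    qed
    moreover have "(\<integral>x. indicator (cbox a b) x * f x * bump a b n x \<partial>lebesgue) = 0" for n
    proof -
      have "bump a b n x = 0" if "x \<notin> cbox a b" for x
        using that bump_outside box_subset_cbox by blast
      then show ?thesis
        using integrable_locally_integrable_mult(2)[OF \<Omega> f test_functionD(1)[OF bump_test_function[OF ab]] compact_cbox ab]
          test[OF bump_test_function[OF ab]] by metis
    qed
    moreover have "(\<lambda>x. indicator (cbox a b) x * f x * indicator (box a b) x) = (\<lambda>x. indicator (box a b) x * f x)"
      using box_subset_cbox[of a b] by (intro ext) (auto split: split_indicator)
    ultimately show ?thesis by (simp add: LIMSEQ_const_iff)
  qed
  have cell: "AE x in lebesgue. x \<in> cbox a b \<longrightarrow> f x = 0" if ab: "cbox a b \<subseteq> \<Omega>" for a b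
  proof -
    define F where "F = (\<lambda>x. indicator (box a b) x * f x)"
    have "integrable lebesgue (\<lambda>x. indicator (cbox a b) x * f x)"
      using f ab by (auto simp: locally_integrable_def set_integrable_def)
    then have "integrable lebesgue (\<lambda>x. indicator (box a b) x *\<^sub>R (indicator (cbox a b) x * f x))"
      by (intro integrable_mult_indicator) auto
    moreover have "(\<lambda>x. indicator (box a b) x *\<^sub>R (indicator (cbox a b) x * f x)) = F"
      using box_subset_cbox[of a b] unfolding F_def by (intro ext) (auto split: split_indicator)
    ultimately have F: "integrable lebesgue F" by simp
    obtain F' where F': "F' \<in> borel_measurable lborel" "AE x in lborel. F x = F' x"
      using completion_ex_borel_measurable_real[OF borel_measurable_integrable[OF F]] by blast
    have F'i: "integrable lborel F'"
      using integrable_cong_AE_imp[OF F measurable_completion[OF F'(1)] AE_completion[OF F'(2)]] F'(1)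
      by (simp add: integrable_completion)
    have eq: "(\<integral>x. indicator (box c d) x * F' x \<partial>lborel) = (\<integral>x. indicator (box c d) x * F x \<partial>lebesgue)" for c d
    proof -
      have m: "(\<lambda>x. indicator (box c d) x * F' x) \<in> borel_measurable lborel" using F'(1) by simp
      have "(\<integral>x. indicator (box c d) x * F' x \<partial>lborel) = (\<integral>x. indicator (box c d) x * F' x \<partial>lebesgue)"
        using m by (simp add: integral_completion)
      also have "\<dots> = (\<integral>x. indicator (box c d) x * F x \<partial>lebesgue)"
      proof (rule integral_cong_AE)
        show "AE x in lebesgue. indicator (box c d) x * F' x = indicator (box c d) x * F x"
          using AE_completion[OF F'(2)] by eventually_elim simp
        show "(\<lambda>x. indicator (box c d) x * F x) \<in> borel_measurable lebesgue"
          by (rule borel_measurable_times[OF borel_measurable_indicator borel_measurable_integrable[OF F]]) auto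
      qed (rule measurable_completion[OF m])
      finally show ?thesis .
    qed
    have box_eq: "(\<integral>x. indicator (box c d) x * F' x \<partial>lborel) = 0" for c d
    proof -
      obtain p q where pq: "box c d \<inter> box a b = box p q" using box_Int_box[of c d a b] by blast
      have *: "(\<lambda>x. indicator (box c d) x * F x) = (\<lambda>x. indicator (box p q) x * f x)"
        unfolding F_def pq[symmetric] by (intro ext) (auto split: split_indicator)
      show ?thesis
      proof (cases "box p q = {}")
        case True
        then show ?thesis unfolding eq * by simp
      next
        case False
        then have "cbox p q = closure (box p q)" by simp
        also have "\<dots> \<subseteq> cbox a b"
          using pq box_subset_cbox[of a b] by (intro closure_minimal closed_cbox) auto
        finally show ?thesis unfolding eq * using ab by (intro box0) simp
      qed
    qed
    have total: "integral\<^sup>L lborel F' = 0"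
    proof -
      have "integral\<^sup>L lborel F' = integral\<^sup>L lebesgue F'" using F' by (simp add: integral_completion)
      also have "\<dots> = integral\<^sup>L lebesgue F"
      proof (rule integral_cong_AE)
        show "AE x in lebesgue. F' x = F x" using AE_completion[OF F'(2)] by eventually_elim simp
      qed (use F F' in \<open>auto intro: measurable_completion\<close>)
      finally show ?thesis using box0[OF ab] by (simp add: F_def)
    qed
    have "AE x in lborel. F' x = 0"
      by (rule AE_zero_if_integral_boxes_zero[OF F'i total box_eq])
    then have "AE x in lebesgue. F' x = 0" by (rule AE_completion)
    moreover have "AE x in lebesgue. x \<notin> cbox a b - box a b"
      by (rule AE_not_in) (use negligible_frontier_interval[of a b] in \<open>simp only: negligible_iff_null_sets\<close>)
    ultimately show ?thesis
      using AE_completion[OF F'(2)] by eventually_elim (auto simp: F_def indicator_def split: if_splits)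
  qed
  obtain \<D> where \<D>: "countable \<D>" "\<D> \<subseteq> Pow \<Omega>" "\<And>X. X \<in> \<D> \<Longrightarrow> \<exists>a b. X = cbox a b" "\<Union>\<D> = \<Omega>"
  proof (rule open_countable_Union_open_cbox[OF \<Omega>])
    fix \<D> assume "countable \<D>" "\<D> \<subseteq> Pow \<Omega>" "\<And>X. X \<in> \<D> \<Longrightarrow> \<exists>a b. X = cbox a b" "\<Union>\<D> = \<Omega>"
    then show thesis by (rule that)
  qed
  have "AE x in lebesgue. x \<in> X \<longrightarrow> f x = 0" if X: "X \<in> \<D>" for X
  proof -
    obtain a b where "X = cbox a b" "cbox a b \<subseteq> \<Omega>" using \<D>(3)[OF X] \<D>(2) X by auto
    then show ?thesis using cell[of a b] by simp
  qed
  then have "AE x in lebesgue. \<forall>X\<in>\<D>. x \<in> X \<longrightarrow> f x = 0" unfolding AE_ball_countable[OF \<D>(1)] by blast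
  then have "AE x in lebesgue. x \<in> \<Omega> \<longrightarrow> f x = 0" by eventually_elim (use \<D>(4) in auto)
  moreover have "\<Omega> \<in> sets lebesgue" using \<Omega> by auto
  ultimately show ?thesis by (simp add: AE_restrict_space_iff)
qed

section \<open>Weak gradients and Sobolev spaces\<close>

lemma lmeasurable_open_bounded:
  fixes \<Omega> :: "'a::euclidean_space set"
  shows "open \<Omega> \<Longrightarrow> bounded \<Omega> \<Longrightarrow> \<Omega> \<in> lmeasurable"
  by (simp add: bounded_set_imp_lmeasurable)

lemma sets_lebesgue_open: "open \<Omega> \<Longrightarrow> \<Omega> \<in> sets lebesgue"
  by auto

lemma locally_integrable_of_square_integrable:
  assumes "open \<Omega>" "bounded \<Omega>" "square_integrable (lebesgue_on \<Omega>) f"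
  shows "locally_integrable \<Omega> f"
proof -
  have "integrable (lebesgue_on \<Omega>) f"
    using finite_measure_lebesgue_on[OF lmeasurable_open_bounded[OF assms(1,2)]] assms(3)
    by (rule square_integrable_imp_integrable)
  then have i: "set_integrable lebesgue \<Omega> f"
    using sets_lebesgue_open[OF assms(1)] by (simp add: set_integrable_def integrable_restrict_space)
  show ?thesis
    unfolding locally_integrable_def
  proof (intro allI impI)
    fix K assume "compact K \<and> K \<subseteq> \<Omega>"
    then show "f absolutely_integrable_on K"
      by (intro set_integrable_subset[OF i] fmeasurableD lmeasurable_compact) auto
  qed
qed

lemma locally_integrable_component:
  assumes "locally_integrable \<Omega> G"
  shows "locally_integrable \<Omega> (\<lambda>x. G x \<bullet> i)"
  unfolding locally_integrable_def
proof (intro allI impI)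
  fix K assume "compact K \<and> K \<subseteq> \<Omega>"
  then have "integrable lebesgue (\<lambda>x. indicator K x *\<^sub>R G x)"
    using assms by (simp add: locally_integrable_def set_integrable_def)
  then have "integrable lebesgue (\<lambda>x. (indicator K x *\<^sub>R G x) \<bullet> i)" by (rule integrable_inner_left)
  then show "(\<lambda>x. G x \<bullet> i) absolutely_integrable_on K" by (simp add: set_integrable_def)
qed

lemma locally_integrable_diff:
  "locally_integrable \<Omega> f \<Longrightarrow> locally_integrable \<Omega> g \<Longrightarrow> locally_integrable \<Omega> (\<lambda>x. f x - g x)"
  by (simp add: locally_integrable_def set_integral_diff(1))

lemma test_function_measurable:
  assumes "\<phi> \<in> test_functions \<Omega>"
  shows "\<phi> \<in> borel_measurable (lebesgue_on S)"
    and "i \<in> Basis \<Longrightarrow> (\<lambda>x. frechet_derivative \<phi> (at x) i) \<in> borel_measurable (lebesgue_on S)"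
  by (rule borel_measurable_lebesgue_on_continuous[OF test_functionD(1)[OF assms]])
    (rule borel_measurable_lebesgue_on_continuous[OF test_functionD(3)[OF assms]])

lemma test_function_square_integrable:
  assumes "\<phi> \<in> test_functions \<Omega>'" "finite_measure (lebesgue_on \<Omega>)"
  shows "square_integrable (lebesgue_on \<Omega>) \<phi>"
    and "i \<in> Basis \<Longrightarrow> square_integrable (lebesgue_on \<Omega>) (\<lambda>x. frechet_derivative \<phi> (at x) i)"
proof -
  obtain B where "\<And>x. norm (\<phi> x) \<le> B" using test_function_bounded[OF assms(1)] by blast
  then show "square_integrable (lebesgue_on \<Omega>) \<phi>"
    by (rule square_integrable_bounded[OF assms(2) test_function_measurable(1)[OF assms(1)]])
  assume i: "i \<in> Basis"
  obtain B' where "\<And>x. norm (frechet_derivative \<phi> (at x) i) \<le> B'"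
    using test_function_derivative_bounded[OF assms(1) i] by blast
  then show "square_integrable (lebesgue_on \<Omega>) (\<lambda>x. frechet_derivative \<phi> (at x) i)"
    by (rule square_integrable_bounded[OF assms(2) test_function_measurable(2)[OF assms(1) i]])
qed

lemma weak_gradient_unique:
  assumes \<Omega>: "open \<Omega>" and G: "has_weak_gradient \<Omega> u G" and H: "has_weak_gradient \<Omega> u H"
  shows "AE x in lebesgue_on \<Omega>. G x = H x"
proof -
  have "AE x in lebesgue_on \<Omega>. G x \<bullet> i - H x \<bullet> i = 0" if i: "i \<in> Basis" for i
  proof (rule fundamental_lemma_calculus_of_variations[OF \<Omega>])
    have li: "locally_integrable \<Omega> (\<lambda>x. G x \<bullet> i)" "locally_integrable \<Omega> (\<lambda>x. H x \<bullet> i)"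
      using G H by (auto simp: has_weak_gradient_def intro: locally_integrable_component)
    then show "locally_integrable \<Omega> (\<lambda>x. G x \<bullet> i - H x \<bullet> i)" by (rule locally_integrable_diff)
    fix \<phi> assume \<phi>: "\<phi> \<in> test_functions \<Omega>"
    note int = integrable_locally_integrable_mult(1)[OF \<Omega> _ test_functionD(1,4,5,6)[OF \<phi>]]
    have "(\<integral>x. (G x \<bullet> i) * \<phi> x \<partial>lebesgue_on \<Omega>) = (\<integral>x. (H x \<bullet> i) * \<phi> x \<partial>lebesgue_on \<Omega>)"
    proof -
      have "(\<integral>x. u x * frechet_derivative \<phi> (at x) i \<partial>lebesgue_on \<Omega>) = - (\<integral>x. (G x \<bullet> i) * \<phi> x \<partial>lebesgue_on \<Omega>)"
        using G \<phi> i unfolding has_weak_gradient_def by blast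
      moreover have "(\<integral>x. u x * frechet_derivative \<phi> (at x) i \<partial>lebesgue_on \<Omega>) = - (\<integral>x. (H x \<bullet> i) * \<phi> x \<partial>lebesgue_on \<Omega>)"
        using H \<phi> i unfolding has_weak_gradient_def by blast
      ultimately show ?thesis by simp
    qed
    then show "(\<integral>x. (G x \<bullet> i - H x \<bullet> i) * \<phi> x \<partial>lebesgue_on \<Omega>) = 0"
      using int[OF li(1)] int[OF li(2)] by (simp add: left_diff_distrib)
  qed
  then have "AE x in lebesgue_on \<Omega>. \<forall>i\<in>Basis. G x \<bullet> i - H x \<bullet> i = 0"
    by (subst AE_finite_all) auto
  then show ?thesis by eventually_elim (auto intro: euclidean_eqI)
qed

lemma weak_gradient_eq:
  assumes "open \<Omega>" "has_weak_gradient \<Omega> u G"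
  shows "AE x in lebesgue_on \<Omega>. weak_gradient \<Omega> u x = G x"
  unfolding weak_gradient_def
  using someI[of "has_weak_gradient \<Omega> u", OF assms(2)] assms(2)
  by (rule weak_gradient_unique[OF assms(1)])

lemma H1_I:
  "square_integrable (lebesgue_on \<Omega>) u \<Longrightarrow> has_weak_gradient \<Omega> u G \<Longrightarrow> square_integrable (lebesgue_on \<Omega>) G
    \<Longrightarrow> u \<in> H1 \<Omega>"
  unfolding H1_def L2_iff_square_integrable by (auto simp: square_integrable_def)

lemma square_integrable_lebesgue_on_AE:
  fixes f g :: "'a::euclidean_space \<Rightarrow> 'c::euclidean_space"
  assumes S: "S \<in> sets lebesgue" and f: "square_integrable (lebesgue_on S) f"
    and ae: "AE x in lebesgue_on S. f x = g x"
  shows "square_integrable (lebesgue_on S) g"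
  unfolding square_integrable_def
proof
  show "g \<in> borel_measurable (lebesgue_on S)"
    using borel_measurable_lebesgue_on_AE[OF S _ ae] f by (simp add: square_integrable_def)
  have "AE x in lebesgue_on S. (norm (f x))\<^sup>2 = (norm (g x))\<^sup>2" using ae by eventually_elim simp
  then show "integrable (lebesgue_on S) (\<lambda>x. (norm (g x))\<^sup>2)"
    by (rule integrable_lebesgue_on_AE[OF S square_integrableD(2)[OF f]])
qed

lemma H1_D:
  assumes \<Omega>: "open \<Omega>" and u: "u \<in> H1 \<Omega>"
  shows "square_integrable (lebesgue_on \<Omega>) u" "has_weak_gradient \<Omega> u (weak_gradient \<Omega> u)"
    "square_integrable (lebesgue_on \<Omega>) (weak_gradient \<Omega> u)"
proof -
  obtain G where G: "has_weak_gradient \<Omega> u G" "square_integrable (lebesgue_on \<Omega>) G"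
    using u by (auto simp: H1_def square_integrable_def)
  show "square_integrable (lebesgue_on \<Omega>) u" using u by (simp add: H1_def L2_iff_square_integrable)
  show "has_weak_gradient \<Omega> u (weak_gradient \<Omega> u)"
    unfolding weak_gradient_def by (rule someI[of "has_weak_gradient \<Omega> u", OF G(1)])
  have "AE x in lebesgue_on \<Omega>. G x = weak_gradient \<Omega> u x"
    using weak_gradient_eq[OF \<Omega> G(1)] by eventually_elim simp
  then show "square_integrable (lebesgue_on \<Omega>) (weak_gradient \<Omega> u)"
    by (rule square_integrable_lebesgue_on_AE[OF sets_lebesgue_open[OF \<Omega>] G(2)])
qed

text \<open>
  The gradients chosen in the definition of the Dirichlet form may be replaced by any others, by
  uniqueness.
\<close>

lemma dirichlet_form_eq:
  assumes \<Omega>: "open \<Omega>"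
    and "has_weak_gradient \<Omega> u G" "square_integrable (lebesgue_on \<Omega>) G"
    and "has_weak_gradient \<Omega> v H" "square_integrable (lebesgue_on \<Omega>) H"
  shows "dirichlet_form \<Omega> u v = (\<integral>x. G x \<bullet> H x \<partial>lebesgue_on \<Omega>)"
proof -
  have "AE x in lebesgue_on \<Omega>. G x \<bullet> H x = weak_gradient \<Omega> u x \<bullet> weak_gradient \<Omega> v x"
    using weak_gradient_eq[OF \<Omega> assms(2)] weak_gradient_eq[OF \<Omega> assms(4)] by eventually_elim simp
  then show ?thesis
    using integral_lebesgue_on_AE[OF sets_lebesgue_open[OF \<Omega>]
      borel_measurable_integrable[OF square_integrable_inner[OF assms(3,5)]]]
    by (simp add: dirichlet_form_def)
qed

lemma has_weak_gradient_lin: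
  assumes \<Omega>: "open \<Omega>" "bounded \<Omega>"
    and u: "square_integrable (lebesgue_on \<Omega>) u" "has_weak_gradient \<Omega> u G" "square_integrable (lebesgue_on \<Omega>) G"
    and v: "square_integrable (lebesgue_on \<Omega>) v" "has_weak_gradient \<Omega> v H" "square_integrable (lebesgue_on \<Omega>) H"
  shows "has_weak_gradient \<Omega> (\<lambda>x. a * u x + b * v x) (\<lambda>x. a *\<^sub>R G x + b *\<^sub>R H x)"
  unfolding has_weak_gradient_def
proof (intro conjI ballI)
  let ?M = "lebesgue_on \<Omega>"
  have fin: "finite_measure ?M" by (rule finite_measure_lebesgue_on[OF lmeasurable_open_bounded[OF \<Omega>]])
  show "locally_integrable \<Omega> (\<lambda>x. a * u x + b * v x)"
    using square_integrable_add[OF square_integrable_scaleR[OF u(1), of a] square_integrable_scaleR[OF v(1), of b]]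
    by (intro locally_integrable_of_square_integrable \<Omega>) simp
  show "locally_integrable \<Omega> (\<lambda>x. a *\<^sub>R G x + b *\<^sub>R H x)"
    by (intro locally_integrable_of_square_integrable \<Omega> square_integrable_add square_integrable_scaleR u v)
  fix \<phi> and i :: 'a assume \<phi>: "\<phi> \<in> test_functions \<Omega>" and i: "i \<in> Basis"
  note t = test_function_square_integrable[OF \<phi> fin]
  have Gi: "square_integrable ?M (\<lambda>x. G x \<bullet> i)" "square_integrable ?M (\<lambda>x. H x \<bullet> i)"
    by (rule square_integrable_linear_image[OF u(3) bounded_linear_inner_left],
        rule square_integrable_linear_image[OF v(3) bounded_linear_inner_left])
  have "(\<integral>x. (a * u x + b * v x) * frechet_derivative \<phi> (at x) i \<partial>?M)
      = a * (\<integral>x. u x * frechet_derivative \<phi> (at x) i \<partial>?M) + b * (\<integral>x. v x * frechet_derivative \<phi> (at x) i \<partial>?M)"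
    using square_integrable_mult[OF u(1) t(2)[OF i]] square_integrable_mult[OF v(1) t(2)[OF i]]
    by (simp add: distrib_right mult.assoc)
  also have "\<dots> = - (a * (\<integral>x. (G x \<bullet> i) * \<phi> x \<partial>?M) + b * (\<integral>x. (H x \<bullet> i) * \<phi> x \<partial>?M))"
    using u(2) v(2) \<phi> i by (simp add: has_weak_gradient_def)
  also have "\<dots> = - (\<integral>x. ((a *\<^sub>R G x + b *\<^sub>R H x) \<bullet> i) * \<phi> x \<partial>?M)"
    using square_integrable_mult[OF Gi(1) t(1)] square_integrable_mult[OF Gi(2) t(1)]
    by (simp add: inner_add_left distrib_right mult.assoc)
  finally show "(\<integral>x. (a * u x + b * v x) * frechet_derivative \<phi> (at x) i \<partial>?M)
      = - (\<integral>x. ((a *\<^sub>R G x + b *\<^sub>R H x) \<bullet> i) * \<phi> x \<partial>?M)" .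
qed

text \<open>Weak gradients form a closed operator: the defining identities pass to \<open>L2\<close> limits.\<close>

lemma has_weak_gradient_L2_limit:
  assumes \<Omega>: "open \<Omega>" "bounded \<Omega>"
    and u: "L2_converges (lebesgue_on \<Omega>) u v" and G: "L2_converges (lebesgue_on \<Omega>) G H"
    and wg: "\<And>n. has_weak_gradient \<Omega> (u n) (G n)"
  shows "has_weak_gradient \<Omega> v H"
  unfolding has_weak_gradient_def
proof (intro conjI ballI)
  let ?M = "lebesgue_on \<Omega>"
  have fin: "finite_measure ?M" by (rule finite_measure_lebesgue_on[OF lmeasurable_open_bounded[OF \<Omega>]])
  show "locally_integrable \<Omega> v" "locally_integrable \<Omega> H"
    using u G by (auto simp: L2_converges_def intro: locally_integrable_of_square_integrable[OF \<Omega>])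
  fix \<phi> and i :: 'a assume \<phi>: "\<phi> \<in> test_functions \<Omega>" and i: "i \<in> Basis"
  note t = test_function_square_integrable[OF \<phi> fin]
  have "L2_converges ?M (\<lambda>n x. G n x \<bullet> i) (\<lambda>x. H x \<bullet> i)"
    using L2_converges_linear_image[OF G bounded_linear_inner_left] .
  then have "(\<lambda>n. - (\<integral>x. (G n x \<bullet> i) * \<phi> x \<partial>?M)) \<longlonglongrightarrow> - (\<integral>x. (H x \<bullet> i) * \<phi> x \<partial>?M)"
    using L2_converges_inner[OF _ t(1)] by (intro tendsto_minus) (auto simp: inner_real_def)
  moreover have "(\<lambda>n. \<integral>x. u n x * frechet_derivative \<phi> (at x) i \<partial>?M)
      \<longlonglongrightarrow> (\<integral>x. v x * frechet_derivative \<phi> (at x) i \<partial>?M)"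
    using L2_converges_inner[OF u t(2)[OF i]] by (simp add: inner_real_def)
  moreover have "(\<integral>x. u n x * frechet_derivative \<phi> (at x) i \<partial>?M) = - (\<integral>x. (G n x \<bullet> i) * \<phi> x \<partial>?M)" for n
    using wg[of n] \<phi> i by (simp add: has_weak_gradient_def)
  ultimately show "(\<integral>x. v x * frechet_derivative \<phi> (at x) i \<partial>?M) = - (\<integral>x. (H x \<bullet> i) * \<phi> x \<partial>?M)"
    using LIMSEQ_unique by simp
qed

lemma H1_lin:
  assumes \<Omega>: "open \<Omega>" "bounded \<Omega>" and u: "u \<in> H1 \<Omega>" and v: "v \<in> H1 \<Omega>"
  shows "(\<lambda>x. a * u x + b * v x) \<in> H1 \<Omega>"
    and "has_weak_gradient \<Omega> (\<lambda>x. a * u x + b * v x) (\<lambda>x. a *\<^sub>R weak_gradient \<Omega> u x + b *\<^sub>R weak_gradient \<Omega> v x)"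
proof -
  note U = H1_D[OF \<Omega>(1) u] and V = H1_D[OF \<Omega>(1) v]
  show wg: "has_weak_gradient \<Omega> (\<lambda>x. a * u x + b * v x) (\<lambda>x. a *\<^sub>R weak_gradient \<Omega> u x + b *\<^sub>R weak_gradient \<Omega> v x)"
    by (rule has_weak_gradient_lin[OF \<Omega> U V])
  show "(\<lambda>x. a * u x + b * v x) \<in> H1 \<Omega>"
    using square_integrable_add[OF square_integrable_scaleR[OF U(1), of a] square_integrable_scaleR[OF V(1), of b]]
      square_integrable_add[OF square_integrable_scaleR[OF U(3), of a] square_integrable_scaleR[OF V(3), of b]]
    by (intro H1_I[OF _ wg]) auto
qed

lemma has_weak_gradient_zero: "has_weak_gradient \<Omega> (\<lambda>x. 0) (\<lambda>x. 0)"
  by (auto simp: has_weak_gradient_def locally_integrable_def set_integrable_def)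

lemma zero_in_H1: "(\<lambda>x. 0) \<in> H1 \<Omega>"
  by (rule H1_I[OF _ has_weak_gradient_zero]) auto

lemma semi_inner_space_dirichlet:
  assumes \<Omega>: "open \<Omega>" "bounded \<Omega>"
  shows "semi_inner_space (H1 \<Omega>) (dirichlet_form \<Omega>)"
proof
  show "H1 \<Omega> \<noteq> {}" using zero_in_H1 by blast
  fix u v w :: "'a \<Rightarrow> real" and a b :: real
  assume u: "u \<in> H1 \<Omega>"
  show "0 \<le> dirichlet_form \<Omega> u u"
    unfolding dirichlet_form_def by (intro Bochner_Integration.integral_nonneg) auto
  assume v: "v \<in> H1 \<Omega>"
  show "dirichlet_form \<Omega> u v = dirichlet_form \<Omega> v u" by (simp add: dirichlet_form_def inner_commute)
  show "(\<lambda>x. a * u x + b * v x) \<in> H1 \<Omega>" using H1_lin(1)[OF \<Omega> u v] .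
  assume w: "w \<in> H1 \<Omega>"
  note U = H1_D[OF \<Omega>(1) u] and V = H1_D[OF \<Omega>(1) v] and W = H1_D[OF \<Omega>(1) w]
  have "dirichlet_form \<Omega> (\<lambda>x. a * u x + b * v x) w
      = (\<integral>x. (a *\<^sub>R weak_gradient \<Omega> u x + b *\<^sub>R weak_gradient \<Omega> v x) \<bullet> weak_gradient \<Omega> w x \<partial>lebesgue_on \<Omega>)"
    by (rule dirichlet_form_eq[OF \<Omega>(1) H1_lin(2)[OF \<Omega> u v] _ W(2,3)])
      (intro square_integrable_add square_integrable_scaleR U V)
  also have "\<dots> = a * dirichlet_form \<Omega> u w + b * dirichlet_form \<Omega> v w"
    unfolding dirichlet_form_def
    using square_integrable_inner[OF U(3) W(3)] square_integrable_inner[OF V(3) W(3)]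
    by (simp add: inner_add_left)
  finally show "dirichlet_form \<Omega> (\<lambda>x. a * u x + b * v x) w = a * dirichlet_form \<Omega> u w + b * dirichlet_form \<Omega> v w" .
qed

lemma semi_inner_space_H1:
  assumes \<Omega>: "open \<Omega>" "bounded \<Omega>"
  shows "semi_inner_space (H1 \<Omega>) (H1_inner \<Omega>)"
proof -
  interpret D: semi_inner_space "H1 \<Omega>" "dirichlet_form \<Omega>" by (rule semi_inner_space_dirichlet[OF \<Omega>])
  interpret L: semi_inner_space "L2 (lebesgue_on \<Omega>)" "L2_inner (lebesgue_on \<Omega>)" by (rule semi_inner_space_L2)
  have sub: "u \<in> H1 \<Omega> \<Longrightarrow> u \<in> L2 (lebesgue_on \<Omega>)" for u by (simp add: H1_def)
  show ?thesis
  proof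
    show "H1_inner \<Omega> u v = H1_inner \<Omega> v u" if "u \<in> H1 \<Omega>" "v \<in> H1 \<Omega>" for u v
      using D.ip_sym[OF that] L.ip_sym[OF that[THEN sub]] by (simp add: H1_inner_def)
  qed (auto simp: H1_inner_def D.nonempty D.lin D.ip_lin L.ip_lin sub D.ip_nonneg L.ip_nonneg algebra_simps)
qed

section \<open>Test functions belong to the Sobolev space\<close>

text \<open>
  Translation invariance makes the integral of each difference quotient vanish; the difference
  quotients are bounded by the derivative and live in a fixed ball.
\<close>

lemma integral_derivative_test_function:
  fixes f :: "'a::euclidean_space \<Rightarrow> real"
  assumes f: "f \<in> test_functions \<Omega>" and i: "i \<in> Basis"
  shows "(\<integral>x. frechet_derivative f (at x) i \<partial>lborel) = 0"
proof -
  note fD = test_functionD[OF f]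
  obtain B where B: "\<And>x. norm (frechet_derivative f (at x) i) \<le> B"
    using test_function_derivative_bounded[OF f i] by blast
  obtain B0 where B0: "\<And>x. norm (f x) \<le> B0" using test_function_bounded[OF f] by blast
  obtain R where R: "\<And>x. x \<in> closure {x. f x \<noteq> 0} \<Longrightarrow> norm x \<le> R"
    using compact_imp_bounded[OF fD(4)] by (auto simp: bounded_iff)
  have f0: "f x = 0" if "norm x > R" for x using fD(6)[of x] R[of x] that by auto
  define h where "h n = 1 / real (Suc n)" for n
  have h: "0 < h n" "h n \<le> 1" for n by (auto simp: h_def divide_le_eq)
  define g where "g n x = (f (x + h n *\<^sub>R i) - f x) / h n" for n x
  have DERIV: "((\<lambda>t. f (x + t *\<^sub>R i)) has_real_derivative frechet_derivative f (at (x + t *\<^sub>R i)) i) (at t)" for x t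
  proof -
    have d1: "((\<lambda>t. x + t *\<^sub>R i) has_derivative (\<lambda>s. s *\<^sub>R i)) (at t)"
      by (auto intro!: derivative_eq_intros)
    have d2: "(f has_derivative frechet_derivative f (at (x + t *\<^sub>R i))) (at (x + t *\<^sub>R i))"
      using fD(2) frechet_derivative_works by blast
    have "((\<lambda>t. f (x + t *\<^sub>R i)) has_derivative (\<lambda>s. frechet_derivative f (at (x + t *\<^sub>R i)) (s *\<^sub>R i))) (at t)"
      using has_derivative_compose[OF d1 d2] .
    moreover have "(\<lambda>s. frechet_derivative f (at (x + t *\<^sub>R i)) (s *\<^sub>R i))
        = (\<lambda>s. frechet_derivative f (at (x + t *\<^sub>R i)) i * s)"
      using linear_scale[OF linear_frechet_derivative[OF fD(2)]] by (auto simp: mult.commute)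
    ultimately show ?thesis by (simp only: has_field_derivative_def)
  qed
  have g_lim: "(\<lambda>n. g n x) \<longlonglongrightarrow> frechet_derivative f (at x) i" for x
  proof -
    have "((\<lambda>t. (f (x + t *\<^sub>R i) - f x) / t) \<longlongrightarrow> frechet_derivative f (at x) i) (at 0)"
      using DERIV[of x 0] by (simp add: DERIV_def)
    moreover have "h \<longlonglongrightarrow> 0" unfolding h_def[abs_def] by (rule LIMSEQ_Suc[OF lim_1_over_n])
    then have "filterlim h (at 0) sequentially"
      using h(1) by (auto simp: filterlim_at intro!: always_eventually less_imp_neq[symmetric])
    ultimately show ?thesis unfolding g_def by (rule filterlim_compose)
  qed
  have g_bound: "norm (g n x) \<le> B * indicator (cball 0 (R + 1)) x" for n x
  proof (cases "norm x \<le> R + 1")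
    case True
    obtain z where "f (x + h n *\<^sub>R i) - f (x + 0 *\<^sub>R i) = (h n - 0) * frechet_derivative f (at (x + z *\<^sub>R i)) i"
      using MVT2[OF h(1)[of n], of "\<lambda>t. f (x + t *\<^sub>R i)" "\<lambda>t. frechet_derivative f (at (x + t *\<^sub>R i)) i"] DERIV by blast
    then have "g n x = frechet_derivative f (at (x + z *\<^sub>R i)) i" using h(1)[of n] by (simp add: g_def)
    then show ?thesis using B[of "x + z *\<^sub>R i"] True by (simp add: indicator_def)
  next
    case False
    have "norm x \<le> norm (x + h n *\<^sub>R i) + norm (h n *\<^sub>R i)"
      using norm_triangle_ineq4[of "x + h n *\<^sub>R i" "h n *\<^sub>R i"] by simp
    then have "norm (x + h n *\<^sub>R i) > R" using False h[of n] i by simp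
    then show ?thesis using f0[of x] f0[of "x + h n *\<^sub>R i"] False by (simp add: g_def)
  qed
  have f_meas: "f \<in> borel_measurable borel" using fD(1) by (rule borel_measurable_continuous_onI)
  have f_int: "integrable lborel f"
  proof (rule Bochner_Integration.integrable_bound)
    show "integrable lborel (\<lambda>x :: 'a. B0 * indicator (cball 0 R) x :: real)"
      using emeasure_lborel_cball_finite[of "0 :: 'a" R] by (intro integrable_mult_right integrable_real_indicator) auto
    have "norm (f x) \<le> norm (B0 * indicator (cball 0 R) x :: real)" for x
      using B0[of x] f0[of x] by (cases "norm x \<le> R") auto
    then show "AE x in lborel. norm (f x) \<le> norm (B0 * indicator (cball 0 R) x :: real)" by simp
  qed (use f_meas in simp)
  have shift: "integrable lborel (\<lambda>x. f (x + c))" "(\<integral>x. f (x + c) \<partial>lborel) = (\<integral>x. f x \<partial>lborel)" for c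
  proof -
    have "integrable (distr lborel borel ((+) c)) f" using f_int by (simp only: lborel_distr_plus)
    then show "integrable lborel (\<lambda>x. f (x + c))"
      using f_meas by (subst (asm) integrable_distr_eq) (auto simp: add.commute)
    have "(\<integral>x. f x \<partial>lborel) = integral\<^sup>L (distr lborel borel ((+) c)) f" by (simp only: lborel_distr_plus)
    also have "\<dots> = (\<integral>x. f (x + c) \<partial>lborel)" using f_meas by (subst integral_distr) (auto simp: add.commute)
    finally show "(\<integral>x. f (x + c) \<partial>lborel) = (\<integral>x. f x \<partial>lborel)" by simp
  qed
  have "(\<lambda>n. \<integral>x. g n x \<partial>lborel) \<longlonglongrightarrow> (\<integral>x. frechet_derivative f (at x) i \<partial>lborel)"
  proof (rule integral_dominated_convergence)
    show "(\<lambda>x. frechet_derivative f (at x) i) \<in> borel_measurable lborel"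
      using borel_measurable_continuous_onI[OF fD(3)[OF i]] by simp
    show "g n \<in> borel_measurable lborel" for n
      using f_int shift(1)[of "h n *\<^sub>R i"] unfolding g_def by auto
    show "integrable lborel (\<lambda>x :: 'a. B * indicator (cball 0 (R + 1)) x :: real)"
      using emeasure_lborel_cball_finite[of "0 :: 'a" "R + 1"] by (intro integrable_mult_right integrable_real_indicator) auto
  qed (use g_lim g_bound in auto)
  moreover have "(\<integral>x. g n x \<partial>lborel) = 0" for n
    unfolding g_def using f_int shift[of "h n *\<^sub>R i"] by simp
  ultimately show ?thesis by (simp add: LIMSEQ_const_iff)
qed

lemma test_function_mult:
  assumes \<phi>: "\<phi> \<in> test_functions \<Omega>" and \<psi>: "\<psi> \<in> test_functions \<Omega>"
  shows "(\<lambda>x. \<phi> x * \<psi> x) \<in> test_functions \<Omega>"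
proof -
  have sub: "closure {x. \<phi> x * \<psi> x \<noteq> 0} \<subseteq> closure {x. \<phi> x \<noteq> 0}" by (intro closure_mono) auto
  have "compact (closure {x. \<phi> x * \<psi> x \<noteq> 0})"
    using compact_Int_closed[OF test_functionD(4)[OF \<phi>] closed_closure[of "{x. \<phi> x * \<psi> x \<noteq> 0}"]] sub
    by (simp add: Int_absorb1)
  then show ?thesis
    using \<phi> \<psi> sub by (auto simp: test_functions_def intro: C_k_mult)
qed

text \<open>
  Integration by parts: the derivative of the product of two test functions integrates to zero.
\<close>

lemma has_weak_gradient_test_function:
  assumes \<Omega>: "open \<Omega>" "bounded \<Omega>" and \<phi>: "\<phi> \<in> test_functions \<Omega>"
  shows "has_weak_gradient \<Omega> \<phi> (\<lambda>x. \<Sum>i\<in>Basis. frechet_derivative \<phi> (at x) i *\<^sub>R i)"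
    and "square_integrable (lebesgue_on \<Omega>) (\<lambda>x. \<Sum>i\<in>Basis. frechet_derivative \<phi> (at x) i *\<^sub>R i)"
proof -
  let ?M = "lebesgue_on \<Omega>" and ?G = "\<lambda>x. \<Sum>i\<in>Basis. frechet_derivative \<phi> (at x) i *\<^sub>R i"
  have fin: "finite_measure ?M" by (rule finite_measure_lebesgue_on[OF lmeasurable_open_bounded[OF \<Omega>]])
  note t = test_function_square_integrable[OF \<phi> fin]
  show G: "square_integrable ?M ?G"
  proof (rule square_integrable_sum)
    fix i :: 'a assume i: "i \<in> Basis"
    show "square_integrable ?M (\<lambda>x. frechet_derivative \<phi> (at x) i *\<^sub>R i)"
      by (rule square_integrable_linear_image[OF t(2)[OF i] bounded_linear_scaleR_left])
  qed
  show "has_weak_gradient \<Omega> \<phi> ?G"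
    unfolding has_weak_gradient_def
  proof (intro conjI ballI)
    show "locally_integrable \<Omega> \<phi>" "locally_integrable \<Omega> ?G"
      using t(1) G by (auto intro: locally_integrable_of_square_integrable[OF \<Omega>])
    fix \<psi> and i :: 'a assume \<psi>: "\<psi> \<in> test_functions \<Omega>" and i: "i \<in> Basis"
    note s = test_function_square_integrable[OF \<psi> fin]
    have Gi: "?G x \<bullet> i = frechet_derivative \<phi> (at x) i" for x
      using i by (simp add: inner_sum_left inner_Basis if_distrib cong: if_cong)
    have prod_deriv: "frechet_derivative (\<lambda>x. \<phi> x * \<psi> x) (at x) i
        = \<phi> x * frechet_derivative \<psi> (at x) i + frechet_derivative \<phi> (at x) i * \<psi> x" for x
    proof -
      have "((\<lambda>x. \<phi> x * \<psi> x) has_derivative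
          (\<lambda>i. \<phi> x * frechet_derivative \<psi> (at x) i + frechet_derivative \<phi> (at x) i * \<psi> x)) (at x)"
        using test_functionD(2)[OF \<phi>, of x] test_functionD(2)[OF \<psi>, of x]
        unfolding frechet_derivative_works by (rule has_derivative_mult)
      then show ?thesis by (simp add: frechet_derivative_eqI)
    qed
    have prod: "(\<lambda>x. \<phi> x * \<psi> x) \<in> test_functions \<Omega>" by (rule test_function_mult[OF \<phi> \<psi>])
    have "(\<integral>x. \<phi> x * frechet_derivative \<psi> (at x) i \<partial>?M) + (\<integral>x. frechet_derivative \<phi> (at x) i * \<psi> x \<partial>?M)
        = (\<integral>x. frechet_derivative (\<lambda>x. \<phi> x * \<psi> x) (at x) i \<partial>?M)"
      using square_integrable_mult[OF t(1) s(2)[OF i]] square_integrable_mult[OF t(2)[OF i] s(1)]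
      by (simp add: prod_deriv)
    also have "\<dots> = (\<integral>x. frechet_derivative (\<lambda>x. \<phi> x * \<psi> x) (at x) i \<partial>lebesgue)"
    proof -
      have ind: "indicator \<Omega> x *\<^sub>R frechet_derivative (\<lambda>x. \<phi> x * \<psi> x) (at x) i
          = frechet_derivative (\<lambda>x. \<phi> x * \<psi> x) (at x) i" for x
      proof (cases "x \<in> \<Omega>")
        case False
        then have "x \<notin> closure {x. \<phi> x * \<psi> x \<noteq> 0}" using test_functionD(5)[OF prod] by (rule contra_subsetD[rotated])
        then have "frechet_derivative (\<lambda>x. \<phi> x * \<psi> x) (at x) = (\<lambda>i. 0)" by (rule test_functionD(7)[OF prod])
        then show ?thesis by simp
      qed simp
      have "\<Omega> \<inter> space lebesgue \<in> sets lebesgue" using sets_lebesgue_open[OF \<Omega>(1)] by simp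
      then show ?thesis by (simp only: integral_restrict_space ind)
    qed
    also have "\<dots> = (\<integral>x. frechet_derivative (\<lambda>x. \<phi> x * \<psi> x) (at x) i \<partial>lborel)"
      using borel_measurable_continuous_onI[OF test_functionD(3)[OF prod i]] by (intro integral_completion) simp
    also have "\<dots> = 0" by (rule integral_derivative_test_function[OF prod i])
    finally show "(\<integral>x. \<phi> x * frechet_derivative \<psi> (at x) i \<partial>?M) = - (\<integral>x. (?G x \<bullet> i) * \<psi> x \<partial>?M)"
      unfolding Gi by simp
  qed
qed

lemma test_function_in_H1:
  assumes "open \<Omega>" "bounded \<Omega>" "\<phi> \<in> test_functions \<Omega>"
  shows "\<phi> \<in> H1 \<Omega>"
  using has_weak_gradient_test_function[OF assms]
    test_function_square_integrable(1)[OF assms(3) finite_measure_lebesgue_on[OF lmeasurable_open_bounded[OF assms(1,2)]]]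
  by (intro H1_I)

lemma test_function_lin:
  assumes \<phi>: "\<phi> \<in> test_functions \<Omega>" and \<psi>: "\<psi> \<in> test_functions \<Omega>"
  shows "(\<lambda>x. a * \<phi> x + b * \<psi> x) \<in> test_functions \<Omega>"
proof -
  let ?K = "closure {x. \<phi> x \<noteq> 0} \<union> closure {x. \<psi> x \<noteq> 0}"
  have "{x. a * \<phi> x + b * \<psi> x \<noteq> 0} \<subseteq> {x. \<phi> x \<noteq> 0} \<union> {x. \<psi> x \<noteq> 0}" by auto
  then have sub: "closure {x. a * \<phi> x + b * \<psi> x \<noteq> 0} \<subseteq> ?K"
    unfolding closure_Un[symmetric] by (rule closure_mono)
  have K: "compact ?K" using test_functionD(4)[OF \<phi>] test_functionD(4)[OF \<psi>] by (rule compact_Un)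
  have "compact (closure {x. a * \<phi> x + b * \<psi> x \<noteq> 0})"
    using compact_Int_closed[OF K closed_closure[of "{x. a * \<phi> x + b * \<psi> x \<noteq> 0}"]] sub by (simp add: Int_absorb1)
  moreover have "\<forall>k. C_k k (\<lambda>x. a * \<phi> x + b * \<psi> x)"
    using \<phi> \<psi> by (auto simp: test_functions_def intro!: C_k_add C_k_mult C_k_const)
  moreover have "?K \<subseteq> \<Omega>" using test_functionD(5)[OF \<phi>] test_functionD(5)[OF \<psi>] by simp
  ultimately show ?thesis using sub by (auto simp: test_functions_def)
qed

text \<open>
  The approximating test functions combine linearly. That test functions lie in \<open>H1\<close> is essential here:
  the \<open>H1\<close> norm of the differences \<open>u - \<phi>\<^sub>n\<close> obeys the usual rules only within \<open>H1\<close>.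
\<close>

lemma H10_lin:
  assumes \<Omega>: "open \<Omega>" "bounded \<Omega>" and u: "u \<in> H10 \<Omega>" and v: "v \<in> H10 \<Omega>"
  shows "(\<lambda>x. a * u x + b * v x) \<in> H10 \<Omega>"
proof -
  interpret semi_inner_space "H1 \<Omega>" "H1_inner \<Omega>" by (rule semi_inner_space_H1[OF \<Omega>])
  obtain \<phi> where \<phi>: "\<And>n. \<phi> n \<in> test_functions \<Omega>" "(\<lambda>n. H1_norm \<Omega> (\<lambda>x. u x - \<phi> n x)) \<longlonglongrightarrow> 0"
    using u by (auto simp: H10_def)
  obtain \<psi> where \<psi>: "\<And>n. \<psi> n \<in> test_functions \<Omega>" "(\<lambda>n. H1_norm \<Omega> (\<lambda>x. v x - \<psi> n x)) \<longlonglongrightarrow> 0"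
    using v by (auto simp: H10_def)
  have uv: "u \<in> H1 \<Omega>" "v \<in> H1 \<Omega>" using u v by (auto simp: H10_def)
  define p where "p n = (\<lambda>x. u x - \<phi> n x)" for n
  define q where "q n = (\<lambda>x. v x - \<psi> n x)" for n
  define \<xi> where "\<xi> n = (\<lambda>x. a * \<phi> n x + b * \<psi> n x)" for n
  have pq: "p n \<in> H1 \<Omega>" "q n \<in> H1 \<Omega>" for n
    unfolding p_def q_def by (intro diff_mem uv test_function_in_H1[OF \<Omega>] \<phi> \<psi>)+
  have sq: "(\<lambda>n. H1_inner \<Omega> (p n) (p n)) \<longlonglongrightarrow> 0" "(\<lambda>n. H1_inner \<Omega> (q n) (q n)) \<longlonglongrightarrow> 0"
    using tendsto_power[OF \<phi>(2), of 2] tendsto_power[OF \<psi>(2), of 2] ip_nonneg pq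
    by (simp_all add: H1_norm_def p_def[symmetric] q_def[symmetric])
  have eq: "(\<lambda>x. a * u x + b * v x - \<xi> n x) = (\<lambda>x. a * p n x + b * q n x)" for n
    by (auto simp: \<xi>_def p_def q_def algebra_simps)
  have bound: "H1_inner \<Omega> (\<lambda>x. a * p n x + b * q n x) (\<lambda>x. a * p n x + b * q n x)
      \<le> 2 * (a\<^sup>2 * H1_inner \<Omega> (p n) (p n)) + 2 * (b\<^sup>2 * H1_inner \<Omega> (q n) (q n))" for n
    using ip_add_le[OF scale_mem[OF pq(1)[of n], of a] scale_mem[OF pq(2)[of n], of b]]
    by (simp add: ip_scale2 pq)
  have "(\<lambda>n. 2 * (a\<^sup>2 * H1_inner \<Omega> (p n) (p n)) + 2 * (b\<^sup>2 * H1_inner \<Omega> (q n) (q n))) \<longlonglongrightarrow> 2 * (a\<^sup>2 * 0) + 2 * (b\<^sup>2 * 0)"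
    by (intro tendsto_intros sq)
  then have "(\<lambda>n. 2 * (a\<^sup>2 * H1_inner \<Omega> (p n) (p n)) + 2 * (b\<^sup>2 * H1_inner \<Omega> (q n) (q n))) \<longlonglongrightarrow> 0" by simp
  then have "(\<lambda>n. H1_inner \<Omega> (\<lambda>x. a * p n x + b * q n x) (\<lambda>x. a * p n x + b * q n x)) \<longlonglongrightarrow> 0"
    by (rule tendsto_sandwich[OF _ _ tendsto_const, rotated 2])
      (use bound ip_nonneg lin pq in auto)
  then have "(\<lambda>n. sqrt (H1_inner \<Omega> (\<lambda>x. a * p n x + b * q n x) (\<lambda>x. a * p n x + b * q n x))) \<longlonglongrightarrow> sqrt 0"
    by (rule tendsto_real_sqrt)
  then have "(\<lambda>n. H1_norm \<Omega> (\<lambda>x. a * u x + b * v x - \<xi> n x)) \<longlonglongrightarrow> 0"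
    unfolding eq H1_norm_def by simp
  moreover have "\<xi> n \<in> test_functions \<Omega>" for n
    unfolding \<xi>_def by (rule test_function_lin[OF \<phi>(1) \<psi>(1)])
  ultimately show ?thesis using lin[OF uv] unfolding H10_def by blast
qed

lemma H10_subset_H1: "H10 \<Omega> \<subseteq> H1 \<Omega>"
  by (auto simp: H10_def)

lemma semi_inner_space_H10:
  assumes \<Omega>: "open \<Omega>" "bounded \<Omega>" and "H10 \<Omega> \<noteq> {}"
  shows "semi_inner_space (H10 \<Omega>) (dirichlet_form \<Omega>)"
proof -
  interpret D: semi_inner_space "H1 \<Omega>" "dirichlet_form \<Omega>" by (rule semi_inner_space_dirichlet[OF \<Omega>])
  show ?thesis
    using H10_subset_H1[of \<Omega>] assms(3)
    by unfold_locales (auto simp: subset_iff D.ip_lin D.ip_nonneg H10_lin[OF \<Omega>] intro: D.ip_sym)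
qed

section \<open>Tensor products on a product domain\<close>

text \<open>
  Slices are compositions with an affine map whose linear part maps basis vectors to basis vectors, so
  that partial derivatives of slices are slices of partial derivatives.
\<close>

lemma
  fixes \<phi> :: "'b::euclidean_space \<Rightarrow> real" and T :: "'a::euclidean_space \<Rightarrow> 'b"
  assumes T: "bounded_linear T" "T ` Basis \<subseteq> Basis"
  shows frechet_derivative_compose_affine: "\<phi> differentiable (at (T x + c)) \<Longrightarrow>
      ((\<lambda>x. \<phi> (T x + c)) has_derivative (\<lambda>k. frechet_derivative \<phi> (at (T x + c)) (T k))) (at x)"
    and C_k_compose_affine: "C_k n \<phi> \<Longrightarrow> C_k n (\<lambda>x. \<phi> (T x + c))"
proof -
  have deriv: "((\<lambda>x. \<psi> (T x + c)) has_derivative (\<lambda>k. frechet_derivative \<psi> (at (T x + c)) (T k))) (at x)"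
    if "\<psi> differentiable (at (T x + c))" for \<psi> :: "'b \<Rightarrow> real" and x
  proof -
    have "((\<lambda>x. T x + c) has_derivative T) (at x)"
      using bounded_linear_imp_has_derivative[OF T(1)] by (auto intro!: derivative_eq_intros)
    moreover have "(\<psi> has_derivative frechet_derivative \<psi> (at (T x + c))) (at (T x + c))"
      using that by (simp only: frechet_derivative_works)
    ultimately show ?thesis by (rule has_derivative_compose)
  qed
  then show "\<phi> differentiable (at (T x + c)) \<Longrightarrow>
      ((\<lambda>x. \<phi> (T x + c)) has_derivative (\<lambda>k. frechet_derivative \<phi> (at (T x + c)) (T k))) (at x)" .
  show "C_k n \<phi> \<Longrightarrow> C_k n (\<lambda>x. \<phi> (T x + c))"
  proof (induction n arbitrary: \<phi>)
    case 0
    have c1: "continuous_on UNIV \<phi>" using 0 by simp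
    have c2: "continuous_on UNIV (\<lambda>x. T x + c)"
      by (intro continuous_on_add linear_continuous_on[OF T(1)] continuous_on_const)
    have "continuous_on UNIV (\<lambda>x. \<phi> (T x + c))" by (rule continuous_on_compose2[OF c1 c2]) simp
    then show ?case by simp
  next
    case (Suc n)
    note d = deriv[OF C_k_differentiable[OF Suc.prems]]
    have "C_k n (\<lambda>x. frechet_derivative \<phi> (at (T x + c)) (T k))" if "k \<in> Basis" for k
      using Suc.prems T(2) that by (intro Suc.IH[of "\<lambda>z. frechet_derivative \<phi> (at z) (T k)"]) auto
    then show ?case
      using d by (auto simp: frechet_derivative_eqI[OF d] differentiable_on_def differentiable_def)
  qed
qed

lemma test_function_compose_affine:
  fixes \<phi> :: "'b::euclidean_space \<Rightarrow> real" and T :: "'a::euclidean_space \<Rightarrow> 'b"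
  assumes \<phi>: "\<phi> \<in> test_functions \<Omega>" and T: "bounded_linear T" "T ` Basis \<subseteq> Basis"
    and P: "continuous_on UNIV P" "\<And>x. P (T x + c) = x" "P ` \<Omega> \<subseteq> \<Omega>'"
  shows "(\<lambda>x. \<phi> (T x + c)) \<in> test_functions \<Omega>'"
proof -
  let ?K = "closure {z. \<phi> z \<noteq> 0}" and ?S = "{x. \<phi> (T x + c) \<noteq> 0}"
  have K: "compact (P ` ?K)"
    using test_functionD(4)[OF \<phi>] continuous_on_subset[OF P(1)] by (intro compact_continuous_image) auto
  have "?S \<subseteq> P ` ?K"
  proof
    fix x assume "x \<in> ?S"
    then have "T x + c \<in> ?K" using closure_subset[of "{z. \<phi> z \<noteq> 0}"] by auto
    then show "x \<in> P ` ?K" using P(2)[of x] by (metis imageI)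
  qed
  then have cl: "closure ?S \<subseteq> P ` ?K" using K by (intro closure_minimal compact_imp_closed)
  have "compact (closure ?S)"
    using compact_Int_closed[OF K closed_closure[of ?S]] cl by (simp add: Int_absorb1)
  moreover have "closure ?S \<subseteq> \<Omega>'" using cl P(3) test_functionD(5)[OF \<phi>] by (meson image_mono order_trans)
  moreover have "\<forall>k. C_k k (\<lambda>x. \<phi> (T x + c))"
    using \<phi> by (auto simp: test_functions_def intro: C_k_compose_affine[OF T])
  ultimately show ?thesis by (simp add: test_functions_def)
qed

lemma test_function_slice_fst:
  fixes \<phi> :: "'a::euclidean_space \<times> 'b::euclidean_space \<Rightarrow> real"
  assumes \<phi>: "\<phi> \<in> test_functions (\<Omega>1 \<times> \<Omega>2)"
  shows "(\<lambda>x. \<phi> (x, y)) \<in> test_functions \<Omega>1"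
    and "frechet_derivative (\<lambda>x. \<phi> (x, y)) (at x) k = frechet_derivative \<phi> (at (x, y)) (k, 0)"
proof -
  have T: "bounded_linear (\<lambda>x :: 'a. (x, 0 :: 'b))" "(\<lambda>x :: 'a. (x, 0 :: 'b)) ` Basis \<subseteq> Basis"
    by (auto intro: bounded_linear_Pair bounded_linear_ident bounded_linear_zero simp: Basis_prod_def)
  have "(\<lambda>x. \<phi> ((x, 0) + (0, y))) \<in> test_functions \<Omega>1"
    by (rule test_function_compose_affine[OF \<phi> T continuous_on_fst[OF continuous_on_id]]) auto
  then show "(\<lambda>x. \<phi> (x, y)) \<in> test_functions \<Omega>1" by simp
  have d: "((\<lambda>x. \<phi> ((x, 0) + (0, y))) has_derivative (\<lambda>k. frechet_derivative \<phi> (at ((x, 0) + (0, y))) (k, 0))) (at x)"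
    by (rule frechet_derivative_compose_affine[OF T test_functionD(2)[OF \<phi>]])
  show "frechet_derivative (\<lambda>x. \<phi> (x, y)) (at x) k = frechet_derivative \<phi> (at (x, y)) (k, 0)"
    using frechet_derivative_eqI[OF d] by simp
qed

lemma test_function_slice_snd:
  fixes \<phi> :: "'a::euclidean_space \<times> 'b::euclidean_space \<Rightarrow> real"
  assumes \<phi>: "\<phi> \<in> test_functions (\<Omega>1 \<times> \<Omega>2)"
  shows "(\<lambda>y. \<phi> (x, y)) \<in> test_functions \<Omega>2"
    and "frechet_derivative (\<lambda>y. \<phi> (x, y)) (at y) k = frechet_derivative \<phi> (at (x, y)) (0, k)"
proof -
  have T: "bounded_linear (\<lambda>y :: 'b. (0 :: 'a, y))" "(\<lambda>y :: 'b. (0 :: 'a, y)) ` Basis \<subseteq> Basis"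
    by (auto intro: bounded_linear_Pair bounded_linear_ident bounded_linear_zero simp: Basis_prod_def)
  have "(\<lambda>y. \<phi> ((0, y) + (x, 0))) \<in> test_functions \<Omega>2"
    by (rule test_function_compose_affine[OF \<phi> T continuous_on_snd[OF continuous_on_id]]) auto
  then show "(\<lambda>y. \<phi> (x, y)) \<in> test_functions \<Omega>2" by simp
  have d: "((\<lambda>y. \<phi> ((0, y) + (x, 0))) has_derivative (\<lambda>k. frechet_derivative \<phi> (at ((0, y) + (x, 0))) (0, k))) (at y)"
    by (rule frechet_derivative_compose_affine[OF T test_functionD(2)[OF \<phi>]])
  show "frechet_derivative (\<lambda>y. \<phi> (x, y)) (at y) k = frechet_derivative \<phi> (at (x, y)) (0, k)"
    using frechet_derivative_eqI[OF d] by simp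
qed

lemma square_integrable_Pair:
  assumes "square_integrable M f" "square_integrable M g"
  shows "square_integrable M (\<lambda>x. (f x, g x))"
proof -
  have "square_integrable M (\<lambda>x. (f x, 0) + (0, g x))"
    by (intro square_integrable_add square_integrable_linear_image[OF assms(1)] square_integrable_linear_image[OF assms(2)]
        bounded_linear_Pair bounded_linear_ident bounded_linear_zero)
  then show ?thesis by simp
qed

lemma integral_norm_Pair:
  assumes "square_integrable M f" "square_integrable M g"
  shows "(\<integral>x. (norm (f x, g x))\<^sup>2 \<partial>M) = (\<integral>x. (norm (f x))\<^sup>2 \<partial>M) + (\<integral>x. (norm (g x))\<^sup>2 \<partial>M)"
  using square_integrableD(2)[OF assms(1)] square_integrableD(2)[OF assms(2)]
  by (simp add: norm_Pair)

lemma L2_converges_Pair: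
  assumes f: "L2_converges M f f'" and g: "L2_converges M g g'"
  shows "L2_converges M (\<lambda>n x. (f n x, g n x)) (\<lambda>x. (f' x, g' x))"
proof -
  have si: "square_integrable M (f n)" "square_integrable M f'" "square_integrable M (g n)" "square_integrable M g'" for n
    using f g by (auto simp: L2_converges_def)
  have "(\<integral>x. (norm ((f n x, g n x) - (f' x, g' x)))\<^sup>2 \<partial>M)
      = (\<integral>x. (norm (f n x - f' x))\<^sup>2 \<partial>M) + (\<integral>x. (norm (g n x - g' x))\<^sup>2 \<partial>M)" for n
    using integral_norm_Pair[OF square_integrable_diff[OF si(1,2)] square_integrable_diff[OF si(3,4)]] by simp
  then show ?thesis
    using f g si tendsto_add[of "\<lambda>n. \<integral>x. (norm (f n x - f' x))\<^sup>2 \<partial>M" 0 sequentially "\<lambda>n. \<integral>x. (norm (g n x - g' x))\<^sup>2 \<partial>M" 0]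
    by (auto simp: L2_converges_def intro: square_integrable_Pair)
qed

lemma integral_norm_sum_square:
  fixes T :: "'i \<Rightarrow> 'x \<Rightarrow> 'c::euclidean_space"
  assumes si: "\<And>i. i \<in> I \<Longrightarrow> square_integrable M (T i)"
  shows "(\<integral>x. (norm (\<Sum>i\<in>I. c i *\<^sub>R T i x))\<^sup>2 \<partial>M)
    = (\<Sum>i\<in>I. \<Sum>i'\<in>I. c i * c i' * (\<integral>x. T i x \<bullet> T i' x \<partial>M))"
proof -
  have int: "integrable M (\<lambda>x. c i * c i' * (T i x \<bullet> T i' x))" if "i \<in> I" "i' \<in> I" for i i'
    using square_integrable_inner[OF si si] that by simp
  have "(\<integral>x. (norm (\<Sum>i\<in>I. c i *\<^sub>R T i x))\<^sup>2 \<partial>M) = (\<integral>x. (\<Sum>i\<in>I. \<Sum>i'\<in>I. c i * c i' * (T i x \<bullet> T i' x)) \<partial>M)"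
    by (simp only: power2_norm_eq_inner inner_sum_left)
      (simp add: inner_sum_right sum_distrib_left ac_simps)
  also have "\<dots> = (\<Sum>i\<in>I. \<integral>x. (\<Sum>i'\<in>I. c i * c i' * (T i x \<bullet> T i' x)) \<partial>M)"
    using int by (intro Bochner_Integration.integral_sum Bochner_Integration.integrable_sum)
  also have "\<dots> = (\<Sum>i\<in>I. \<Sum>i'\<in>I. \<integral>x. c i * c i' * (T i x \<bullet> T i' x) \<partial>M)"
    using int by (intro sum.cong refl Bochner_Integration.integral_sum)
  finally show ?thesis by simp
qed

locale product_domain =
  fixes \<Omega>1 :: "'a::euclidean_space set" and \<Omega>2 :: "'b::euclidean_space set"
  assumes open1: "open \<Omega>1" and bounded1: "bounded \<Omega>1" and open2: "open \<Omega>2" and bounded2: "bounded \<Omega>2"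
begin

abbreviation "\<mu>1 \<equiv> lebesgue_on \<Omega>1"
abbreviation "\<mu>2 \<equiv> lebesgue_on \<Omega>2"
abbreviation "\<mu> \<equiv> lebesgue_on (\<Omega>1 \<times> \<Omega>2)"

lemma open_product: "open (\<Omega>1 \<times> \<Omega>2)" and bounded_product: "bounded (\<Omega>1 \<times> \<Omega>2)"
  using open1 open2 bounded1 bounded2 by (auto intro: open_Times bounded_Times)

lemma sets1: "\<Omega>1 \<in> sets lebesgue" and sets2: "\<Omega>2 \<in> sets lebesgue" and sets_product: "\<Omega>1 \<times> \<Omega>2 \<in> sets lebesgue"
  using open1 open2 open_product by (auto intro: sets_lebesgue_open)

lemma finite_product: "finite_measure \<mu>"
  by (rule finite_measure_lebesgue_on[OF lmeasurable_open_bounded[OF open_product bounded_product]])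

lemma integrable_tensor:
  fixes f :: "'a \<Rightarrow> real" and g :: "'b \<Rightarrow> real"
  assumes "integrable \<mu>1 f" "integrable \<mu>2 g"
  shows "integrable \<mu> (\<lambda>z. f (fst z) * g (snd z))"
    and "(\<integral>z. f (fst z) * g (snd z) \<partial>\<mu>) = integral\<^sup>L \<mu>1 f * integral\<^sup>L \<mu>2 g"
  using integrable_lebesgue_on_tensor[OF sets1 sets2 assms] by (simp_all add: case_prod_beta')

lemma compose_fst_measurable: "f \<in> borel_measurable \<mu>1 \<Longrightarrow> (\<lambda>z. f (fst z)) \<in> borel_measurable \<mu>"
  and compose_snd_measurable: "g \<in> borel_measurable \<mu>2 \<Longrightarrow> (\<lambda>z. g (snd z)) \<in> borel_measurable \<mu>"
  by (rule measurable_compose[OF measurable_fst_lebesgue_on], assumption)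
    (rule measurable_compose[OF measurable_snd_lebesgue_on], assumption)

lemma square_integrable_tensor:
  fixes A :: "'a \<Rightarrow> 'c::euclidean_space" and g :: "'b \<Rightarrow> real"
  assumes A: "square_integrable \<mu>1 A" and g: "square_integrable \<mu>2 g"
  shows "square_integrable \<mu> (\<lambda>z. g (snd z) *\<^sub>R A (fst z))"
  unfolding square_integrable_def
proof
  show "(\<lambda>z. g (snd z) *\<^sub>R A (fst z)) \<in> borel_measurable \<mu>"
    by (intro borel_measurable_scaleR compose_fst_measurable compose_snd_measurable square_integrableD(1) A g)
  show "integrable \<mu> (\<lambda>z. (norm (g (snd z) *\<^sub>R A (fst z)))\<^sup>2)"
    using integrable_tensor(1)[OF square_integrableD(2)[OF A] square_integrableD(2)[OF g]]
    by (simp add: power_mult_distrib mult.commute)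
qed

lemma square_integrable_tensor':
  fixes B :: "'b \<Rightarrow> 'c::euclidean_space" and f :: "'a \<Rightarrow> real"
  assumes f: "square_integrable \<mu>1 f" and B: "square_integrable \<mu>2 B"
  shows "square_integrable \<mu> (\<lambda>z. f (fst z) *\<^sub>R B (snd z))"
  unfolding square_integrable_def
proof
  show "(\<lambda>z. f (fst z) *\<^sub>R B (snd z)) \<in> borel_measurable \<mu>"
    by (intro borel_measurable_scaleR compose_fst_measurable compose_snd_measurable square_integrableD(1) B f)
  show "integrable \<mu> (\<lambda>z. (norm (f (fst z) *\<^sub>R B (snd z)))\<^sup>2)"
    using integrable_tensor(1)[OF square_integrableD(2)[OF f] square_integrableD(2)[OF B]]
    by (simp add: power_mult_distrib)
qed

lemma square_integrable_tensor_fun: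
  "square_integrable \<mu>1 u \<Longrightarrow> square_integrable \<mu>2 v \<Longrightarrow> square_integrable \<mu> (tensor_fun u v)"
  using square_integrable_tensor'[of u v] by (simp add: tensor_fun_def case_prod_beta')

lemma integral_inner_tensor:
  fixes A A' :: "'a \<Rightarrow> 'c::euclidean_space" and g g' :: "'b \<Rightarrow> real"
  assumes "square_integrable \<mu>1 A" "square_integrable \<mu>1 A'" "square_integrable \<mu>2 g" "square_integrable \<mu>2 g'"
  shows "(\<integral>z. (g (snd z) *\<^sub>R A (fst z)) \<bullet> (g' (snd z) *\<^sub>R A' (fst z)) \<partial>\<mu>)
    = (\<integral>x. A x \<bullet> A' x \<partial>\<mu>1) * (\<integral>y. g y * g' y \<partial>\<mu>2)"
  using integrable_tensor(2)[OF square_integrable_inner[OF assms(1,2)] square_integrable_mult[OF assms(3,4)]]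
  by (simp add: ac_simps)

lemma integral_inner_tensor':
  fixes B B' :: "'b \<Rightarrow> 'c::euclidean_space" and f f' :: "'a \<Rightarrow> real"
  assumes "square_integrable \<mu>1 f" "square_integrable \<mu>1 f'" "square_integrable \<mu>2 B" "square_integrable \<mu>2 B'"
  shows "(\<integral>z. (f (fst z) *\<^sub>R B (snd z)) \<bullet> (f' (fst z) *\<^sub>R B' (snd z)) \<partial>\<mu>)
    = (\<integral>x. f x * f' x \<partial>\<mu>1) * (\<integral>y. B y \<bullet> B' y \<partial>\<mu>2)"
  using integrable_tensor(2)[OF square_integrable_mult[OF assms(1,2)] square_integrable_inner[OF assms(3,4)]]
  by (simp add: ac_simps)

text \<open>
  Slicing a test function of the product yields test functions of the factors, so the weak gradient
  of a tensor product is found by Fubini, one variable at a time.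
\<close>

lemma has_weak_gradient_tensor:
  assumes u: "square_integrable \<mu>1 u" "has_weak_gradient \<Omega>1 u A" "square_integrable \<mu>1 A"
    and v: "square_integrable \<mu>2 v" "has_weak_gradient \<Omega>2 v B" "square_integrable \<mu>2 B"
  shows "has_weak_gradient (\<Omega>1 \<times> \<Omega>2) (tensor_fun u v) (\<lambda>z. (v (snd z) *\<^sub>R A (fst z), u (fst z) *\<^sub>R B (snd z)))"
    and "square_integrable \<mu> (\<lambda>z. (v (snd z) *\<^sub>R A (fst z), u (fst z) *\<^sub>R B (snd z)))"
proof -
  let ?G = "\<lambda>z. (v (snd z) *\<^sub>R A (fst z), u (fst z) *\<^sub>R B (snd z))"
  note si1 = square_integrable_tensor[OF u(3) v(1)] and si2 = square_integrable_tensor'[OF u(1) v(3)]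
  note siuv = square_integrable_tensor_fun[OF u(1) v(1)]
  show G: "square_integrable \<mu> ?G" by (rule square_integrable_Pair[OF si1 si2])
  show "has_weak_gradient (\<Omega>1 \<times> \<Omega>2) (tensor_fun u v) ?G"
    unfolding has_weak_gradient_def
  proof (intro conjI ballI)
    show "locally_integrable (\<Omega>1 \<times> \<Omega>2) (tensor_fun u v)" "locally_integrable (\<Omega>1 \<times> \<Omega>2) ?G"
      by (intro locally_integrable_of_square_integrable open_product bounded_product siuv G)+
    fix \<phi> and i :: "'a \<times> 'b" assume \<phi>: "\<phi> \<in> test_functions (\<Omega>1 \<times> \<Omega>2)" and i: "i \<in> Basis"
    note t = test_function_square_integrable[OF \<phi> finite_product]
    have int1: "integrable \<mu> (\<lambda>z. tensor_fun u v z * frechet_derivative \<phi> (at z) i)"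
      by (rule square_integrable_mult[OF siuv t(2)[OF i]])
    have int2: "integrable \<mu> (\<lambda>z. (?G z \<bullet> i) * \<phi> z)"
      by (rule square_integrable_mult[OF square_integrable_linear_image[OF G bounded_linear_inner_left] t(1)])
    consider k where "k \<in> Basis" "i = (k, 0)" | k where "k \<in> Basis" "i = (0, k)"
      using i by (auto simp: Basis_prod_def)
    then show "(\<integral>z. tensor_fun u v z * frechet_derivative \<phi> (at z) i \<partial>\<mu>) = - (\<integral>z. (?G z \<bullet> i) * \<phi> z \<partial>\<mu>)"
    proof cases
      case 1
      have "(\<integral>z. tensor_fun u v z * frechet_derivative \<phi> (at z) i \<partial>\<mu>)
          = (\<integral>y. \<integral>x. tensor_fun u v (x, y) * frechet_derivative \<phi> (at (x, y)) i \<partial>\<mu>1 \<partial>\<mu>2)"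
        by (rule integral_lebesgue_on_snd[OF sets1 sets2 sets_product int1, symmetric])
      also have "\<dots> = (\<integral>y. v y * (\<integral>x. u x * frechet_derivative (\<lambda>x. \<phi> (x, y)) (at x) k \<partial>\<mu>1) \<partial>\<mu>2)"
        by (simp only: 1 test_function_slice_fst(2)[OF \<phi>] tensor_fun_def prod.case integral_mult_right_zero[symmetric] ac_simps)
      also have "\<dots> = (\<integral>y. v y * - (\<integral>x. (A x \<bullet> k) * \<phi> (x, y) \<partial>\<mu>1) \<partial>\<mu>2)"
        using u(2) test_function_slice_fst(1)[OF \<phi>] 1(1) by (simp add: has_weak_gradient_def)
      also have "\<dots> = - (\<integral>y. \<integral>x. (?G (x, y) \<bullet> i) * \<phi> (x, y) \<partial>\<mu>1 \<partial>\<mu>2)"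
        by (simp add: 1 mult.assoc)
      also have "\<dots> = - (\<integral>z. (?G z \<bullet> i) * \<phi> z \<partial>\<mu>)"
        by (subst integral_lebesgue_on_snd[OF sets1 sets2 sets_product int2]) (rule refl)
      finally show ?thesis .
    next
      case 2
      have "(\<integral>z. tensor_fun u v z * frechet_derivative \<phi> (at z) i \<partial>\<mu>)
          = (\<integral>x. \<integral>y. tensor_fun u v (x, y) * frechet_derivative \<phi> (at (x, y)) i \<partial>\<mu>2 \<partial>\<mu>1)"
        by (rule integral_lebesgue_on_fst[OF sets1 sets2 sets_product int1, symmetric])
      also have "\<dots> = (\<integral>x. u x * (\<integral>y. v y * frechet_derivative (\<lambda>y. \<phi> (x, y)) (at y) k \<partial>\<mu>2) \<partial>\<mu>1)"
        by (simp only: 2 test_function_slice_snd(2)[OF \<phi>] tensor_fun_def prod.case integral_mult_right_zero[symmetric] ac_simps)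
      also have "\<dots> = (\<integral>x. u x * - (\<integral>y. (B y \<bullet> k) * \<phi> (x, y) \<partial>\<mu>2) \<partial>\<mu>1)"
        using v(2) test_function_slice_snd(1)[OF \<phi>] 2(1) by (simp add: has_weak_gradient_def)
      also have "\<dots> = - (\<integral>x. \<integral>y. (?G (x, y) \<bullet> i) * \<phi> (x, y) \<partial>\<mu>2 \<partial>\<mu>1)"
        by (simp add: 2 mult.assoc)
      also have "\<dots> = - (\<integral>z. (?G z \<bullet> i) * \<phi> z \<partial>\<mu>)"
        by (subst integral_lebesgue_on_fst[OF sets1 sets2 sets_product int2]) (rule refl)
      finally show ?thesis .
    qed
  qed
qed

lemma AE_square_integrable_slice:
  fixes f :: "'a \<times> 'b \<Rightarrow> 'c::euclidean_space"
  assumes f: "square_integrable \<mu> f"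
  shows "AE x in \<mu>1. square_integrable \<mu>2 (\<lambda>y. f (x, y))"
proof -
  have i: "integrable \<mu> (\<lambda>z. f z \<bullet> b)" for b
    by (intro integrable_inner_left square_integrable_imp_integrable[OF finite_product f])
  have "AE x in \<mu>1. integrable \<mu>2 (\<lambda>y. f (x, y) \<bullet> b)" for b
    by (rule AE_integrable_lebesgue_on_fst[OF sets1 sets2 sets_product i])
  then have "AE x in \<mu>1. \<forall>b\<in>Basis. integrable \<mu>2 (\<lambda>y. f (x, y) \<bullet> b)"
    by (subst AE_finite_all) auto
  moreover have "AE x in \<mu>1. integrable \<mu>2 (\<lambda>y. (norm (f (x, y)))\<^sup>2)"
    by (rule AE_integrable_lebesgue_on_fst[OF sets1 sets2 sets_product square_integrableD(2)[OF f]])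
  ultimately show ?thesis
  proof eventually_elim
    case (elim x)
    have "(\<lambda>y. f (x, y)) \<in> borel_measurable \<mu>2"
      unfolding borel_measurable_euclidean_space[of "\<lambda>y. f (x, y)"]
      using elim(1) borel_measurable_integrable by auto
    then show ?case using elim(2) by (simp add: square_integrable_def)
  qed
qed

text \<open>
  The squared distances of the slices converge to zero in \<open>L1\<close>, hence almost everywhere along a
  subsequence.
\<close>

lemma AE_L2_converges_slice:
  fixes f :: "nat \<Rightarrow> 'a \<times> 'b \<Rightarrow> 'c::euclidean_space"
  assumes fg: "L2_converges \<mu> f g"
  obtains r :: "nat \<Rightarrow> nat" where "strict_mono r" "AE x in \<mu>1. L2_converges \<mu>2 (\<lambda>n y. f (r n) (x, y)) (\<lambda>y. g (x, y))"
proof -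
  have si: "square_integrable \<mu> (f n)" "square_integrable \<mu> g" for n using fg by (auto simp: L2_converges_def)
  define F where "F n x = (\<integral>y. (norm (f n (x, y) - g (x, y)))\<^sup>2 \<partial>\<mu>2)" for n x
  have int: "integrable \<mu> (\<lambda>z. (norm (f n z - g z))\<^sup>2)" for n
    by (rule square_integrableD(2)[OF square_integrable_diff[OF si]])
  have Fint: "integrable \<mu>1 (F n)" for n
    unfolding F_def by (rule integrable_lebesgue_on_fst[OF sets1 sets2 sets_product int])
  have F_nonneg: "0 \<le> F n x" for n x unfolding F_def by (rule Bochner_Integration.integral_nonneg) simp
  have "(\<integral>x. norm (F n x) \<partial>\<mu>1) = (\<integral>z. (norm (f n z - g z))\<^sup>2 \<partial>\<mu>)" for n
    using integral_lebesgue_on_fst[OF sets1 sets2 sets_product int[of n]] F_nonneg by (simp add: F_def)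
  then have "(\<lambda>n. \<integral>x. norm (F n x) \<partial>\<mu>1) \<longlonglongrightarrow> 0" using fg by (simp add: L2_converges_def)
  then obtain r :: "nat \<Rightarrow> nat" where r: "strict_mono r" "AE x in \<mu>1. (\<lambda>n. F (r n) x) \<longlonglongrightarrow> 0"
    using tendsto_L1_AE_subseq[of \<mu>1 F, OF Fint] by blast
  have "AE x in \<mu>1. \<forall>n. square_integrable \<mu>2 (\<lambda>y. f n (x, y))"
    using AE_square_integrable_slice[OF si(1)] by (simp add: AE_all_countable)
  then have "AE x in \<mu>1. L2_converges \<mu>2 (\<lambda>n y. f (r n) (x, y)) (\<lambda>y. g (x, y))"
    using AE_square_integrable_slice[OF si(2)] r(2)
    by eventually_elim (simp add: L2_converges_def F_def)
  then show ?thesis using that r(1) by blast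
qed

end

lemma has_weak_gradient_sum:
  assumes \<Omega>: "open \<Omega>" "bounded \<Omega>"
    and u: "\<And>i. i \<in> F \<Longrightarrow> square_integrable (lebesgue_on \<Omega>) (u i)"
    and wg: "\<And>i. i \<in> F \<Longrightarrow> has_weak_gradient \<Omega> (u i) (G i)"
    and G: "\<And>i. i \<in> F \<Longrightarrow> square_integrable (lebesgue_on \<Omega>) (G i)"
  shows "has_weak_gradient \<Omega> (\<lambda>x. \<Sum>i\<in>F. c i * u i x) (\<lambda>x. \<Sum>i\<in>F. c i *\<^sub>R G i x)"
  using u wg G
proof (induction F rule: infinite_finite_induct)
  case (insert j F)
  have su: "square_integrable (lebesgue_on \<Omega>) (\<lambda>x. \<Sum>i\<in>F. c i * u i x)"
  proof -
    have "square_integrable (lebesgue_on \<Omega>) (\<lambda>x. \<Sum>i\<in>F. c i *\<^sub>R u i x)"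
      by (intro square_integrable_sum square_integrable_scaleR insert.prems(1)) simp
    then show ?thesis by simp
  qed
  have sG: "square_integrable (lebesgue_on \<Omega>) (\<lambda>x. \<Sum>i\<in>F. c i *\<^sub>R G i x)"
    by (intro square_integrable_sum square_integrable_scaleR insert.prems(3)) simp
  have wF: "has_weak_gradient \<Omega> (\<lambda>x. \<Sum>i\<in>F. c i * u i x) (\<lambda>x. \<Sum>i\<in>F. c i *\<^sub>R G i x)"
    using insert by simp
  have "has_weak_gradient \<Omega> (\<lambda>x. c j * u j x + 1 * (\<Sum>i\<in>F. c i * u i x)) (\<lambda>x. c j *\<^sub>R G j x + 1 *\<^sub>R (\<Sum>i\<in>F. c i *\<^sub>R G i x))"
    by (rule has_weak_gradient_lin[OF \<Omega> _ _ _ su wF sG]) (use insert.prems in simp_all)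
  then show ?case using insert.hyps by simp
qed (simp_all add: has_weak_gradient_zero)

lemma sum_square_delta_fst:
  fixes c :: "nat \<times> nat \<Rightarrow> real"
  shows "(\<Sum>i\<in>{..<N}\<times>{..<N}. \<Sum>i'\<in>{..<N}\<times>{..<N}. c i * c i' * ((if fst i = fst i' then 1 else 0) * K (snd i) (snd i')))
    = (\<Sum>j<N. \<Sum>k<N. \<Sum>k'<N. c (j, k) * c (j, k') * K k k')"
proof -
  have row: "(\<Sum>i'\<in>{..<N}\<times>{..<N}. c (j, k) * c i' * ((if j = fst i' then 1 else 0) * K k (snd i')))
      = (\<Sum>k'<N. c (j, k) * c (j, k') * K k k')" if "j < N" for j k
  proof -
    have "(\<Sum>i'\<in>{..<N}\<times>{..<N}. c (j, k) * c i' * ((if j = fst i' then 1 else 0) * K k (snd i')))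
        = (\<Sum>k'<N. \<Sum>j'<N. if j' = j then c (j, k) * c (j, k') * K k k' else 0)"
      unfolding sum.cartesian_product' by (subst sum.swap) (intro sum.cong refl, simp)
    then show ?thesis using that by simp
  qed
  have "(\<Sum>i'\<in>{..<N}\<times>{..<N}. c i * c i' * ((if fst i = fst i' then 1 else 0) * K (snd i) (snd i')))
      = (\<Sum>k'<N. c i * c (fst i, k') * K (snd i) k')" if i: "i \<in> {..<N}\<times>{..<N}" for i
  proof -
    have "fst i < N" "snd i < N" using i by auto
    then show ?thesis using row[where j = "fst i" and k = "snd i"] by (simp only: prod.collapse)
  qed
  then have "(\<Sum>i\<in>{..<N}\<times>{..<N}. \<Sum>i'\<in>{..<N}\<times>{..<N}. c i * c i' * ((if fst i = fst i' then 1 else 0) * K (snd i) (snd i')))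
      = (\<Sum>i\<in>{..<N}\<times>{..<N}. \<Sum>k'<N. c i * c (fst i, k') * K (snd i) k')"
    by (rule sum.cong[OF refl])
  then show ?thesis by (simp only: sum.cartesian_product' fst_conv snd_conv)
qed

lemma sum_square_delta_snd:
  fixes c :: "nat \<times> nat \<Rightarrow> real"
  shows "(\<Sum>i\<in>{..<N}\<times>{..<N}. \<Sum>i'\<in>{..<N}\<times>{..<N}. c i * c i' * (K (fst i) (fst i') * (if snd i = snd i' then 1 else 0)))
    = (\<Sum>k<N. \<Sum>j<N. \<Sum>j'<N. c (j, k) * c (j', k) * K j j')"
proof -
  have row: "(\<Sum>i'\<in>{..<N}\<times>{..<N}. c (j, k) * c i' * (K j (fst i') * (if k = snd i' then 1 else 0)))
      = (\<Sum>j'<N. c (j, k) * c (j', k) * K j j')" if "k < N" for j k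
  proof -
    have "(\<Sum>i'\<in>{..<N}\<times>{..<N}. c (j, k) * c i' * (K j (fst i') * (if k = snd i' then 1 else 0)))
        = (\<Sum>j'<N. \<Sum>k'<N. if k' = k then c (j, k) * c (j', k) * K j j' else 0)"
      unfolding sum.cartesian_product' by (intro sum.cong refl) simp
    then show ?thesis using that by simp
  qed
  have "(\<Sum>i'\<in>{..<N}\<times>{..<N}. c i * c i' * (K (fst i) (fst i') * (if snd i = snd i' then 1 else 0)))
      = (\<Sum>j'<N. c i * c (j', snd i) * K (fst i) j')" if i: "i \<in> {..<N}\<times>{..<N}" for i
  proof -
    have "fst i < N" "snd i < N" using i by auto
    then show ?thesis using row[where j = "fst i" and k = "snd i"] by (simp only: prod.collapse)
  qed
  then have "(\<Sum>i\<in>{..<N}\<times>{..<N}. \<Sum>i'\<in>{..<N}\<times>{..<N}. c i * c i' * (K (fst i) (fst i') * (if snd i = snd i' then 1 else 0)))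
      = (\<Sum>i\<in>{..<N}\<times>{..<N}. \<Sum>j'<N. c i * c (j', snd i) * K (fst i) j')"
    by (rule sum.cong[OF refl])
  also have "\<dots> = (\<Sum>j<N. \<Sum>k<N. \<Sum>j'<N. c (j, k) * c (j', k) * K j j')"
    by (simp only: sum.cartesian_product' fst_conv snd_conv)
  also have "\<dots> = (\<Sum>k<N. \<Sum>j<N. \<Sum>j'<N. c (j, k) * c (j', k) * K j j')"
    by (rule sum.swap)
  finally show ?thesis .
qed

section \<open>The weak form on the tensor product space\<close>

context product_domain
begin

definition tensor_gradient :: "('a \<Rightarrow> real) \<Rightarrow> ('b \<Rightarrow> real) \<Rightarrow> 'a \<times> 'b \<Rightarrow> 'a \<times> 'b" where
  "tensor_gradient u v z = (v (snd z) *\<^sub>R weak_gradient \<Omega>1 u (fst z), u (fst z) *\<^sub>R weak_gradient \<Omega>2 v (snd z))"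

lemma tensor_gradient:
  assumes "u \<in> H1 \<Omega>1" "v \<in> H1 \<Omega>2"
  shows "has_weak_gradient (\<Omega>1 \<times> \<Omega>2) (tensor_fun u v) (tensor_gradient u v)"
    and "square_integrable \<mu> (tensor_gradient u v)"
    and "square_integrable \<mu> (tensor_fun u v)"
  using has_weak_gradient_tensor[OF H1_D[OF open1 assms(1)] H1_D[OF open2 assms(2)]]
    square_integrable_tensor_fun[OF H1_D(1)[OF open1 assms(1)] H1_D(1)[OF open2 assms(2)]]
  by (simp_all add: tensor_gradient_def[abs_def])

lemma L2_inner_tensor:
  assumes "square_integrable \<mu>1 u" "square_integrable \<mu>1 u'" "square_integrable \<mu>2 v" "square_integrable \<mu>2 v'"
  shows "L2_inner \<mu> (tensor_fun u v) (tensor_fun u' v') = L2_inner \<mu>1 u u' * L2_inner \<mu>2 v v'"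
  using integral_inner_tensor'[OF assms]
  by (simp add: L2_inner_def tensor_fun_def case_prod_beta')

text \<open>
  With \<open>e\<close> orthonormal for the Dirichlet form and \<open>f\<close> for the \<open>H1\<close> inner product, the first component
  of the gradient of \<open>S = \<Sum> c\<^sub>j\<^sub>k e\<^sub>j \<otimes> f\<^sub>k\<close> has squared norm \<open>\<Sum>\<^sub>j \<parallel>\<Sum>\<^sub>k c\<^sub>j\<^sub>k f\<^sub>k\<parallel>\<^sup>2\<close>, and the second one, because
  \<open>\<langle>\<nabla>f\<^sub>k, \<nabla>f\<^sub>l\<rangle> = \<delta>\<^sub>k\<^sub>l - \<langle>f\<^sub>k, f\<^sub>l\<rangle>\<close>, has squared norm \<open>\<Sum>\<^sub>k \<parallel>\<Sum>\<^sub>j c\<^sub>j\<^sub>k e\<^sub>j\<parallel>\<^sup>2 - \<parallel>S\<parallel>\<^sup>2\<close>, all norms being those of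
  \<open>L2\<close>. The Poincare inequality bounds the latter.
\<close>

lemma tensor_gradient_energy_le:
  fixes c :: "nat \<times> nat \<Rightarrow> real"
  assumes e: "\<And>j. e j \<in> H1 \<Omega>1" "\<And>i j. dirichlet_form \<Omega>1 (e i) (e j) = (if i = j then 1 else 0)"
    and f: "\<And>k. f k \<in> H1 \<Omega>2" "\<And>i j. H1_inner \<Omega>2 (f i) (f j) = (if i = j then 1 else 0)"
    and poincare: "\<And>a. L2_inner \<mu>1 (\<lambda>x. \<Sum>j<N. a j * e j x) (\<lambda>x. \<Sum>j<N. a j * e j x)
        \<le> C * (\<Sum>j<N. (a j)\<^sup>2)"
  shows "(\<integral>z. (norm (\<Sum>i\<in>{..<N}\<times>{..<N}. c i *\<^sub>R tensor_gradient (e (fst i)) (f (snd i)) z))\<^sup>2 \<partial>\<mu>)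
    \<le> (1 + C) * (\<Sum>i\<in>{..<N}\<times>{..<N}. (c i)\<^sup>2)"
proof -
  let ?I = "{..<N} \<times> {..<N}"
  interpret D1: semi_inner_space "H1 \<Omega>1" "dirichlet_form \<Omega>1" by (rule semi_inner_space_dirichlet[OF open1 bounded1])
  interpret D2: semi_inner_space "H1 \<Omega>2" "dirichlet_form \<Omega>2" by (rule semi_inner_space_dirichlet[OF open2 bounded2])
  interpret H2: semi_inner_space "H1 \<Omega>2" "H1_inner \<Omega>2" by (rule semi_inner_space_H1[OF open2 bounded2])
  interpret L1: semi_inner_space "L2 \<mu>1" "L2_inner \<mu>1" by (rule semi_inner_space_L2)
  interpret L2: semi_inner_space "L2 \<mu>2" "L2_inner \<mu>2" by (rule semi_inner_space_L2)
  note E = H1_D[OF open1 e(1)] and F = H1_D[OF open2 f(1)]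
  have eL: "e j \<in> L2 \<mu>1" and fL: "f j \<in> L2 \<mu>2" for j using E(1) F(1) by (simp_all add: L2_iff_square_integrable)
  define X where "X i z = f (snd i) (snd z) *\<^sub>R weak_gradient \<Omega>1 (e (fst i)) (fst z)" for i :: "nat \<times> nat" and z
  define Y where "Y i z = e (fst i) (fst z) *\<^sub>R weak_gradient \<Omega>2 (f (snd i)) (snd z)" for i :: "nat \<times> nat" and z
  define W where "W i = tensor_fun (e (fst i)) (f (snd i))" for i :: "nat \<times> nat"
  have Xsi: "square_integrable \<mu> (X i)" and Ysi: "square_integrable \<mu> (Y i)" and Wsi: "square_integrable \<mu> (W i)" for i
    unfolding X_def[abs_def] Y_def[abs_def] W_def
    by (rule square_integrable_tensor[OF E(3) F(1)], rule square_integrable_tensor'[OF E(1) F(3)],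
        rule square_integrable_tensor_fun[OF E(1) F(1)])
  have XX: "(\<integral>z. X i z \<bullet> X i' z \<partial>\<mu>) = (if fst i = fst i' then 1 else 0) * L2_inner \<mu>2 (f (snd i)) (f (snd i'))" for i i'
    unfolding X_def integral_inner_tensor[OF E(3) E(3) F(1) F(1)] e(2)[symmetric]
    by (simp add: dirichlet_form_def L2_inner_def)
  have WW: "(\<integral>z. W i z \<bullet> W i' z \<partial>\<mu>) = L2_inner \<mu>1 (e (fst i)) (e (fst i')) * L2_inner \<mu>2 (f (snd i)) (f (snd i'))" for i i'
    using L2_inner_tensor[OF E(1)[of "fst i"] E(1)[of "fst i'"] F(1)[of "snd i"] F(1)[of "snd i'"]]
    by (simp add: W_def L2_inner_def)
  have YY: "(\<integral>z. Y i z \<bullet> Y i' z \<partial>\<mu>) = L2_inner \<mu>1 (e (fst i)) (e (fst i')) * (if snd i = snd i' then 1 else 0)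
      - (\<integral>z. W i z \<bullet> W i' z \<partial>\<mu>)" for i i'
  proof -
    have "(\<integral>z. Y i z \<bullet> Y i' z \<partial>\<mu>) = L2_inner \<mu>1 (e (fst i)) (e (fst i')) * dirichlet_form \<Omega>2 (f (snd i)) (f (snd i'))"
      unfolding Y_def integral_inner_tensor'[OF E(1) E(1) F(3) F(3)]
      by (simp add: dirichlet_form_def L2_inner_def)
    also have "dirichlet_form \<Omega>2 (f (snd i)) (f (snd i')) = (if snd i = snd i' then 1 else 0) - L2_inner \<mu>2 (f (snd i)) (f (snd i'))"
      using f(2)[of "snd i" "snd i'"] by (simp add: H1_inner_def)
    finally show ?thesis unfolding WW by (simp only: right_diff_distrib)
  qed
  have norm_X: "(\<integral>z. (norm (\<Sum>i\<in>?I. c i *\<^sub>R X i z))\<^sup>2 \<partial>\<mu>) \<le> (\<Sum>i\<in>?I. (c i)\<^sup>2)"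
  proof -
    have "(\<integral>z. (norm (\<Sum>i\<in>?I. c i *\<^sub>R X i z))\<^sup>2 \<partial>\<mu>)
        = (\<Sum>j<N. \<Sum>k<N. \<Sum>k'<N. c (j, k) * c (j, k') * L2_inner \<mu>2 (f k) (f k'))"
      unfolding integral_norm_sum_square[OF Xsi] XX by (rule sum_square_delta_fst)
    also have "\<dots> = (\<Sum>j<N. L2_inner \<mu>2 (\<lambda>y. \<Sum>k<N. c (j, k) * f k y) (\<lambda>y. \<Sum>k<N. c (j, k) * f k y))"
      by (simp add: L2.ip_sum_sum fL)
    also have "\<dots> \<le> (\<Sum>j<N. H1_inner \<Omega>2 (\<lambda>y. \<Sum>k<N. c (j, k) * f k y) (\<lambda>y. \<Sum>k<N. c (j, k) * f k y))"
      unfolding H1_inner_def by (intro sum_mono) (simp add: D2.ip_nonneg D2.sum_mem f(1))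
    also have "\<dots> = (\<Sum>j<N. \<Sum>k<N. (c (j, k))\<^sup>2)"
      using f by (intro sum.cong refl H2.ip_orthonormal_sum) (simp add: H2.orthonormal_upto_def)
    finally show ?thesis by (simp add: sum.cartesian_product')
  qed
  have norm_Y: "(\<integral>z. (norm (\<Sum>i\<in>?I. c i *\<^sub>R Y i z))\<^sup>2 \<partial>\<mu>) \<le> C * (\<Sum>i\<in>?I. (c i)\<^sup>2)"
  proof -
    have "(\<integral>z. (norm (\<Sum>i\<in>?I. c i *\<^sub>R Y i z))\<^sup>2 \<partial>\<mu>)
        = (\<Sum>i\<in>?I. \<Sum>i'\<in>?I. c i * c i' * (L2_inner \<mu>1 (e (fst i)) (e (fst i')) * (if snd i = snd i' then 1 else 0)))
          - (\<Sum>i\<in>?I. \<Sum>i'\<in>?I. c i * c i' * (\<integral>z. W i z \<bullet> W i' z \<partial>\<mu>))"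
      unfolding integral_norm_sum_square[OF Ysi] YY by (simp only: right_diff_distrib sum_subtractf)
    also have "(\<Sum>i\<in>?I. \<Sum>i'\<in>?I. c i * c i' * (\<integral>z. W i z \<bullet> W i' z \<partial>\<mu>)) = (\<integral>z. (norm (\<Sum>i\<in>?I. c i *\<^sub>R W i z))\<^sup>2 \<partial>\<mu>)"
      by (rule integral_norm_sum_square[OF Wsi, symmetric])
    also have "(\<Sum>i\<in>?I. \<Sum>i'\<in>?I. c i * c i' * (L2_inner \<mu>1 (e (fst i)) (e (fst i')) * (if snd i = snd i' then 1 else 0)))
        = (\<Sum>k<N. \<Sum>j<N. \<Sum>j'<N. c (j, k) * c (j', k) * L2_inner \<mu>1 (e j) (e j'))"
      by (rule sum_square_delta_snd)
    also have "\<dots> = (\<Sum>k<N. L2_inner \<mu>1 (\<lambda>x. \<Sum>j<N. c (j, k) * e j x) (\<lambda>x. \<Sum>j<N. c (j, k) * e j x))"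
      by (simp add: L1.ip_sum_sum eL)
    also have "\<dots> - (\<integral>z. (norm (\<Sum>i\<in>?I. c i *\<^sub>R W i z))\<^sup>2 \<partial>\<mu>)
        \<le> (\<Sum>k<N. L2_inner \<mu>1 (\<lambda>x. \<Sum>j<N. c (j, k) * e j x) (\<lambda>x. \<Sum>j<N. c (j, k) * e j x))"
      by simp
    also have "\<dots> \<le> (\<Sum>k<N. C * (\<Sum>j<N. (c (j, k))\<^sup>2))"
      by (intro sum_mono poincare)
    also have "\<dots> = C * (\<Sum>k<N. \<Sum>j<N. (c (j, k))\<^sup>2)" by (simp only: sum_distrib_left)
    also have "(\<Sum>k<N. \<Sum>j<N. (c (j, k))\<^sup>2) = (\<Sum>j<N. \<Sum>k<N. (c (j, k))\<^sup>2)" by (rule sum.swap)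
    finally show ?thesis by (simp add: sum.cartesian_product')
  qed
  have "(\<Sum>i\<in>?I. c i *\<^sub>R tensor_gradient (e (fst i)) (f (snd i)) z) = (\<Sum>i\<in>?I. c i *\<^sub>R X i z, \<Sum>i\<in>?I. c i *\<^sub>R Y i z)" for z
    by (simp add: prod_eq_iff fst_sum snd_sum tensor_gradient_def X_def Y_def)
  then have "(\<integral>z. (norm (\<Sum>i\<in>?I. c i *\<^sub>R tensor_gradient (e (fst i)) (f (snd i)) z))\<^sup>2 \<partial>\<mu>)
      = (\<integral>z. (norm (\<Sum>i\<in>?I. c i *\<^sub>R X i z))\<^sup>2 \<partial>\<mu>) + (\<integral>z. (norm (\<Sum>i\<in>?I. c i *\<^sub>R Y i z))\<^sup>2 \<partial>\<mu>)"
    by (simp only:) (intro integral_norm_Pair square_integrable_sum square_integrable_scaleR Xsi Ysi)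
  also have "\<dots> \<le> (1 + C) * (\<Sum>i\<in>?I. (c i)\<^sup>2)" using norm_X norm_Y by (simp add: distrib_right)
  finally show ?thesis .
qed

lemma filterlim_squares: "filterlim (\<lambda>n :: nat. {..<n} \<times> {..<n}) (finite_subsets_at_top UNIV) sequentially"
  unfolding filterlim_finite_subsets_at_top
proof (intro allI impI)
  fix X :: "(nat \<times> nat) set" assume X: "finite X \<and> X \<subseteq> UNIV"
  obtain m where m: "\<And>i. i \<in> fst ` X \<union> snd ` X \<Longrightarrow> i < m"
    using finite_nat_set_iff_bounded[of "fst ` X \<union> snd ` X"] X by auto
  show "\<forall>\<^sub>F n in sequentially. finite ({..<n} \<times> {..<n}) \<and> X \<subseteq> {..<n} \<times> {..<n} \<and> {..<n} \<times> {..<n} \<subseteq> UNIV"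
    using eventually_ge_at_top[of m]
    by (rule eventually_mono) (force dest: m[OF UnI1, OF imageI] m[OF UnI2, OF imageI])
qed

text \<open>
  The square partial sums of an element of \<open>H10 \<Omega>1 \<otimes> H1 \<Omega>2\<close> converge together with their gradients:
  by the energy estimate the gradients form a Cauchy sequence.
\<close>

lemma dsl_space_approximation:
  assumes h: "h \<in> dsl_space \<Omega>1 \<Omega>2"
    and poincare: "\<And>u. u \<in> H10 \<Omega>1 \<Longrightarrow> L2_inner \<mu>1 u u \<le> C * dirichlet_form \<Omega>1 u u"
  obtains e f c G where "\<And>j. e j \<in> H10 \<Omega>1" "\<And>k. f k \<in> H1 \<Omega>2"
    "L2_converges \<mu> (\<lambda>n z. \<Sum>i\<in>{..<n}\<times>{..<n}. c i * tensor_fun (e (fst i)) (f (snd i)) z) h"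
    "L2_converges \<mu> (\<lambda>n z. \<Sum>i\<in>{..<n}\<times>{..<n}. c i *\<^sub>R tensor_gradient (e (fst i)) (f (snd i)) z) G"
proof -
  obtain e f and c :: "nat \<times> nat \<Rightarrow> real" where hL: "h \<in> L2 \<mu>"
    and eb: "orthonormal_basis (H10 \<Omega>1) (dirichlet_form \<Omega>1) e" and fb: "orthonormal_basis (H1 \<Omega>2) (H1_inner \<Omega>2) f"
    and c: "(\<lambda>jk. (c jk)\<^sup>2) summable_on UNIV"
    and lim: "((\<lambda>F. L2_norm \<mu> (\<lambda>z. h z - (\<Sum>(j, k)\<in>F. c (j, k) * tensor_fun (e j) (f k) z))) \<longlongrightarrow> 0) (finite_subsets_at_top UNIV)"
    using h unfolding dsl_space_def hilbert_tensor_def by blast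
  have e: "e j \<in> H10 \<Omega>1" "dirichlet_form \<Omega>1 (e i) (e j) = (if i = j then 1 else 0)" for i j
    using eb by (auto simp: orthonormal_basis_def)
  have f: "f j \<in> H1 \<Omega>2" "H1_inner \<Omega>2 (f i) (f j) = (if i = j then 1 else 0)" for i j
    using fb by (auto simp: orthonormal_basis_def)
  have eH1: "e j \<in> H1 \<Omega>1" for j using e(1) H10_subset_H1 by blast
  define I where "I n = {..<n} \<times> {..<n}" for n :: nat
  define S where "S n z = (\<Sum>i\<in>I n. c i * tensor_fun (e (fst i)) (f (snd i)) z)" for n z
  define g where "g n z = (\<Sum>i\<in>I n. c i *\<^sub>R tensor_gradient (e (fst i)) (f (snd i)) z)" for n z
  have hsi: "square_integrable \<mu> h" using hL by (simp add: L2_iff_square_integrable)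
  have Ssi: "square_integrable \<mu> (S n)" for n
  proof -
    have "square_integrable \<mu> (\<lambda>z. \<Sum>i\<in>I n. c i *\<^sub>R tensor_fun (e (fst i)) (f (snd i)) z)"
      by (intro square_integrable_sum square_integrable_scaleR tensor_gradient(3) eH1 f(1))
    then show ?thesis by (simp add: S_def[abs_def])
  qed
  have gsi: "square_integrable \<mu> (g n)" for n
    unfolding g_def[abs_def] by (intro square_integrable_sum square_integrable_scaleR tensor_gradient(2) eH1 f(1))
  have "L2_converges \<mu> S h"
  proof -
    have "(\<lambda>n. L2_norm \<mu> (\<lambda>z. h z - S n z)) \<longlonglongrightarrow> 0"
      using filterlim_compose[OF lim filterlim_squares] by (simp add: S_def I_def case_prod_beta')
    then have "(\<lambda>n. (L2_norm \<mu> (\<lambda>z. h z - S n z))\<^sup>2) \<longlonglongrightarrow> 0\<^sup>2" by (rule tendsto_power)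
    moreover have "(L2_norm \<mu> (\<lambda>z. h z - S n z))\<^sup>2 = (\<integral>z. (norm (S n z - h z))\<^sup>2 \<partial>\<mu>)" for n
      by (simp add: L2_norm_def L2_inner_self power2_commute[of "h _"] del: power2_commute)
    ultimately show ?thesis using Ssi hsi by (simp add: L2_converges_def)
  qed
  interpret D: semi_inner_space "H10 \<Omega>1" "dirichlet_form \<Omega>1"
    using e(1) by (intro semi_inner_space_H10[OF open1 bounded1]) blast
  have poincare_sum: "L2_inner \<mu>1 (\<lambda>x. \<Sum>j<N. a j * e j x) (\<lambda>x. \<Sum>j<N. a j * e j x) \<le> C * (\<Sum>j<N. (a j)\<^sup>2)" for N a
    using poincare[OF D.sum_mem[of "{..<N}" e a]] D.ip_orthonormal_sum[of N e a] e
    by (simp add: D.orthonormal_upto_def)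
  define q where "q n = (\<Sum>i\<in>I n. (c i)\<^sup>2)" for n
  have I_mono: "I n \<subseteq> I m" if "n \<le> m" for n m using that by (auto simp: I_def)
  have diff_le: "(\<integral>z. (norm (g m z - g n z))\<^sup>2 \<partial>\<mu>) \<le> (1 + C) * (q m - q n)" if nm: "n \<le> m" for m n
  proof -
    define c' where "c' i = (if i \<in> I n then 0 else c i)" for i
    have split: "(\<Sum>i\<in>I m. k i) = (\<Sum>i\<in>I m - I n. k i) + (\<Sum>i\<in>I n. k i)" for k :: "nat \<times> nat \<Rightarrow> 'c::comm_monoid_add"
      by (rule sum.subset_diff[OF I_mono[OF nm]]) (simp add: I_def)
    have "g m z - g n z = (\<Sum>i\<in>I m. c' i *\<^sub>R tensor_gradient (e (fst i)) (f (snd i)) z)" for z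
      unfolding g_def split by (simp add: c'_def)
    moreover have "(\<Sum>i\<in>I m. (c' i)\<^sup>2) = q m - q n"
      unfolding q_def split by (simp add: c'_def)
    ultimately show ?thesis
      using tensor_gradient_energy_le[where N = m and c = c', OF eH1 e(2) f(1) f(2) poincare_sum] by (simp add: I_def)
  qed
  have C: "0 \<le> 1 + C"
  proof -
    have "0 \<le> L2_inner \<mu>1 (e 0) (e 0)" unfolding L2_inner_self by (rule Bochner_Integration.integral_nonneg) simp
    then show ?thesis using poincare[OF e(1)[of 0]] e(2)[of 0 0] by simp
  qed
  have "incseq q"
    unfolding q_def by (intro incseq_SucI sum_mono2 I_mono) (auto simp: I_def)
  moreover have "q n \<le> infsum (\<lambda>i. (c i)\<^sup>2) UNIV" for n
    unfolding q_def by (intro finite_sum_le_infsum c) (auto simp: I_def)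
  ultimately have "convergent q"
    using Bseq_mono_convergent[of q] by (metis incseq_convergent convergent_def)
  then have "Cauchy q" by (rule convergent_Cauchy)
  have "\<exists>G. L2_converges \<mu> g G"
  proof (rule Riesz_Fischer[OF gsi])
    fix \<epsilon> :: real assume \<epsilon>: "0 < \<epsilon>"
    have "0 < \<epsilon> / (2 + C)" using \<epsilon> C by simp
    then obtain N where N: "\<And>m n. m \<ge> N \<Longrightarrow> n \<ge> N \<Longrightarrow> norm (q m - q n) < \<epsilon> / (2 + C)"
      using CauchyD[OF \<open>Cauchy q\<close>] by blast
    have le: "(\<integral>z. (norm (g m z - g n z))\<^sup>2 \<partial>\<mu>) < \<epsilon>" if "n \<ge> N" "n \<le> m" for m n
    proof -
      have "(\<integral>z. (norm (g m z - g n z))\<^sup>2 \<partial>\<mu>) \<le> (1 + C) * (q m - q n)" by (rule diff_le[OF that(2)])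
      also have "\<dots> \<le> (1 + C) * (\<epsilon> / (2 + C))"
        using N[of m n] that C by (intro mult_left_mono) auto
      also have "\<dots> < \<epsilon>"
      proof -
        have "(1 + C) / (2 + C) < 1" using C by (simp add: divide_less_eq)
        then have "\<epsilon> * ((1 + C) / (2 + C)) < \<epsilon> * 1" using \<epsilon> by (intro mult_strict_left_mono)
        then show ?thesis by (simp add: mult.commute)
      qed
      finally show ?thesis .
    qed
    have "(\<integral>z. (norm (g m z - g n z))\<^sup>2 \<partial>\<mu>) < \<epsilon>" if "m \<ge> N" "n \<ge> N" for m n
    proof (cases "n \<le> m")
      case False
      then show ?thesis using le[of m n] that le[OF that(1), of n] by (simp only: norm_minus_commute[of "g m _"])
    qed (use le that in auto)
    then show "\<exists>N. \<forall>m\<ge>N. \<forall>n\<ge>N. (\<integral>z. (norm (g m z - g n z))\<^sup>2 \<partial>\<mu>) < \<epsilon>" by blast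
  qed
  then obtain G where "L2_converges \<mu> g G" by blast
  then show ?thesis
    using that[of e f c G] e(1) f(1) \<open>L2_converges \<mu> S h\<close> by (simp add: S_def[abs_def] g_def[abs_def] I_def)
qed

text \<open>
  Separation of variables. The two components of the gradient need different arguments: a limit of
  partial sums suffices for the first one, whereas the boundary form is defined through the traces of
  the slices of \<open>h\<close> and calls for a statement about almost every slice.
\<close>

lemma dsl_weak_form:
  assumes e: "e \<in> H10 \<Omega>1" "\<And>v. v \<in> H10 \<Omega>1 \<Longrightarrow> dirichlet_form \<Omega>1 e v = lam * L2_inner \<mu>1 e v"
    and s: "s \<in> H1 \<Omega>2" "\<And>v. v \<in> H1 \<Omega>2 \<Longrightarrow> dirichlet_form \<Omega>2 s v = del * boundary_form \<Omega>2 b s v"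
    and scale: "\<And>a v. v \<in> H1 \<Omega>2 \<Longrightarrow> boundary_form \<Omega>2 b (\<lambda>y. a * s y) v = a * boundary_form \<Omega>2 b s v"
    and poincare: "\<And>u. u \<in> H10 \<Omega>1 \<Longrightarrow> L2_inner \<mu>1 u u \<le> C * dirichlet_form \<Omega>1 u u"
    and h: "h \<in> dsl_space \<Omega>1 \<Omega>2"
  shows "dirichlet_form (\<Omega>1 \<times> \<Omega>2) (tensor_fun e s) h
    = lam * L2_inner \<mu> (tensor_fun e s) h + del * dsl_boundary_form \<Omega>1 \<Omega>2 b (tensor_fun e s) h"
proof -
  obtain E F c G where E: "\<And>j. E j \<in> H10 \<Omega>1" and F: "\<And>k. F k \<in> H1 \<Omega>2"
    and S0: "L2_converges \<mu> (\<lambda>n z. \<Sum>i\<in>{..<n}\<times>{..<n}. c i * tensor_fun (E (fst i)) (F (snd i)) z) h"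
    and g0: "L2_converges \<mu> (\<lambda>n z. \<Sum>i\<in>{..<n}\<times>{..<n}. c i *\<^sub>R tensor_gradient (E (fst i)) (F (snd i)) z) G"
  proof (rule dsl_space_approximation[OF h poincare])
    fix e f c G assume "\<And>j. e j \<in> H10 \<Omega>1" "\<And>k. f k \<in> H1 \<Omega>2"
      "L2_converges \<mu> (\<lambda>n z. \<Sum>i\<in>{..<n}\<times>{..<n}. c i * tensor_fun (e (fst i)) (f (snd i)) z) h"
      "L2_converges \<mu> (\<lambda>n z. \<Sum>i\<in>{..<n}\<times>{..<n}. c i *\<^sub>R tensor_gradient (e (fst i)) (f (snd i)) z) G"
    then show thesis by (rule that)
  qed
  define I where "I n = {..<n} \<times> {..<n}" for n :: nat
  define S where "S n z = (\<Sum>i\<in>I n. c i * tensor_fun (E (fst i)) (F (snd i)) z)" for n z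
  define g where "g n z = (\<Sum>i\<in>I n. c i *\<^sub>R tensor_gradient (E (fst i)) (F (snd i)) z)" for n z
  have S: "L2_converges \<mu> S h" and g: "L2_converges \<mu> g G"
    using S0 g0 by (simp_all add: S_def[abs_def] g_def[abs_def] I_def)
  have EH1: "E j \<in> H1 \<Omega>1" for j using E H10_subset_H1 by blast
  have eH1: "e \<in> H1 \<Omega>1" using e(1) H10_subset_H1 by blast
  note eD = H1_D[OF open1 eH1] and sD = H1_D[OF open2 s(1)] and ED = H1_D[OF open1 EH1] and FD = H1_D[OF open2 F]
  define A where "A = weak_gradient \<Omega>1 e"
  define B where "B = weak_gradient \<Omega>2 s"
  have Gsi: "square_integrable \<mu> G" and hsi: "square_integrable \<mu> h" using g S by (auto simp: L2_converges_def)
  have wg_h: "has_weak_gradient (\<Omega>1 \<times> \<Omega>2) h G"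
  proof (rule has_weak_gradient_L2_limit[OF open_product bounded_product S g])
    show "has_weak_gradient (\<Omega>1 \<times> \<Omega>2) (S n) (g n)" for n
      unfolding S_def[abs_def] g_def[abs_def]
      by (rule has_weak_gradient_sum[OF open_product bounded_product]) (rule tensor_gradient[OF EH1 F])+
  qed
  let ?X = "\<lambda>z. s (snd z) *\<^sub>R A (fst z)" and ?Y = "\<lambda>z. e (fst z) *\<^sub>R B (snd z)"
  have Xsi: "square_integrable \<mu> ?X" unfolding A_def by (rule square_integrable_tensor[OF eD(3) sD(1)])
  have Ysi: "square_integrable \<mu> ?Y" unfolding B_def by (rule square_integrable_tensor'[OF eD(1) sD(3)])
  have fstG: "L2_converges \<mu> (\<lambda>n z. fst (g n z)) (\<lambda>z. fst (G z))"
    by (rule L2_converges_linear_image[OF g bounded_linear_fst])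
  have sndG: "L2_converges \<mu> (\<lambda>n z. snd (g n z)) (\<lambda>z. snd (G z))"
    by (rule L2_converges_linear_image[OF g bounded_linear_snd])
  have Gsi': "square_integrable \<mu> (\<lambda>z. fst (G z))" "square_integrable \<mu> (\<lambda>z. snd (G z))"
    using fstG sndG by (auto simp: L2_converges_def)
  have "dirichlet_form (\<Omega>1 \<times> \<Omega>2) (tensor_fun e s) h = (\<integral>z. tensor_gradient e s z \<bullet> G z \<partial>\<mu>)"
    by (rule dirichlet_form_eq[OF open_product tensor_gradient(1,2)[OF eH1 s(1)] wg_h Gsi])
  also have "\<dots> = (\<integral>z. fst (G z) \<bullet> ?X z + ?Y z \<bullet> snd (G z) \<partial>\<mu>)"
    by (simp add: tensor_gradient_def A_def B_def inner_prod_def inner_commute)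
  also have "\<dots> = (\<integral>z. fst (G z) \<bullet> ?X z \<partial>\<mu>) + (\<integral>z. ?Y z \<bullet> snd (G z) \<partial>\<mu>)"
    using square_integrable_inner[OF Gsi'(1) Xsi] square_integrable_inner[OF Ysi Gsi'(2)]
    by (rule Bochner_Integration.integral_add)
  \<comment> \<open>The derivative in the first variable only needs partial sums, for which the Dirichlet
    eigenvalue equation can be applied term by term.\<close>
  also have "(\<integral>z. fst (G z) \<bullet> ?X z \<partial>\<mu>) = lam * L2_inner \<mu> (tensor_fun e s) h"
  proof (rule LIMSEQ_unique)
    show "(\<lambda>n. \<integral>z. fst (g n z) \<bullet> ?X z \<partial>\<mu>) \<longlonglongrightarrow> (\<integral>z. fst (G z) \<bullet> ?X z \<partial>\<mu>)"
      by (rule L2_converges_inner[OF fstG Xsi])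
    have summand: "(\<integral>z. (F k (snd z) *\<^sub>R weak_gradient \<Omega>1 (E j) (fst z)) \<bullet> ?X z \<partial>\<mu>)
        = lam * (\<integral>z. tensor_fun (E j) (F k) z * tensor_fun e s z \<partial>\<mu>)" for j k
    proof -
      have "(\<integral>z. (F k (snd z) *\<^sub>R weak_gradient \<Omega>1 (E j) (fst z)) \<bullet> ?X z \<partial>\<mu>)
          = dirichlet_form \<Omega>1 e (E j) * L2_inner \<mu>2 (F k) s"
        unfolding A_def integral_inner_tensor[OF ED(3) eD(3) FD(1) sD(1)]
        by (simp add: dirichlet_form_def L2_inner_def inner_commute)
      also have "\<dots> = lam * (L2_inner \<mu>1 (E j) e * L2_inner \<mu>2 (F k) s)"
        using e(2)[OF E] by (simp add: L2_inner_def mult.commute)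
      also have "\<dots> = lam * L2_inner \<mu> (tensor_fun (E j) (F k)) (tensor_fun e s)"
        by (simp only: L2_inner_tensor[OF ED(1) eD(1) FD(1) sD(1)])
      finally show ?thesis by (simp add: L2_inner_def)
    qed
    have "(\<integral>z. fst (g n z) \<bullet> ?X z \<partial>\<mu>) = lam * (\<integral>z. S n z \<bullet> tensor_fun e s z \<partial>\<mu>)" for n
    proof -
      have "(\<integral>z. fst (g n z) \<bullet> ?X z \<partial>\<mu>)
          = (\<integral>z. (\<Sum>i\<in>I n. c i * ((F (snd i) (snd z) *\<^sub>R weak_gradient \<Omega>1 (E (fst i)) (fst z)) \<bullet> ?X z)) \<partial>\<mu>)"
        by (simp add: g_def fst_sum tensor_gradient_def inner_sum_left sum_distrib_left ac_simps)
      also have "\<dots> = (\<Sum>i\<in>I n. \<integral>z. c i * ((F (snd i) (snd z) *\<^sub>R weak_gradient \<Omega>1 (E (fst i)) (fst z)) \<bullet> ?X z) \<partial>\<mu>)"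
        by (intro Bochner_Integration.integral_sum integrable_mult_right square_integrable_inner Xsi
            square_integrable_tensor ED(3) FD(1))
      also have "\<dots> = (\<Sum>i\<in>I n. c i * (lam * (\<integral>z. tensor_fun (E (fst i)) (F (snd i)) z * tensor_fun e s z \<partial>\<mu>)))"
        by (simp only: integral_mult_right_zero summand)
      also have "\<dots> = lam * (\<Sum>i\<in>I n. \<integral>z. c i * (tensor_fun (E (fst i)) (F (snd i)) z * tensor_fun e s z) \<partial>\<mu>)"
        by (simp add: sum_distrib_left ac_simps)
      also have "(\<Sum>i\<in>I n. \<integral>z. c i * (tensor_fun (E (fst i)) (F (snd i)) z * tensor_fun e s z) \<partial>\<mu>)
          = (\<integral>z. (\<Sum>i\<in>I n. c i * (tensor_fun (E (fst i)) (F (snd i)) z * tensor_fun e s z)) \<partial>\<mu>)"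
        by (intro Bochner_Integration.integral_sum[symmetric] integrable_mult_right square_integrable_mult
            tensor_gradient(3) EH1 eH1 F s(1))
      finally show ?thesis by (simp add: S_def sum_distrib_right mult.assoc)
    qed
    moreover have "(\<lambda>n. lam * (\<integral>z. S n z \<bullet> tensor_fun e s z \<partial>\<mu>)) \<longlonglongrightarrow> lam * (\<integral>z. h z \<bullet> tensor_fun e s z \<partial>\<mu>)"
      by (intro tendsto_mult tendsto_const L2_converges_inner[OF S] tensor_gradient(3) eH1 s(1))
    ultimately show "(\<lambda>n. \<integral>z. fst (g n z) \<bullet> ?X z \<partial>\<mu>) \<longlonglongrightarrow> lam * L2_inner \<mu> (tensor_fun e s) h"
      by (simp add: L2_inner_def mult.commute)
  qed
  \<comment> \<open>The derivative in the second variable is read off from almost every slice \<open>h (x, -)\<close>, where the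
    Steklov equation produces the boundary form.\<close>
  also have "(\<integral>z. ?Y z \<bullet> snd (G z) \<partial>\<mu>) = del * dsl_boundary_form \<Omega>1 \<Omega>2 b (tensor_fun e s) h"
  proof -
    obtain r :: "nat \<Rightarrow> nat" where r: "AE x in \<mu>1. L2_converges \<mu>2 (\<lambda>n y. (S (r n) (x, y), snd (g (r n) (x, y)))) (\<lambda>y. (h (x, y), snd (G (x, y))))"
      using AE_L2_converges_slice[OF L2_converges_Pair[OF S sndG]] by blast
    have slice: "h_slice \<in> H1 \<Omega>2 \<and> dirichlet_form \<Omega>2 s h_slice = (\<integral>y. B y \<bullet> G_slice y \<partial>\<mu>2)"
      if conv: "L2_converges \<mu>2 (\<lambda>n y. (S (r n) (x, y), snd (g (r n) (x, y)))) (\<lambda>y. (h_slice y, G_slice y))"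
      for x h_slice G_slice
    proof -
      have convS: "L2_converges \<mu>2 (\<lambda>n y. S (r n) (x, y)) h_slice"
        and convg: "L2_converges \<mu>2 (\<lambda>n y. snd (g (r n) (x, y))) G_slice"
        using L2_converges_linear_image[OF conv bounded_linear_fst] L2_converges_linear_image[OF conv bounded_linear_snd]
        by simp_all
      have "has_weak_gradient \<Omega>2 (\<lambda>y. S m (x, y)) (\<lambda>y. snd (g m (x, y)))" for m
      proof -
        have "has_weak_gradient \<Omega>2 (\<lambda>y. \<Sum>i\<in>I m. (c i * E (fst i) x) * F (snd i) y)
            (\<lambda>y. \<Sum>i\<in>I m. (c i * E (fst i) x) *\<^sub>R weak_gradient \<Omega>2 (F (snd i)) y)"
          by (rule has_weak_gradient_sum[OF open2 bounded2]) (rule FD)+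
        then show ?thesis
          by (simp add: S_def g_def tensor_fun_def tensor_gradient_def snd_sum mult.assoc)
      qed
      then have wg: "has_weak_gradient \<Omega>2 h_slice G_slice"
        by (rule has_weak_gradient_L2_limit[OF open2 bounded2 convS convg])
      have si: "square_integrable \<mu>2 h_slice" "square_integrable \<mu>2 G_slice"
        using convS convg by (auto simp: L2_converges_def)
      show ?thesis
        using H1_I[OF si(1) wg si(2)] dirichlet_form_eq[OF open2 sD(2,3) wg si(2)] by (simp add: B_def)
    qed
    have int: "integrable \<mu> (\<lambda>z. ?Y z \<bullet> snd (G z))" by (rule square_integrable_inner[OF Ysi Gsi'(2)])
    have ae: "AE x in \<mu>1. (\<integral>y. ?Y (x, y) \<bullet> snd (G (x, y)) \<partial>\<mu>2)
        = del * boundary_form \<Omega>2 b (\<lambda>y. tensor_fun e s (x, y)) (\<lambda>y. h (x, y))"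
      using r
    proof eventually_elim
      case (elim x)
      note slice[OF elim]
      then have "(\<integral>y. B y \<bullet> snd (G (x, y)) \<partial>\<mu>2) = del * boundary_form \<Omega>2 b s (\<lambda>y. h (x, y))"
        and "(\<lambda>y. h (x, y)) \<in> H1 \<Omega>2" using s(2) by auto
      then show ?case using scale[of "\<lambda>y. h (x, y)" "e x"] by (simp add: tensor_fun_def)
    qed
    have "(\<integral>z. ?Y z \<bullet> snd (G z) \<partial>\<mu>) = (\<integral>x. \<integral>y. ?Y (x, y) \<bullet> snd (G (x, y)) \<partial>\<mu>2 \<partial>\<mu>1)"
      by (rule integral_lebesgue_on_fst[OF sets1 sets2 sets_product int, symmetric])
    also have "\<dots> = (\<integral>x. del * boundary_form \<Omega>2 b (\<lambda>y. tensor_fun e s (x, y)) (\<lambda>y. h (x, y)) \<partial>\<mu>1)"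
      by (rule integral_lebesgue_on_AE[OF sets1 _ ae])
        (rule borel_measurable_integrable[OF integrable_lebesgue_on_fst[OF sets1 sets2 sets_product int]])
    finally show ?thesis by (simp add: dsl_boundary_form_def)
  qed
  finally show ?thesis .
qed

end

section \<open>Orthonormal bases of the Sobolev spaces\<close>

lemma (in semi_inner_space) independent_if_orthonormal:
  fixes w :: "nat \<Rightarrow> 'x \<Rightarrow> real"
  assumes w: "\<And>i. w i \<in> X" "\<And>i j. ip (w i) (w j) = (if i = j then 1 else 0)"
    and a: "\<exists>i\<le>n. a i \<noteq> 0"
  shows "0 < ip (\<lambda>x. \<Sum>i\<le>n. a i * w i x) (\<lambda>x. \<Sum>i\<le>n. a i * w i x)"
proof -
  have "orthonormal_upto (Suc n) w" using w by (simp add: orthonormal_upto_def)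
  then have "ip (\<lambda>x. \<Sum>i\<le>n. a i * w i x) (\<lambda>x. \<Sum>i\<le>n. a i * w i x) = (\<Sum>i\<le>n. (a i)\<^sup>2)"
    using ip_orthonormal_sum[of "Suc n" w a] by (simp add: lessThan_Suc_atMost)
  moreover obtain i where "i \<le> n" "a i \<noteq> 0" using a by blast
  then have "0 < (\<Sum>i\<le>n. (a i)\<^sup>2)" by (intro sum_pos2[of _ i]) auto
  ultimately show ?thesis by simp
qed

lemma H1_diff:
  assumes \<Omega>: "open \<Omega>" "bounded \<Omega>" and u: "u \<in> H1 \<Omega>" and v: "v \<in> H1 \<Omega>"
  shows "(\<lambda>x. u x - v x) \<in> H1 \<Omega>"
    and "dirichlet_form \<Omega> (\<lambda>x. u x - v x) (\<lambda>x. u x - v x)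
      = (\<integral>x. (norm (weak_gradient \<Omega> u x - weak_gradient \<Omega> v x))\<^sup>2 \<partial>lebesgue_on \<Omega>)"
proof -
  show "(\<lambda>x. u x - v x) \<in> H1 \<Omega>" using H1_lin(1)[OF \<Omega> u v, of 1 "-1"] by simp
  have wg: "has_weak_gradient \<Omega> (\<lambda>x. u x - v x) (\<lambda>x. weak_gradient \<Omega> u x - weak_gradient \<Omega> v x)"
    using H1_lin(2)[OF \<Omega> u v, of 1 "-1"] by simp
  have si: "square_integrable (lebesgue_on \<Omega>) (\<lambda>x. weak_gradient \<Omega> u x - weak_gradient \<Omega> v x)"
    by (intro square_integrable_diff H1_D(3) \<Omega> u v)
  show "dirichlet_form \<Omega> (\<lambda>x. u x - v x) (\<lambda>x. u x - v x)
      = (\<integral>x. (norm (weak_gradient \<Omega> u x - weak_gradient \<Omega> v x))\<^sup>2 \<partial>lebesgue_on \<Omega>)"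
    using dirichlet_form_eq[OF \<Omega>(1) wg si wg si] by (simp add: power2_norm_eq_inner)
qed

text \<open>
  The gradient embeds \<open>H10\<close> isometrically into a space of square-integrable functions, which yields a
  dense sequence for the Gram-Schmidt process.
\<close>

lemma H10_orthonormal_basis_from:
  assumes \<Omega>: "open \<Omega>" "bounded \<Omega>"
    and w: "\<And>i :: nat. w i \<in> H10 \<Omega>" "\<And>i j. dirichlet_form \<Omega> (w i) (w j) = (if i = j then 1 else 0)"
  shows "\<exists>e. orthonormal_basis (H10 \<Omega>) (dirichlet_form \<Omega>) e \<and> e 0 = w k"
proof -
  interpret D: semi_inner_space "H10 \<Omega>" "dirichlet_form \<Omega>"
    using w(1) by (intro semi_inner_space_H10[OF \<Omega>]) blast
  have sub: "u \<in> H10 \<Omega> \<Longrightarrow> u \<in> H1 \<Omega>" for u using H10_subset_H1 by blast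
  obtain d :: "nat \<Rightarrow> 'a \<Rightarrow> real" where d: "\<And>n. d n \<in> H10 \<Omega>"
    "\<And>u \<epsilon>. u \<in> H10 \<Omega> \<Longrightarrow> 0 < \<epsilon> \<Longrightarrow>
      \<exists>n. (\<integral>x. (norm (weak_gradient \<Omega> u x - weak_gradient \<Omega> (d n) x))\<^sup>2 \<partial>lebesgue_on \<Omega>) < \<epsilon>"
    using exists_dense_sequence[OF lmeasurable_open_bounded[OF \<Omega>] D.nonempty, of "weak_gradient \<Omega>"]
      H1_D(3)[OF \<Omega>(1) sub] by blast
  show ?thesis
  proof (rule D.exists_orthonormal_basis_from)
    show "w k \<in> H10 \<Omega>" "dirichlet_form \<Omega> (w k) (w k) = 1" using w by auto
    show "d n \<in> H10 \<Omega>" for n by (rule d(1))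
    show "\<exists>n. dirichlet_form \<Omega> (\<lambda>x. u x - d n x) (\<lambda>x. u x - d n x) < \<epsilon>" if "u \<in> H10 \<Omega>" "0 < \<epsilon>" for u \<epsilon>
      using d(2)[OF that] by (simp only: H1_diff(2)[OF \<Omega> sub[OF that(1)] sub[OF d(1)]])
    show "\<exists>x\<in>H10 \<Omega>. 0 < dirichlet_form \<Omega> (D.residual n e x) (D.residual n e x)" if "D.orthonormal_upto n e" for n e
      using D.exists_positive_residual[OF w(1) D.independent_if_orthonormal[OF w] that] .
  qed
qed

text \<open>
  Here the isometry is \<open>u \<mapsto> (u, \<nabla>u)\<close>. A sequence that is orthonormal for the smaller Dirichlet form is
  independent for the \<open>H1\<close> inner product, which excludes finite dimension.
\<close>

lemma H1_orthonormal_basis_from: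
  assumes \<Omega>: "open \<Omega>" "bounded \<Omega>"
    and w: "\<And>i :: nat. w i \<in> H1 \<Omega>" "\<And>i j. dirichlet_form \<Omega> (w i) (w j) = (if i = j then 1 else 0)"
    and v: "v \<in> H1 \<Omega>" "H1_inner \<Omega> v v = 1"
  shows "\<exists>f. orthonormal_basis (H1 \<Omega>) (H1_inner \<Omega>) f \<and> f 0 = v"
proof -
  interpret D: semi_inner_space "H1 \<Omega>" "dirichlet_form \<Omega>" by (rule semi_inner_space_dirichlet[OF \<Omega>])
  interpret H: semi_inner_space "H1 \<Omega>" "H1_inner \<Omega>" by (rule semi_inner_space_H1[OF \<Omega>])
  define T where "T u x = (u x, weak_gradient \<Omega> u x)" for u :: "'a \<Rightarrow> real" and x
  have T: "square_integrable (lebesgue_on \<Omega>) (T u)" if "u \<in> H1 \<Omega>" for u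
    unfolding T_def[abs_def] by (rule square_integrable_Pair[OF H1_D(1,3)[OF \<Omega>(1) that]])
  have dist: "H1_inner \<Omega> (\<lambda>x. u x - u' x) (\<lambda>x. u x - u' x) = (\<integral>x. (norm (T u x - T u' x))\<^sup>2 \<partial>lebesgue_on \<Omega>)"
    if u: "u \<in> H1 \<Omega>" and u': "u' \<in> H1 \<Omega>" for u u'
    using integral_norm_Pair[OF square_integrable_diff[OF H1_D(1)[OF \<Omega>(1) u] H1_D(1)[OF \<Omega>(1) u']]
        square_integrable_diff[OF H1_D(3)[OF \<Omega>(1) u] H1_D(3)[OF \<Omega>(1) u']]]
    by (simp only: H1_inner_def H1_diff(2)[OF \<Omega> u u'] L2_inner_self T_def diff_Pair)
  obtain d :: "nat \<Rightarrow> 'a \<Rightarrow> real" where d: "\<And>n. d n \<in> H1 \<Omega>"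
    "\<And>u \<epsilon>. u \<in> H1 \<Omega> \<Longrightarrow> 0 < \<epsilon> \<Longrightarrow> \<exists>n. (\<integral>x. (norm (T u x - T (d n) x))\<^sup>2 \<partial>lebesgue_on \<Omega>) < \<epsilon>"
    using exists_dense_sequence[of \<Omega> "H1 \<Omega>" T, OF lmeasurable_open_bounded[OF \<Omega>] D.nonempty T] by blast
  show ?thesis
  proof (rule H.exists_orthonormal_basis_from)
    show "v \<in> H1 \<Omega>" "H1_inner \<Omega> v v = 1" by fact+
    show "d n \<in> H1 \<Omega>" for n by (rule d(1))
    show "\<exists>n. H1_inner \<Omega> (\<lambda>x. u x - d n x) (\<lambda>x. u x - d n x) < \<epsilon>" if "u \<in> H1 \<Omega>" "0 < \<epsilon>" for u \<epsilon>
      using d(2)[OF that] by (simp only: dist[OF that(1) d(1)])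
    have indep: "0 < H1_inner \<Omega> (\<lambda>x. \<Sum>i\<le>n. a i * w i x) (\<lambda>x. \<Sum>i\<le>n. a i * w i x)"
      if "\<exists>i\<le>n. a i \<noteq> 0" for n and a :: "nat \<Rightarrow> real"
    proof -
      have "0 \<le> L2_inner (lebesgue_on \<Omega>) (\<lambda>x. \<Sum>i\<le>n. a i * w i x) (\<lambda>x. \<Sum>i\<le>n. a i * w i x)"
        unfolding L2_inner_self by (rule Bochner_Integration.integral_nonneg) simp
      then show ?thesis using D.independent_if_orthonormal[OF w that] by (simp add: H1_inner_def)
    qed
    show "\<exists>x\<in>H1 \<Omega>. 0 < H1_inner \<Omega> (H.residual n e x) (H.residual n e x)" if "H.orthonormal_upto n e" for n e
      using H.exists_positive_residual[OF w(1) indep that] .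
  qed
qed

section \<open>Poincare inequality, Steklov eigenfunctions and traces\<close>

lemma dirichlet_eigendataD:
  assumes "dirichlet_eigendata \<Omega> lam e"
  shows "0 < lam j" "e j \<in> H10 \<Omega>" "\<And>v. v \<in> H10 \<Omega> \<Longrightarrow> dirichlet_form \<Omega> (e j) v = lam j * L2_inner (lebesgue_on \<Omega>) (e j) v"
    "L2_inner (lebesgue_on \<Omega>) (e i) (e j) = (if i = j then 1 else 0)" "e j \<in> L2 (lebesgue_on \<Omega>)"
    "filterlim lam at_top sequentially"
    "\<And>u. u \<in> L2 (lebesgue_on \<Omega>) \<Longrightarrow> (\<lambda>n. let r = (\<lambda>x. u x - (\<Sum>j<n. L2_inner (lebesgue_on \<Omega>) u (e j) * e j x))
      in sqrt (L2_inner (lebesgue_on \<Omega>) r r)) \<longlonglongrightarrow> 0"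
  using assms unfolding dirichlet_eigendata_def dirichlet_eigenpair_def orthonormal_basis_def by blast+

lemma normalized_dirichlet_eigenfunctions:
  assumes \<Omega>: "open \<Omega>" "bounded \<Omega>" and ed: "dirichlet_eigendata \<Omega> lam e"
  shows "(\<lambda>x. (1 / sqrt (lam i)) * e i x) \<in> H10 \<Omega>"
    and "dirichlet_form \<Omega> (\<lambda>x. (1 / sqrt (lam i)) * e i x) (\<lambda>x. (1 / sqrt (lam j)) * e j x) = (if i = j then 1 else 0)"
proof -
  note E = dirichlet_eigendataD[OF ed]
  interpret D: semi_inner_space "H10 \<Omega>" "dirichlet_form \<Omega>"
    using E(2) by (intro semi_inner_space_H10[OF \<Omega>]) blast
  show w: "(\<lambda>x. (1 / sqrt (lam i)) * e i x) \<in> H10 \<Omega>" for i by (rule D.scale_mem[OF E(2)])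
  have "dirichlet_form \<Omega> (\<lambda>x. (1 / sqrt (lam i)) * e i x) (\<lambda>x. (1 / sqrt (lam j)) * e j x)
      = (1 / sqrt (lam i)) * ((1 / sqrt (lam j)) * dirichlet_form \<Omega> (e j) (e i))"
    by (simp only: D.ip_scale[OF E(2) w] D.ip_sym[OF E(2)[of i] w] D.ip_scale[OF E(2) E(2)])
  then show "dirichlet_form \<Omega> (\<lambda>x. (1 / sqrt (lam i)) * e i x) (\<lambda>x. (1 / sqrt (lam j)) * e j x) = (if i = j then 1 else 0)"
    using E(1)[of i] by (cases "i = j") (simp_all add: E(3)[OF E(2)] E(4))
qed

text \<open>
  The Poincare inequality with the reciprocal of a lower bound of the eigenvalues: Bessel's inequality
  for the Dirichlet form reads \<open>\<Sum> \<lambda>\<^sub>j \<langle>u, e\<^sub>j\<rangle>\<^sup>2 \<le> \<parallel>\<nabla>u\<parallel>\<^sup>2\<close>, and Parseval's identity in \<open>L2\<close> compares the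
  left side with \<open>\<parallel>u\<parallel>\<^sup>2\<close>.
\<close>

lemma poincare_inequality:
  assumes \<Omega>: "open \<Omega>" "bounded \<Omega>" and ed: "dirichlet_eigendata \<Omega> lam e"
  shows "\<exists>C. \<forall>u\<in>H10 \<Omega>. L2_inner (lebesgue_on \<Omega>) u u \<le> C * dirichlet_form \<Omega> u u"
proof -
  note E = dirichlet_eigendataD[OF ed] and W = normalized_dirichlet_eigenfunctions[OF \<Omega> ed]
  interpret D: semi_inner_space "H10 \<Omega>" "dirichlet_form \<Omega>"
    using E(2) by (intro semi_inner_space_H10[OF \<Omega>]) blast
  interpret L: semi_inner_space "L2 (lebesgue_on \<Omega>)" "L2_inner (lebesgue_on \<Omega>)" by (rule semi_inner_space_L2)
  obtain N where N: "\<And>j. j \<ge> N \<Longrightarrow> 1 \<le> lam j"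
    using E(6) unfolding filterlim_at_top eventually_sequentially by blast
  define m where "m = Min (insert 1 (lam ` {..<N}))"
  have m_pos: "0 < m" using E(1) by (auto simp: m_def)
  have m_le: "m \<le> lam j" for j
  proof (cases "j < N")
    case True
    then show ?thesis by (auto simp: m_def intro!: Min_le)
  next
    case False
    have "m \<le> 1" by (auto simp: m_def intro!: Min_le)
    then show ?thesis using N[of j] False by simp
  qed
  have "L2_inner (lebesgue_on \<Omega>) u u \<le> (1 / m) * dirichlet_form \<Omega> u u" if u: "u \<in> H10 \<Omega>" for u
  proof -
    have uL: "u \<in> L2 (lebesgue_on \<Omega>)" using u H10_subset_H1 by (auto simp: H1_def)
    have ou: "L.orthonormal_upto n e" for n using E(4,5) by (simp add: L.orthonormal_upto_def)
    have od: "D.orthonormal_upto n (\<lambda>i x. (1 / sqrt (lam i)) * e i x)" for n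
      using W by (simp only: D.orthonormal_upto_def) simp
    have coeff: "(dirichlet_form \<Omega> u (\<lambda>x. (1 / sqrt (lam j)) * e j x))\<^sup>2 = lam j * (L2_inner (lebesgue_on \<Omega>) u (e j))\<^sup>2" for j
    proof -
      have "dirichlet_form \<Omega> u (\<lambda>x. (1 / sqrt (lam j)) * e j x) = (1 / sqrt (lam j)) * (lam j * L2_inner (lebesgue_on \<Omega>) (e j) u)"
        by (simp only: D.ip_sym[OF u W(1)] D.ip_scale[OF E(2) u] E(3)[OF u])
      then have "(dirichlet_form \<Omega> u (\<lambda>x. (1 / sqrt (lam j)) * e j x))\<^sup>2
          = (1 / lam j) * ((lam j)\<^sup>2 * (L2_inner (lebesgue_on \<Omega>) u (e j))\<^sup>2)"
        using E(1)[of j] by (simp add: power_mult_distrib power_divide L.ip_sym[OF uL E(5)])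
      then show ?thesis using E(1)[of j] by (simp add: power2_eq_square)
    qed
    let ?r = "\<lambda>n. L2_inner (lebesgue_on \<Omega>) (L.residual n e u) (L.residual n e u)"
    have le: "L2_inner (lebesgue_on \<Omega>) u u \<le> ?r n + (1 / m) * dirichlet_form \<Omega> u u" for n
    proof -
      have "m * (\<Sum>j<n. (L2_inner (lebesgue_on \<Omega>) u (e j))\<^sup>2) \<le> (\<Sum>j<n. lam j * (L2_inner (lebesgue_on \<Omega>) u (e j))\<^sup>2)"
        unfolding sum_distrib_left using m_le by (intro sum_mono mult_right_mono) auto
      also have "\<dots> \<le> dirichlet_form \<Omega> u u"
        using D.bessel[OF od u, of n] by (simp only: coeff)
      finally have "(\<Sum>j<n. (L2_inner (lebesgue_on \<Omega>) u (e j))\<^sup>2) \<le> (1 / m) * dirichlet_form \<Omega> u u"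
        using m_pos by (simp add: field_simps)
      then show ?thesis using L.ip_residual[OF ou uL, of n] by simp
    qed
    have "(\<lambda>n. sqrt (?r n)) \<longlonglongrightarrow> 0"
      using E(7)[OF uL] by (simp add: Let_def L.residual_def)
    then have "(\<lambda>n. (sqrt (?r n))\<^sup>2) \<longlonglongrightarrow> 0\<^sup>2" by (rule tendsto_power)
    then have "?r \<longlonglongrightarrow> 0" using L.ip_nonneg[OF L.residual_mem[OF ou uL]] by simp
    then have "(\<lambda>n. ?r n + (1 / m) * dirichlet_form \<Omega> u u) \<longlonglongrightarrow> 0 + (1 / m) * dirichlet_form \<Omega> u u"
      by (intro tendsto_add tendsto_const)
    then have "L2_inner (lebesgue_on \<Omega>) u u \<le> 0 + (1 / m) * dirichlet_form \<Omega> u u"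
      by (rule LIMSEQ_le_const) (use le in blast)
    then show ?thesis by simp
  qed
  then show ?thesis by blast
qed

lemma steklov_eigendataD:
  assumes "steklov_eigendata \<Omega> b del s"
  shows "s k \<in> H1 \<Omega>" "nonzero_on \<Omega> (s k)" "\<And>v. v \<in> H1 \<Omega> \<Longrightarrow> dirichlet_form \<Omega> (s k) v = del k * boundary_form \<Omega> b (s k) v"
    "1 \<le> k \<Longrightarrow> 0 < del k" "1 \<le> k \<Longrightarrow> 1 \<le> l \<Longrightarrow> steklov_inner \<Omega> b (s k) (s l) = (if k = l then 1 else 0)"
proof -
  have pair: "steklov_eigenpair \<Omega> b (del k) (s k)" for k
    using assms unfolding steklov_eigendata_def by (elim conjE) (erule spec)
  show "s k \<in> H1 \<Omega>" "nonzero_on \<Omega> (s k)" using pair[of k] by (auto simp: steklov_eigenpair_def)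
  show "dirichlet_form \<Omega> (s k) v = del k * boundary_form \<Omega> b (s k) v" if "v \<in> H1 \<Omega>" for v
    using pair[of k] that by (simp add: steklov_eigenpair_def)
  show "0 < del k" if "1 \<le> k"
    using assms that unfolding steklov_eigendata_def by (elim conjE) simp
  show "steklov_inner \<Omega> b (s k) (s l) = (if k = l then 1 else 0)" if "1 \<le> k" "1 \<le> l"
    using assms that unfolding steklov_eigendata_def by (elim conjE) simp
qed

text \<open>
  On Steklov eigenfunctions the Dirichlet form is \<open>\<delta>\<close> times the boundary form, and the sum of both is
  normalized; so the squared Dirichlet norm of \<open>s\<^sub>k\<close> is \<open>\<delta>\<^sub>k / (1 + \<delta>\<^sub>k)\<close>, which is positive for \<open>k \<ge> 1\<close>.
\<close>

lemma normalized_steklov_eigenfunctions: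
  assumes \<Omega>: "open \<Omega>" "bounded \<Omega>" and sd: "steklov_eigendata \<Omega> b del s"
  shows "\<exists>w :: nat \<Rightarrow> 'a::euclidean_space \<Rightarrow> real. (\<forall>i. w i \<in> H1 \<Omega>) \<and>
    (\<forall>i j. dirichlet_form \<Omega> (w i) (w j) = (if i = j then 1 else 0))"
proof -
  note S = steklov_eigendataD[OF sd]
  interpret D: semi_inner_space "H1 \<Omega>" "dirichlet_form \<Omega>" by (rule semi_inner_space_dirichlet[OF \<Omega>])
  \<comment> \<open>The index is shifted because the constant eigenfunction has zero Dirichlet norm.\<close>
  define \<kappa> where "\<kappa> i = del (Suc i) / (1 + del (Suc i))" for i
  have pos: "0 < del (Suc i)" for i by (rule S(4)) simp
  have \<kappa>: "0 < \<kappa> i" for i unfolding \<kappa>_def using pos[of i] by (intro divide_pos_pos) auto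
  have form: "dirichlet_form \<Omega> (s (Suc i)) (s (Suc j)) = (if i = j then \<kappa> i else 0)" for i j
  proof -
    let ?D = "dirichlet_form \<Omega> (s (Suc i)) (s (Suc j))" and ?B = "boundary_form \<Omega> b (s (Suc i)) (s (Suc j))"
    have "?D = del (Suc i) * ?B" by (rule S(3)[OF S(1)])
    moreover have "?D + ?B = (if i = j then 1 else 0)"
      using S(5)[of "Suc i" "Suc j"] by (simp add: steklov_inner_def)
    ultimately have "?D * (1 + del (Suc i)) = del (Suc i) * (if i = j then 1 else 0)" by algebra
    then have "?D = del (Suc i) * (if i = j then 1 else 0) / (1 + del (Suc i))"
      using pos[of i] by (subst eq_divide_eq) simp
    then show ?thesis by (simp add: \<kappa>_def)
  qed
  define w where "w i = (\<lambda>x. (1 / sqrt (\<kappa> i)) * s (Suc i) x)" for i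
  have w: "w i \<in> H1 \<Omega>" for i unfolding w_def by (rule D.scale_mem[OF S(1)])
  have "dirichlet_form \<Omega> (w i) (w j) = (1 / sqrt (\<kappa> i)) * ((1 / sqrt (\<kappa> j)) * dirichlet_form \<Omega> (s (Suc j)) (s (Suc i)))" for i j
  proof -
    have "dirichlet_form \<Omega> (w i) (w j) = (1 / sqrt (\<kappa> i)) * dirichlet_form \<Omega> (s (Suc i)) (w j)"
      unfolding w_def[of i] by (rule D.ip_scale[OF S(1) w])
    also have "dirichlet_form \<Omega> (s (Suc i)) (w j) = dirichlet_form \<Omega> (w j) (s (Suc i))" by (rule D.ip_sym[OF S(1) w])
    also have "\<dots> = (1 / sqrt (\<kappa> j)) * dirichlet_form \<Omega> (s (Suc j)) (s (Suc i))"
      unfolding w_def by (rule D.ip_scale[OF S(1) S(1)])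
    finally show ?thesis .
  qed
  then have "dirichlet_form \<Omega> (w i) (w j) = (if i = j then 1 else 0)" for i j
    using \<kappa>[of i] by (cases "i = j") (simp_all add: form)
  then show ?thesis using w by blast
qed

lemma L2_inner_pos_iff_nonzero_on:
  assumes "square_integrable (lebesgue_on \<Omega>) u"
  shows "0 < L2_inner (lebesgue_on \<Omega>) u u \<longleftrightarrow> nonzero_on \<Omega> u"
proof -
  have "L2_inner (lebesgue_on \<Omega>) u u = 0 \<longleftrightarrow> (AE x in lebesgue_on \<Omega>. u x = 0)"
    unfolding L2_inner_self using square_integrableD(2)[OF assms]
    by (subst integral_nonneg_eq_0_iff_AE) auto
  moreover have "0 \<le> L2_inner (lebesgue_on \<Omega>) u u"
    unfolding L2_inner_self by (rule Bochner_Integration.integral_nonneg) simp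
  ultimately show ?thesis by (auto simp: nonzero_on_def)
qed

lemma boundary_form_scale:
  assumes B2: "cond_B2 \<Omega>" and B3: "cond_B3 \<Omega> b" and \<Omega>: "open \<Omega>" "bounded \<Omega>"
    and u: "u \<in> H1 \<Omega>" and v: "v \<in> H1 \<Omega>"
  shows "boundary_form \<Omega> b (\<lambda>y. a * u y) v = a * boundary_form \<Omega> b u v"
proof -
  let ?\<sigma> = "surface_measure \<Omega>"
  interpret D: semi_inner_space "H1 \<Omega>" "dirichlet_form \<Omega>" by (rule semi_inner_space_dirichlet[OF \<Omega>])
  have tm: "is_trace_map \<Omega> (trace_map \<Omega>)"
  proof -
    have "\<exists>\<gamma>. is_trace_map \<Omega> \<gamma>" using B2 by (simp add: cond_B2_def)
    then show ?thesis unfolding trace_map_def by (rule someI_ex)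
  qed
  have tL: "trace_map \<Omega> w \<in> borel_measurable ?\<sigma>" if "w \<in> H1 \<Omega>" for w
    using tm that by (auto simp: is_trace_map_def L2_def)
  have "sets (hausdorff_measure (DIM('a) - 1) :: 'a measure) = sets borel"
    unfolding hausdorff_measure_def by (simp add: sets.sigma_sets_eq[of borel, simplified])
  then have "sets ?\<sigma> = sets (restrict_space borel (bdry \<Omega>))"
    unfolding surface_measure_def by (rule sets_restrict_space_cong)
  then have b: "b \<in> borel_measurable ?\<sigma>"
    using B3 by (simp add: cond_B3_def cong: measurable_cong_sets)
  have "AE z in ?\<sigma>. trace_map \<Omega> (\<lambda>x. a * u x + 0 * v x) z = a * trace_map \<Omega> u z + 0 * trace_map \<Omega> v z"
    using tm u v unfolding is_trace_map_def by blast
  then have ae: "AE z in ?\<sigma>. b z * trace_map \<Omega> (\<lambda>x. a * u x) z * trace_map \<Omega> v z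
      = a * (b z * trace_map \<Omega> u z * trace_map \<Omega> v z)"
    by eventually_elim simp
  have "boundary_form \<Omega> b (\<lambda>y. a * u y) v = (\<integral>z. a * (b z * trace_map \<Omega> u z * trace_map \<Omega> v z) \<partial>?\<sigma>)"
    unfolding boundary_form_def
    by (rule integral_cong_AE[OF _ _ ae])
      (intro borel_measurable_times borel_measurable_const b tL u v D.scale_mem)+
  then show ?thesis by (simp add: boundary_form_def)
qed

text \<open>
  All coefficients vanish except the one at \<open>(0, 0)\<close>, so every finite sum that contains this index is
  already equal to the limit.
\<close>

lemma (in product_domain) tensor_in_dsl_space:
  assumes E: "orthonormal_basis (H10 \<Omega>1) (dirichlet_form \<Omega>1) E" "E 0 = (\<lambda>x. p * u x)" "p \<noteq> 0"
    and F: "orthonormal_basis (H1 \<Omega>2) (H1_inner \<Omega>2) F" "F 0 = (\<lambda>y. q * v y)" "q \<noteq> 0"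
    and uv: "square_integrable \<mu>1 u" "square_integrable \<mu>2 v"
  shows "tensor_fun u v \<in> dsl_space \<Omega>1 \<Omega>2"
proof -
  define c :: "nat \<times> nat \<Rightarrow> real" where "c i = (if i = (0, 0) then 1 / (p * q) else 0)" for i
  have "(\<lambda>i. (c i)\<^sup>2) summable_on {(0, 0)}" by simp
  then have summable: "(\<lambda>i. (c i)\<^sup>2) summable_on UNIV"
    by (subst summable_on_cong_neutral[of "{(0, 0)}" UNIV _ "\<lambda>i. (c i)\<^sup>2"]) (auto simp: c_def)
  have sum_eq: "(\<Sum>(j, k)\<in>X. c (j, k) * tensor_fun (E j) (F k) z) = tensor_fun u v z"
    if X: "finite X" "(0, 0) \<in> X" for X z
  proof -
    have "(\<Sum>(j, k)\<in>X. c (j, k) * tensor_fun (E j) (F k) z)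
        = (\<Sum>i\<in>X. if i = (0, 0) then 1 / (p * q) * tensor_fun (E 0) (F 0) z else 0)"
      by (intro sum.cong) (auto simp: c_def split: if_splits)
    also have "\<dots> = tensor_fun u v z"
      using X E(2,3) F(2,3) by (simp add: tensor_fun_def case_prod_beta')
    finally show ?thesis .
  qed
  have "\<forall>\<^sub>F X in finite_subsets_at_top UNIV. finite X \<and> {(0, 0)} \<subseteq> X"
    by (auto simp: eventually_finite_subsets_at_top intro!: exI[of _ "{(0, 0)}"])
  then have "\<forall>\<^sub>F X in finite_subsets_at_top UNIV. 0 = L2_norm \<mu> (\<lambda>z. tensor_fun u v z - (\<Sum>(j, k)\<in>X. c (j, k) * tensor_fun (E j) (F k) z))"
  proof eventually_elim
    case (elim X)
    then show ?case using sum_eq[of X] by (simp add: L2_norm_def L2_inner_def)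
  qed
  then have "((\<lambda>X. L2_norm \<mu> (\<lambda>z. tensor_fun u v z - (\<Sum>(j, k)\<in>X. c (j, k) * tensor_fun (E j) (F k) z))) \<longlongrightarrow> 0) (finite_subsets_at_top UNIV)"
    by (rule Lim_transform_eventually[OF tendsto_const])
  then show ?thesis
    unfolding dsl_space_def hilbert_tensor_def
    using E(1) F(1) summable square_integrable_tensor_fun[OF uv] by (auto simp: L2_iff_square_integrable)
qed

section \<open>Tensor products of eigenfunctions\<close>

theorem theorem10p2:
  fixes \<Omega>1 :: "'a::euclidean_space set" and \<Omega>2 :: "'b::euclidean_space set"
    and b2 :: "'b \<Rightarrow> real"
    and lam1 del2 :: "nat \<Rightarrow> real"
    and e1 :: "nat \<Rightarrow> 'a \<Rightarrow> real" and s2 :: "nat \<Rightarrow> 'b \<Rightarrow> real"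
  assumes "region \<Omega>1" and "cond_B1 \<Omega>1" and "cond_B2 \<Omega>1"
    and "region \<Omega>2" and "cond_B1 \<Omega>2" and "cond_B2 \<Omega>2"
    and "cond_B3 \<Omega>2 b2"
    and "dirichlet_eigendata \<Omega>1 lam1 e1"
    and "steklov_eigendata \<Omega>2 b2 del2 s2"
  shows "\<forall>j k. dsl_eigenfunction \<Omega>1 \<Omega>2 b2 (lam1 j, del2 k) (tensor_fun (e1 j) (s2 k))"
proof (intro allI)
  fix j k
  interpret product_domain \<Omega>1 \<Omega>2
    using assms(1,2,4,5) by unfold_locales (auto simp: region_def cond_B1_def)
  note E = dirichlet_eigendataD[OF assms(8)] and S = steklov_eigendataD[OF assms(9)]
  have e_H1: "e1 j \<in> H1 \<Omega>1" using E(2) H10_subset_H1 by blast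
  note eD = H1_D[OF open1 e_H1] and sD = H1_D[OF open2 S(1)[of k]]
  interpret H2: semi_inner_space "H1 \<Omega>2" "H1_inner \<Omega>2" by (rule semi_inner_space_H1[OF open2 bounded2])
  obtain C where poincare: "\<And>u. u \<in> H10 \<Omega>1 \<Longrightarrow> L2_inner \<mu>1 u u \<le> C * dirichlet_form \<Omega>1 u u"
    using poincare_inequality[OF open1 bounded1 assms(8)] by blast
  have s_pos: "0 < L2_inner \<mu>2 (s2 k) (s2 k)"
    using S(2) by (simp add: L2_inner_pos_iff_nonzero_on[OF sD(1)])
  have H_pos: "0 < H1_inner \<Omega>2 (s2 k) (s2 k)"
  proof -
    interpret D2: semi_inner_space "H1 \<Omega>2" "dirichlet_form \<Omega>2" by (rule semi_inner_space_dirichlet[OF open2 bounded2])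
    show ?thesis using s_pos D2.ip_nonneg[OF S(1)[of k]] by (simp add: H1_inner_def)
  qed
  obtain F0 where F0: "orthonormal_basis (H10 \<Omega>1) (dirichlet_form \<Omega>1) F0" "F0 0 = (\<lambda>x. (1 / sqrt (lam1 j)) * e1 j x)"
    using H10_orthonormal_basis_from[where w = "\<lambda>i x. (1 / sqrt (lam1 i)) * e1 i x" and k = j,
      OF open1 bounded1 normalized_dirichlet_eigenfunctions[OF open1 bounded1 assms(8)]] by blast
  define q where "q = 1 / sqrt (H1_inner \<Omega>2 (s2 k) (s2 k))"
  have unit: "H1_inner \<Omega>2 (\<lambda>y. q * s2 k y) (\<lambda>y. q * s2 k y) = 1"
    unfolding H2.ip_scale2[OF S(1)] using H_pos by (simp add: q_def power_divide)
  obtain w where w: "\<And>i :: nat. w i \<in> H1 \<Omega>2" "\<And>i j. dirichlet_form \<Omega>2 (w i) (w j) = (if i = j then 1 else 0)"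
    using normalized_steklov_eigenfunctions[OF open2 bounded2 assms(9)] by blast
  obtain G0 where G0: "orthonormal_basis (H1 \<Omega>2) (H1_inner \<Omega>2) G0" "G0 0 = (\<lambda>y. q * s2 k y)"
    using H1_orthonormal_basis_from[OF open2 bounded2 w H2.scale_mem[OF S(1)] unit] by blast
  have mem: "tensor_fun (e1 j) (s2 k) \<in> dsl_space \<Omega>1 \<Omega>2"
    by (rule tensor_in_dsl_space[OF F0 _ G0 _ eD(1) sD(1)]) (use E(1)[of j] H_pos in \<open>auto simp: q_def\<close>)
  have nonzero: "nonzero_on (\<Omega>1 \<times> \<Omega>2) (tensor_fun (e1 j) (s2 k))"
    using s_pos E(4)[of j j] L2_inner_tensor[OF eD(1) eD(1) sD(1) sD(1)]
    by (simp add: L2_inner_pos_iff_nonzero_on[OF tensor_gradient(3)[OF e_H1 S(1)], symmetric])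
  have "dirichlet_form (\<Omega>1 \<times> \<Omega>2) (tensor_fun (e1 j) (s2 k)) h
      = lam1 j * L2_inner \<mu> (tensor_fun (e1 j) (s2 k)) h
        + del2 k * dsl_boundary_form \<Omega>1 \<Omega>2 b2 (tensor_fun (e1 j) (s2 k)) h"
    if h: "h \<in> dsl_space \<Omega>1 \<Omega>2" for h
    using dsl_weak_form[OF E(2) E(3) S(1) S(3) boundary_form_scale[OF assms(6,7) open2 bounded2 S(1)] poincare h] .
  then show "dsl_eigenfunction \<Omega>1 \<Omega>2 b2 (lam1 j, del2 k) (tensor_fun (e1 j) (s2 k))"
    using mem nonzero by (simp add: dsl_eigenfunction_def)
qed

end
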